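(* Let $d\ge 2$ and let $P=\bigcup_{j=1}^J P_j\subseteq\mathbb{R}^d$ ($J\ge 1$) be a finite union of bounded convex $d$-dimensional polytopes $P_1,\dots,P_J$ with pairwise disjoint interiors. Then for every $a\in\mathbb{C}^d$ and every $R\in\mathbb{C}\setminus\{0\}$, the Fourier--Laplace transform $\widehat{\mathbf 1_P}$ of the indicator function of $P$ does not vanish identically on the complex sphere $C_{a,R}$. Consequently $P$ has the Pompeiu property.
   Context: For $x,y\in\mathbb{C}^d$ write $x\cdot y=x_1y_1+\cdots+x_dy_d$ (no conjugation). For a bounded measurable set $E\subseteq\mathbb{R}^d$, the Fourier--Laplace transform of its indicator function $\mathbf 1_E$ is the entire function $\widehat{\mathbf 1_E}(z)=\int_{E}e^{-2\pi i z\cdot x}\,dx$, $z\in\mathbb{C}^d$. For $a=(a_1,\dots,a_d)\in\mathbb{C}^d$ and $R\in\mathbb{C}\setminus\{0\}$, the complex sphere of center $a$ and radius $R$ is $C_{a,R}=\{z\in\mathbb{C}^d:(z_1-a_1)^2+\cdots+(z_d-a_d)^2=R^2\}$. A bounded measurable set $E\subseteq\mathbb{R}^d$ has the Pompeiu property if the only continuous function $f$ on $\mathbb{R}^d$ whose integrals over all congruent copies of $E$ (images of $E$ under isometries of $\mathbb{R}^d$) vanish is the zero function. *)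

theory Defs
  imports "HOL-Analysis.Analysis"
begin

text \<open>Bilinear, without conjugation (unlike the library's inner product).\<close>
definition cdot :: "complex ^ 'n \<Rightarrow> complex ^ 'n \<Rightarrow> complex" where
  "cdot x y = (\<Sum>i\<in>UNIV. x $ i * y $ i)"

definition of_real_vec :: "real ^ 'n \<Rightarrow> complex ^ 'n" where
  "of_real_vec x = (\<chi> i. complex_of_real (x $ i))"

definition fourier_laplace_indicator :: "(real ^ 'n) set \<Rightarrow> complex ^ 'n \<Rightarrow> complex" where
  "fourier_laplace_indicator E z =
     (LINT x:E|lebesgue. exp (- 2 * complex_of_real pi * \<i> * cdot z (of_real_vec x)))"

definition complex_sphere :: "complex ^ 'n \<Rightarrow> complex \<Rightarrow> (complex ^ 'n) set" where
  "complex_sphere a R = {z. (\<Sum>i\<in>UNIV. (z $ i - a $ i)\<^sup>2) = R\<^sup>2}"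

text \<open>All isometries are allowed, orientation-reversing ones included; on Euclidean space a
  distance-preserving self-map is automatically surjective.\<close>
definition euclidean_isometry :: "(real ^ 'n \<Rightarrow> real ^ 'n) \<Rightarrow> bool" where
  "euclidean_isometry T \<longleftrightarrow> (\<forall>x y. dist (T x) (T y) = dist x y)"

text \<open>Test functions are complex-valued; the real-valued variant is equivalent, by splitting into
  real and imaginary parts.\<close>
definition pompeiu_property :: "(real ^ 'n) set \<Rightarrow> bool" where
  "pompeiu_property E \<longleftrightarrow>
     bounded E \<and> E \<in> sets lebesgue \<and>
     (\<forall>f :: real ^ 'n \<Rightarrow> complex.
        continuous_on UNIV f \<longrightarrow>
        (\<forall>T. euclidean_isometry T \<longrightarrow> (LINT x:T ` E|lebesgue. f x) = 0) \<longrightarrow>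
        (\<forall>x. f x = 0))"

end

theory Submission
  imports Defs "HOL-Computational_Algebra.Fundamental_Theorem_Algebra"
begin

text \<open>Triangulate \<open>P\<close>. Integrating directional derivatives along the edges of each simplex gives
  a product \<open>Q\<close> of nonzero real linear forms, finitely many points \<open>v\<close> and homogeneous polynomials
  \<open>p\<^sub>v\<close> with \<open>\<integral>\<^sub>P Q(\<partial>) f = \<Sum>\<^sub>v (p\<^sub>v(\<partial>) f)(v)\<close> for all smooth \<open>f\<close>; letting
  \<open>\<epsilon> \<rightarrow> 0\<close> in \<open>f = exp (\<epsilon> z \<cdot> x)\<close> shows that the \<open>p\<^sub>v\<close> have no common zero off \<open>Q = 0\<close>.

  If the transform vanishes on a complex sphere, then \<open>\<Sum>\<^sub>v p\<^sub>v(z) exp (z \<cdot> v) = 0\<close> there. Differentiating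
  along a one-parameter rotation group multiplies \<open>exp (z \<cdot> v)\<close> by a rate depending on \<open>v\<close>, so
  that all points but one can be eliminated, which is a contradiction.

  For the Pompeiu property let \<open>W\<close> be the smooth functions with vanishing integrals over all copies.
  The same elimination, carried out with differential operators, yields an operator \<open>A(\<partial>) \<noteq> 0\<close>
  killing \<open>W\<close>. The operators killing \<open>W\<close> form a rotation-invariant ideal; raising operators turn
  \<open>A\<close> into \<open>\<zeta>\<^sup>K q(\<Delta>)\<close> with \<open>\<zeta> = \<partial>\<^sub>i + \<i> \<partial>\<^sub>j\<close>. Hence either \<open>\<zeta>\<close> is nilpotent on \<open>W\<close>, or \<open>W\<close>
  contains an eigenfunction of the Laplacian, and elimination over the corresponding complex sphere makes \<open>\<zeta>\<close>
  nilpotent on the eigenspace. As \<open>i, j\<close> are arbitrary, \<open>W\<close> contains a nonzero constant, which is absurd.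
  Mollification reduces continuous functions to smooth ones.\<close>


section \<open>Linear images of Lebesgue measure\<close>

text \<open>The usual passage from non-vanishing on spheres to the Pompeiu property goes through
  theorems on mean-periodic functions. Here both conclusions rest on a single algebraic elimination,
  run once for values of exponential sums and once for operators acting on \<open>W\<close>. It
  cross-multiplies two coefficients, which leaves a Wronskian; growth along orbits of the
  complexified rotation group shows that this is not zero. Two obstacles shape the argument.
  Coefficients have to be nonzero on the sphere and not just as polynomials, so non-vanishing always
  means \<open>\<not> vanishes \<Lambda>\<close>, and multiplying coefficients requires the
  irreducibility of \<open>U \<Lambda>\<close>. Moreover the vertices must differ in their
  \<open>i\<close>-th coordinates and no edge direction may be orthogonal to axis \<open>i\<close>;
  a generic rotation of the configuration arranges both. The set \<open>\<zeta> = 0\<close>, where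
  the orbit coordinates break down, is always left out. For operators this costs powers of \<zeta>,
  which is harmless since all that is wanted in the end is that \<zeta> be nilpotent.\<close>

text \<open>Fubini for \<open>M \<otimes> lborel\<close> and the indicator of \<open>{(x, y). y \<in> [0, 1]\<^sup>n, x + y \<in> A}\<close>. The library's
  determinant formula is not available for an index type that is merely finite.\<close>

lemma translation_invariant_eq_scaled_lborel:
  fixes M :: "'a::euclidean_space measure"
  assumes sets: "sets M = sets borel" and sf: "sigma_finite_measure M"
    and inv: "\<And>a. distr M borel (\<lambda>x. a + x) = M"
    and A: "A \<in> sets borel"
  shows "emeasure M A = emeasure M (uminus ` cbox 0 One) * emeasure lborel A"
proof -
  interpret M: sigma_finite_measure M by (rule sf)
  interpret P: pair_sigma_finite M "lborel :: 'a measure" 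
    by (intro pair_sigma_finite.intro sf sigma_finite_lborel)
  let ?B = "cbox 0 One :: 'a set"
  have [measurable_cong]: "sets M = sets borel" by (rule sets)
  have [measurable]: "A \<in> sets borel" by (rule A)
  have mi: "(\<integral>\<^sup>+x. f (a + x) \<partial>M) = (\<integral>\<^sup>+x. f x \<partial>M)" if [measurable]: "f \<in> borel_measurable borel" for f a
    by (subst (2) inv[of a, symmetric]) (simp add: nn_integral_distr)
  have li: "(\<integral>\<^sup>+x. f (a + x) \<partial>lborel) = (\<integral>\<^sup>+x. f x \<partial>lborel)" if [measurable]: "f \<in> borel_measurable borel" for f and a :: 'a
    by (subst (2) lborel_distr_plus[of a, symmetric]) (simp add: nn_integral_distr)
  have "emeasure M A = (\<integral>\<^sup>+y. indicator ?B y * (\<integral>\<^sup>+x. indicator A x \<partial>M) \<partial>lborel)"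
    by (subst nn_integral_multc) (auto simp: sets)
  also have "\<dots> = (\<integral>\<^sup>+y. indicator ?B y * (\<integral>\<^sup>+x. indicator A (y + x) \<partial>M) \<partial>lborel)"
    by (subst mi) auto
  also have "\<dots> = (\<integral>\<^sup>+y. \<integral>\<^sup>+x. indicator ?B y * indicator A (y + x) \<partial>M \<partial>lborel)"
    by (intro nn_integral_cong nn_integral_cmult[symmetric]) measurable
  also have "\<dots> = (\<integral>\<^sup>+x. \<integral>\<^sup>+y. indicator ?B y * indicator A (y + x) \<partial>lborel \<partial>M)"
    by (rule P.Fubini') measurable
  \<comment> \<open>Translating \<open>y\<close> by \<open>- x\<close> moves the dependence on
    \<open>x\<close> from \<open>A\<close> to the unit cube; the invariance of \<open>M\<close> then
    turns the \<open>x\<close>-integral into a constant.\<close>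
  also have "\<dots> = (\<integral>\<^sup>+x. \<integral>\<^sup>+y. indicator ?B (-x + y) * indicator A ((-x + y) + x) \<partial>lborel \<partial>M)"
    by (subst li[where f="\<lambda>y. indicator ?B y * indicator A (y + x)" for x]) auto
  also have "\<dots> = (\<integral>\<^sup>+x. \<integral>\<^sup>+y. indicator ?B (-x + y) * indicator A y \<partial>lborel \<partial>M)"
    by simp
  also have "\<dots> = (\<integral>\<^sup>+y. \<integral>\<^sup>+x. indicator ?B (-x + y) * indicator A y \<partial>M \<partial>lborel)"
    by (rule P.Fubini'[symmetric]) measurable
  also have "\<dots> = (\<integral>\<^sup>+y. (\<integral>\<^sup>+x. indicator ?B (-x + y) \<partial>M) * indicator A y \<partial>lborel)"
    by (intro nn_integral_cong nn_integral_multc) measurable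
  also have "\<dots> = (\<integral>\<^sup>+y. (\<integral>\<^sup>+x. indicator ?B (-x) \<partial>M) * indicator A y \<partial>lborel)"
  proof (intro nn_integral_cong)
    fix y :: 'a
    show "(\<integral>\<^sup>+x. indicator ?B (-x + y) \<partial>M) * indicator A y = (\<integral>\<^sup>+x. indicator ?B (-x) \<partial>M) * indicator A y"
      using mi[of "\<lambda>x. indicator ?B (-x)" "-y"] by (simp add: algebra_simps)
  qed
  also have "\<dots> = (\<integral>\<^sup>+x. indicator ?B (-x) \<partial>M) * emeasure lborel A"
    by (subst nn_integral_cmult) auto
  also have "(\<integral>\<^sup>+x. indicator ?B (-x) \<partial>M) = (\<integral>\<^sup>+x. indicator (uminus ` ?B) x \<partial>M)"
  proof (intro nn_integral_cong)
    fix x :: 'a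
    have "-x \<in> ?B \<longleftrightarrow> x \<in> uminus ` ?B" 
    proof
      assume "-x \<in> ?B" thus "x \<in> uminus ` ?B" by (rule image_eqI[rotated]) simp
    next
      assume "x \<in> uminus ` ?B"
      then obtain y where "y \<in> ?B" "x = - y" by (rule imageE)
      thus "-x \<in> ?B" by simp
    qed
    thus "indicator ?B (-x) = (indicator (uminus ` ?B) x :: ennreal)" by (simp only: indicator_def)
  qed
  also have "\<dots> = emeasure M (uminus ` ?B)"
    by (rule nn_integral_indicator) (auto simp: sets intro!: borel_closed compact_imp_closed compact_continuous_image continuous_intros)
  finally show ?thesis .
qed

text \<open>The image measure is translation invariant because \<open>g\<close> is onto, and finite
  on compact sets because \<open>g\<close> has a continuous inverse, so it is a multiple of
  \<open>lborel\<close>. The factor, \<open>1 / |det g|\<close>, stays anonymous.\<close>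

lemma linear_lborel_scaled:
  fixes g :: "'a::euclidean_space \<Rightarrow> 'a"
  assumes g: "linear g" and inj: "inj g"
  obtains c :: real where "c > 0" "distr lborel borel g = density lborel (\<lambda>_. ennreal c)"
proof -
  obtain h where h: "linear h" "\<And>x. h (g x) = x" "\<And>x. g (h x) = x"
    using linear_injective_isomorphism[OF g inj] by metis
  have cg: "continuous_on UNIV g" and ch: "continuous_on UNIV h"
    using g h by (auto simp: linear_continuous_on linear_conv_bounded_linear)
  have [measurable]: "g \<in> borel_measurable borel" "h \<in> borel_measurable borel"
    using cg ch by (auto intro: borel_measurable_continuous_onI)
  define M where "M = distr lborel borel g"
  have sM [measurable_cong]: "sets M = sets borel" by (simp add: M_def)
  have vim: "g -` S = h ` S" for S
    using h by (auto simp: image_iff) metis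
  have em: "emeasure M S = emeasure lborel (h ` S)" if "S \<in> sets borel" for S
    using that by (simp add: M_def emeasure_distr vim)
  have fin: "emeasure M S < \<infinity>" if "compact S" for S
  proof -
    have "compact (h ` S)" using that ch by (meson compact_continuous_image continuous_on_subset subset_UNIV)
    thus ?thesis using em[OF borel_compact[OF that]] emeasure_compact_finite by metis
  qed
  have sf: "sigma_finite_measure M"
  proof (rule sigma_finite_measure.intro, intro exI conjI ballI)
    show "countable (range (\<lambda>n::nat. cball (0::'a) n))" by simp
    show "range (\<lambda>n::nat. cball (0::'a) n) \<subseteq> sets M" by (auto simp: sM)
    show "\<Union> (range (\<lambda>n::nat. cball (0::'a) n)) = space M" 
      by (auto simp: M_def intro: real_arch_simple)
  next
    fix a assume "a \<in> range (\<lambda>n::nat. cball (0::'a) n)"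
    thus "emeasure M a \<noteq> \<infinity>" using fin[of a] by auto
  qed
  have inv: "distr M borel (\<lambda>x. a + x) = M" for a
  proof -
    have "distr M borel (\<lambda>x. a + x) = distr lborel borel (\<lambda>x. a + g x)"
      unfolding M_def by (subst distr_distr) (auto simp: o_def)
    also have "(\<lambda>x. a + g x) = (\<lambda>x. g (h a + x))"
      using h by (auto simp: linear_add[OF g])
    also have "distr lborel borel (\<lambda>x. g (h a + x)) = distr (distr lborel borel (\<lambda>x. h a + x)) borel g"
      by (subst distr_distr) (auto simp: o_def)
    also have "\<dots> = M" by (simp add: lborel_distr_plus M_def)
    finally show ?thesis .
  qed
  let ?e = "emeasure M (uminus ` cbox 0 One)"
  have "compact (uminus ` cbox 0 (One::'a))"
    by (intro compact_continuous_image continuous_intros) auto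
  then have efin: "?e < \<infinity>" by (rule fin)
  define c where "c = enn2real ?e"
  have ce: "ennreal c = ?e" using efin by (simp add: c_def)
  have eq: "emeasure M A = ?e * emeasure lborel A" if "A \<in> sets borel" for A
    by (rule translation_invariant_eq_scaled_lborel[OF sM sf inv that])
  \<comment> \<open>Infinite total mass rules out the factor 0.\<close>
  have "emeasure M UNIV = \<infinity>" 
  proof -
    have "h ` UNIV = UNIV" using h(2) by (metis surjI)
    thus ?thesis using em[of UNIV] by (simp add: emeasure_lborel_UNIV)
  qed
  then have "?e \<noteq> 0" using eq[of UNIV] by auto
  then have "c > 0" using ce c_def by (metis enn2real_nonneg ennreal_0 less_eq_real_def)
  moreover have "distr lborel borel g = density lborel (\<lambda>_. ennreal c)"
  proof (rule measure_eqI)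
    fix A assume "A \<in> sets (distr lborel borel g)"
    hence A: "A \<in> sets borel" by simp
    have "emeasure (density lborel (\<lambda>_. ennreal c)) A = ennreal c * emeasure lborel A"
      using A by (subst emeasure_density) (auto simp: nn_integral_cmult)
    thus "emeasure (distr lborel borel g) A = emeasure (density lborel (\<lambda>_. ennreal c)) A"
      using eq[OF A] by (simp add: ce M_def)
  qed simp
  ultimately show ?thesis by (rule that)
qed

lemma integral_linear_image_scaled:
  fixes g :: "'a::euclidean_space \<Rightarrow> 'a"
  assumes g: "linear g" and inj: "inj g"
  shows "\<exists>c>0. \<forall>f :: 'a \<Rightarrow> complex. f \<in> borel_measurable borel \<longrightarrow> (LINT x|lborel. f (g x)) = c *\<^sub>R (LINT x|lborel. f x)"
proof -
  obtain c where c: "c > 0" "distr lborel borel g = density lborel (\<lambda>_. ennreal c)"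
    by (rule linear_lborel_scaled[OF assms])
  have [measurable]: "g \<in> borel_measurable borel"
    using g by (intro borel_measurable_continuous_onI) (auto simp: linear_continuous_on linear_conv_bounded_linear)
  have "(LINT x|lborel. f (g x)) = c *\<^sub>R (LINT x|lborel. f x)" if [measurable]: "f \<in> borel_measurable borel" for f :: "'a \<Rightarrow> complex"
  proof -
    have "(LINT x|lborel. f (g x)) = (LINT x|distr lborel borel g. f x)"
      by (subst integral_distr) auto
    also have "\<dots> = (LINT x|density lborel (\<lambda>_. ennreal c). f x)" by (simp only: c)
    also have "\<dots> = c *\<^sub>R (LINT x|lborel. f x)"
      using c by (subst integral_density) auto
    finally show ?thesis .
  qed
  with c(1) show ?thesis by blast
qed

text \<open>The unit ball is mapped onto itself, so testing the unknown factor on its indicator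
  gives 1.\<close>

lemma integral_orthogonal_image:
  fixes g :: "'a::euclidean_space \<Rightarrow> 'a" and f :: "'a \<Rightarrow> complex"
  assumes g: "orthogonal_transformation g" and f: "f \<in> borel_measurable borel"
  shows "(LINT x|lborel. f (g x)) = (LINT x|lborel. f x)"
proof -
  have lin: "linear g" and inj: "inj g"
    using g by (auto simp: orthogonal_transformation_linear orthogonal_transformation_inj)
  obtain c where c: "c > 0"
    "\<forall>f :: 'a \<Rightarrow> complex. f \<in> borel_measurable borel \<longrightarrow> (LINT x|lborel. f (g x)) = c *\<^sub>R (LINT x|lborel. f x)"
    using integral_linear_image_scaled[OF lin inj] by blast
  let ?f = "\<lambda>x. indicator (cball (0::'a) 1) x *\<^sub>R (1::complex)"
  have "?f (g x) = ?f x" for x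
    using g by (simp add: indicator_def orthogonal_transformation_norm)
  then have "(LINT x|lborel. ?f x) = c *\<^sub>R (LINT x|lborel. ?f x)"
  proof -
    have "?f \<in> borel_measurable borel"
      by (intro borel_measurable_scaleR borel_measurable_indicator borel_closed closed_cball borel_measurable_const)
    thus ?thesis using c(2)[rule_format, of ?f] by (simp only: simp_thms \<open>\<And>x. ?f (g x) = ?f x\<close>)
  qed
  moreover have "(LINT x|lborel. ?f x) = of_real (measure lborel (cball (0::'a) 1))"
    using has_bochner_integral_integral_eq[OF has_bochner_integral_indicator[of "cball (0::'a) 1" lborel "1::complex"]]
    by (simp add: emeasure_compact_finite[unfolded infinity_ennreal_def] scaleR_conv_of_real)
  moreover have "measure lborel (cball (0::'a) 1) > 0"
    using content_ball_pos by (metis content_cball_pos zero_less_one)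
  ultimately have "c = 1" by (simp add: scaleR_conv_of_real)
  thus ?thesis using c(2) f by simp
qed


section \<open>Smooth functions\<close>

definition pd :: "'n \<Rightarrow> (real ^ 'n \<Rightarrow> complex) \<Rightarrow> real ^ 'n \<Rightarrow> complex" where
  "pd i f x = frechet_derivative f (at x) (axis i 1)"

text \<open>Coinduction gives derivatives of every order without counting them: to prove smoothness,
  a class of differentiable functions closed under \<open>pd\<close> suffices.\<close>

coinductive smooth :: "(real ^ 'n \<Rightarrow> complex) \<Rightarrow> bool" where
  "(\<And>x. f differentiable (at x)) \<Longrightarrow> (\<And>i. smooth (pd i f)) \<Longrightarrow> smooth f"

lemma smooth_differentiable: "smooth f \<Longrightarrow> f differentiable (at x)"
  and smooth_pd: "smooth f \<Longrightarrow> smooth (pd i f)"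
  by (auto elim: smooth.cases)

lemma pd_eqI: "(f has_derivative f') (at x) \<Longrightarrow> pd i f x = f' (axis i 1)"
  unfolding pd_def by (metis frechet_derivative_at)

lemma axis_sum_expansion: "(\<Sum>i\<in>UNIV. (h $ i) *\<^sub>R axis i (1::real)) = h"
  by (metis basis_expansion scalar_mult_eq_scaleR)

lemma differentiable_has_pd:
  assumes "f differentiable (at x)"
  shows "(f has_derivative (\<lambda>h. \<Sum>i\<in>UNIV. (h $ i) *\<^sub>R pd i f x)) (at x)"
proof -
  have d: "(f has_derivative frechet_derivative f (at x)) (at x)"
    using assms by (simp add: frechet_derivative_works)
  then interpret bounded_linear "frechet_derivative f (at x)" by (rule has_derivative_bounded_linear)
  have "frechet_derivative f (at x) h = (\<Sum>i\<in>UNIV. (h $ i) *\<^sub>R pd i f x)" for h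
  proof -
    have "frechet_derivative f (at x) h = frechet_derivative f (at x) (\<Sum>i\<in>UNIV. (h $ i) *\<^sub>R axis i 1)"
      by (simp only: axis_sum_expansion)
    thus ?thesis by (simp add: sum scaleR pd_def)
  qed
  then show ?thesis by (intro has_derivative_eq_rhs[OF d] ext)
qed

lemmas smooth_has_pd = differentiable_has_pd[OF smooth_differentiable]

lemma smooth_continuous: "smooth f \<Longrightarrow> continuous_on S f"
  by (meson continuous_at_imp_continuous_on differentiable_imp_continuous_within smooth_differentiable)

lemma pd_add: "f differentiable (at x) \<Longrightarrow> g differentiable (at x) \<Longrightarrow> pd i (\<lambda>x. f x + g x) x = pd i f x + pd i g x"
  by (subst pd_eqI[OF has_derivative_add[OF differentiable_has_pd differentiable_has_pd]])
     (simp_all add: axis_def if_distrib if_distribR cong: if_cong)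

lemma pd_mult:
  assumes "f differentiable (at x)" "g differentiable (at x)"
  shows "pd i (\<lambda>x. f x * g x) x = pd i f x * g x + f x * pd i g x"
  by (subst pd_eqI[OF has_derivative_mult[OF differentiable_has_pd[OF assms(1)] differentiable_has_pd[OF assms(2)]]])
     (simp add: axis_def if_distrib if_distribR cong: if_cong)

lemma pd_const [simp]: "pd i (\<lambda>_. c) x = 0"
  by (subst pd_eqI[OF has_derivative_const]) simp

lemma pd_coord: "pd i (\<lambda>x. complex_of_real (x $ k)) x = (if i = k then 1 else 0)"
  by (subst pd_eqI[of _ "\<lambda>h. complex_of_real (h $ k)"])
     (auto simp: axis_def intro!: has_derivative_of_real bounded_linear_imp_has_derivative[OF bounded_linear_vec_nth])

inductive_set smooth_span :: "(real ^ 'n \<Rightarrow> complex) set \<Rightarrow> (real ^ 'n \<Rightarrow> complex) set"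
  for B where
  base: "f \<in> B \<Longrightarrow> f \<in> smooth_span B"
| smooth: "smooth f \<Longrightarrow> f \<in> smooth_span B"
| add: "f \<in> smooth_span B \<Longrightarrow> g \<in> smooth_span B \<Longrightarrow> (\<lambda>x. f x + g x) \<in> smooth_span B"
| mult: "f \<in> smooth_span B \<Longrightarrow> g \<in> smooth_span B \<Longrightarrow> (\<lambda>x. f x * g x) \<in> smooth_span B"

text \<open>Coinduction up to sums and products: by the sum and Leibniz rules, derivatives of
  generators need only be polynomial expressions in generators and functions already known to be
  smooth. Exponentials, bumps, affine substitutions and convolutions are all treated this
  way.\<close>

lemma smooth_upto:
  assumes B: "\<And>f x. f \<in> B \<Longrightarrow> f differentiable (at x)"
    "\<And>f i. f \<in> B \<Longrightarrow> pd i f \<in> smooth_span B"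
  assumes f: "f \<in> smooth_span B"
  shows "smooth f"
proof -
  have diff: "g differentiable (at x)" if "g \<in> smooth_span B" for g x
    using that by induction (auto intro: B smooth_differentiable)
  have pds: "pd i g \<in> smooth_span B" if "g \<in> smooth_span B" for g i
    using that
  proof induction
    case (add f g)
    have "pd i (\<lambda>x. f x + g x) = (\<lambda>x. pd i f x + pd i g x)"
      using add diff by (auto simp: pd_add)
    then show ?case using add by (auto intro: smooth_span.intros)
  next
    case (mult f g)
    have "pd i (\<lambda>x. f x * g x) = (\<lambda>x. pd i f x * g x + f x * pd i g x)"
      using mult diff by (auto simp: pd_mult)
    then show ?case using mult by (auto intro: smooth_span.intros)
  qed (auto intro: B smooth_span.intros smooth_pd)
  show ?thesis
    using f by (coinduction arbitrary: f) (use diff pds in blast)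
qed

lemma smooth_add: "smooth f \<Longrightarrow> smooth g \<Longrightarrow> smooth (\<lambda>x. f x + g x)"
  and smooth_mult: "smooth f \<Longrightarrow> smooth g \<Longrightarrow> smooth (\<lambda>x. f x * g x)"
  by (rule smooth_upto[where B="{}"]; auto intro: smooth_span.intros)+

lemma smooth_const [simp]: "smooth (\<lambda>_. c)"
proof (coinduction arbitrary: c)
  case (smooth c)
  have "pd i (\<lambda>_. c) = (\<lambda>_. 0)" for i :: 'a by auto
  thus ?case by auto
qed

lemma smooth_cmult: "smooth f \<Longrightarrow> smooth (\<lambda>x. c * f x)"
  by (intro smooth_mult smooth_const)

lemma smooth_coord: "smooth (\<lambda>x. complex_of_real (x $ k))"
proof (rule smooth.intros)
  show "(\<lambda>x. complex_of_real (x $ k)) differentiable (at x)" for x :: "real ^ 'a"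
    by (rule differentiableI[OF has_derivative_of_real[OF bounded_linear_imp_has_derivative[OF bounded_linear_vec_nth]]])
  show "smooth (pd i (\<lambda>x. complex_of_real (x $ k)))" for i
    using smooth_const[of "if i = k then 1 else 0"] by (simp add: pd_coord[abs_def])
qed

lemma pd_cmult: "f differentiable (at x) \<Longrightarrow> pd i (\<lambda>x. c * f x) x = c * pd i f x"
  by (subst pd_mult) auto

lemma smooth_affine_comp:
  fixes g :: "real ^ 'n \<Rightarrow> real ^ 'n"
  assumes g: "linear g" and f: "smooth f"
  shows "smooth (\<lambda>x. f (a + g x))"
    and "pd i (\<lambda>x. f (a + g x)) x = (\<Sum>k\<in>UNIV. complex_of_real (g (axis i 1) $ k) * pd k f (a + g x))"
proof -
  have d: "((\<lambda>x. f (a + g x)) has_derivative (\<lambda>h. \<Sum>k\<in>UNIV. (g h $ k) *\<^sub>R pd k f (a + g x))) (at x)"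
    if "smooth f" for f x
    by (rule has_derivative_compose[OF _ smooth_has_pd[OF that], of "\<lambda>x. a + g x"])
       (auto intro!: derivative_eq_intros linear_imp_has_derivative g)
  have p: "pd i (\<lambda>x. f (a + g x)) x = (\<Sum>k\<in>UNIV. complex_of_real (g (axis i 1) $ k) * pd k f (a + g x))"
    if "smooth f" for f i x
    by (subst pd_eqI[OF d[OF that]]) (simp add: scaleR_conv_of_real)
  show "pd i (\<lambda>x. f (a + g x)) x = (\<Sum>k\<in>UNIV. complex_of_real (g (axis i 1) $ k) * pd k f (a + g x))"
    by (rule p[OF f])
  \<comment> \<open>All \<open>f\<close> at once, because the chain rule replaces \<open>f\<close>
    by its partial derivatives.\<close>
  let ?B = "{h. \<exists>f. smooth f \<and> h = (\<lambda>x. f (a + g x))}"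
  have s: "(\<lambda>x. \<Sum>k\<in>I. F k x) \<in> smooth_span ?B" if "\<And>k. k \<in> I \<Longrightarrow> F k \<in> smooth_span ?B" for I and F :: "'n \<Rightarrow> _"
    using that by (induction I rule: infinite_finite_induct) (auto intro: smooth_span.intros)
  show "smooth (\<lambda>x. f (a + g x))"
  proof (rule smooth_upto[where B="?B"])
    fix h i assume "h \<in> ?B"
    then obtain f where f: "smooth f" "h = (\<lambda>x. f (a + g x))" by auto
    have "pd i h = (\<lambda>x. \<Sum>k\<in>UNIV. complex_of_real (g (axis i 1) $ k) * pd k f (a + g x))"
      using f p by auto
    also have "\<dots> \<in> smooth_span ?B"
    proof (intro s smooth_span.mult)
      fix k show "(\<lambda>x. pd k f (a + g x)) \<in> smooth_span ?B"
        using smooth_pd[OF f(1), of k] by (intro smooth_span.base) auto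
    qed (auto intro: smooth_span.intros)
    finally show "pd i h \<in> smooth_span ?B" .
  next
    fix h x assume "h \<in> ?B"
    thus "h differentiable (at x)" using d differentiable_def by blast
  qed (auto intro: smooth_span.base f)
qed

lemma smooth_line_derivative:
  assumes "smooth f"
  shows "((\<lambda>t. f (x + t *\<^sub>R u)) has_vector_derivative (\<Sum>i\<in>UNIV. (u $ i) *\<^sub>R pd i f (x + t *\<^sub>R u))) (at t within S)"
proof -
  have "((\<lambda>t. f (x + t *\<^sub>R u)) has_derivative (\<lambda>h. \<Sum>i\<in>UNIV. ((h *\<^sub>R u) $ i) *\<^sub>R pd i f (x + t *\<^sub>R u))) (at t within S)"
    by (rule has_derivative_compose[OF _ smooth_has_pd[OF assms], of "\<lambda>t. x + t *\<^sub>R u"])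
       (auto intro!: derivative_eq_intros)
  thus ?thesis
    unfolding has_vector_derivative_def by (simp add: scaleR_sum_right)
qed

lemma smooth_line_derivative_axis:
  assumes "smooth f"
  shows "((\<lambda>t. f (x + t *\<^sub>R axis i 1)) has_vector_derivative pd i f (x + t *\<^sub>R axis i 1)) (at t within S)"
  by (rule has_vector_derivative_eq_rhs[OF smooth_line_derivative[OF assms]])
     (simp add: axis_def if_distrib if_distribR cong: if_cong)

text \<open>Along axis \<open>j\<close> the increment of \<open>f\<close> is the integral of
  \<open>pd j f\<close>. Differentiating in direction \<open>i\<close> under the integral makes the
  increment of \<open>pd i f\<close> the integral of \<open>pd i (pd j f)\<close>, and the
  fundamental theorem of calculus recovers the integrand at 0.\<close>

lemma pd_commute:
  fixes f :: "real ^ 'n \<Rightarrow> complex"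
  assumes f: "smooth f"
  shows "pd i (pd j f) = pd j (pd i f)"
proof
  fix x
  let ?a = "axis i 1 :: real ^ 'n" and ?b = "axis j 1 :: real ^ 'n"
  note c = continuous_on_compose2[OF smooth_continuous[of _ UNIV], OF _ _ subset_UNIV]
  define p where "p = pd i (pd j f)"
  have ftc: "((\<lambda>\<tau>. pd j f (y + \<tau> *\<^sub>R ?b)) has_integral f (y + t *\<^sub>R ?b) - f y) (cbox 0 t)" if "t \<ge> 0" for y t
    using fundamental_theorem_of_calculus[OF that, of "\<lambda>t. f (y + t *\<^sub>R ?b)" "\<lambda>\<tau>. pd j f (y + \<tau> *\<^sub>R ?b)"]
      smooth_line_derivative_axis[OF f] by simp
  have eq: "pd i f (x + t *\<^sub>R ?b) - pd i f x = integral {0..t} (\<lambda>\<tau>. p (x + \<tau> *\<^sub>R ?b))" if t: "t \<ge> 0" for t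
  proof -
    have "((\<lambda>s. integral (cbox 0 t) (\<lambda>\<tau>. pd j f ((x + \<tau> *\<^sub>R ?b) + s *\<^sub>R ?a))) has_vector_derivative
        integral (cbox 0 t) (\<lambda>\<tau>. p ((x + \<tau> *\<^sub>R ?b) + 0 *\<^sub>R ?a))) (at 0 within UNIV)"
      unfolding p_def
    proof (rule leibniz_rule_vector_derivative)
      show "((\<lambda>s. pd j f ((x + \<tau> *\<^sub>R ?b) + s *\<^sub>R ?a)) has_vector_derivative
          pd i (pd j f) ((x + \<tau> *\<^sub>R ?b) + s *\<^sub>R ?a)) (at s within UNIV)" for s \<tau>
        by (rule smooth_line_derivative_axis[OF smooth_pd[OF f]])
      show "(\<lambda>\<tau>. pd j f (x + \<tau> *\<^sub>R ?b + s *\<^sub>R ?a)) integrable_on cbox 0 t" for s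
        by (intro integrable_continuous c[OF smooth_pd[OF f]] continuous_intros)
      show "continuous_on (UNIV \<times> cbox 0 t) (\<lambda>(s, \<tau>). pd i (pd j f) (x + \<tau> *\<^sub>R ?b + s *\<^sub>R ?a))"
        unfolding case_prod_beta
        by (intro c[OF smooth_pd[OF smooth_pd[OF f]]] continuous_intros)
    qed auto
    also have "(\<lambda>s. integral (cbox 0 t) (\<lambda>\<tau>. pd j f ((x + \<tau> *\<^sub>R ?b) + s *\<^sub>R ?a)))
        = (\<lambda>s. f ((x + t *\<^sub>R ?b) + s *\<^sub>R ?a) - f (x + s *\<^sub>R ?a))"
    proof
      fix s
      show "integral (cbox 0 t) (\<lambda>\<tau>. pd j f ((x + \<tau> *\<^sub>R ?b) + s *\<^sub>R ?a)) = f ((x + t *\<^sub>R ?b) + s *\<^sub>R ?a) - f (x + s *\<^sub>R ?a)"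
        using integral_unique[OF ftc[OF t, of "x + s *\<^sub>R ?a"]] by (simp add: add_ac)
    qed
    finally have "((\<lambda>s. f ((x + t *\<^sub>R ?b) + s *\<^sub>R ?a) - f (x + s *\<^sub>R ?a)) has_vector_derivative
        integral (cbox 0 t) (\<lambda>\<tau>. p (x + \<tau> *\<^sub>R ?b))) (at 0)" by simp
    moreover have "((\<lambda>s. f ((x + t *\<^sub>R ?b) + s *\<^sub>R ?a) - f (x + s *\<^sub>R ?a)) has_vector_derivative
        pd i f ((x + t *\<^sub>R ?b) + 0 *\<^sub>R ?a) - pd i f (x + 0 *\<^sub>R ?a)) (at 0)"
      by (intro has_vector_derivative_diff smooth_line_derivative_axis f)
    ultimately show ?thesis using vector_derivative_unique_at by fastforce
  qed
  have "((\<lambda>t. integral {0..t} (\<lambda>\<tau>. p (x + \<tau> *\<^sub>R ?b))) has_vector_derivative p (x + 0 *\<^sub>R ?b)) (at 0 within {0..1})"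
    unfolding p_def
    by (rule integral_has_vector_derivative) (auto intro!: c[OF smooth_pd[OF smooth_pd[OF f]]] continuous_intros)
  then have "((\<lambda>t. pd i f (x + t *\<^sub>R ?b) - pd i f x) has_vector_derivative p x) (at 0 within {0..1})"
    by (rule has_vector_derivative_transform[rotated 2, THEN has_vector_derivative_eq_rhs]) (auto simp: eq)
  moreover have "((\<lambda>t. pd i f (x + t *\<^sub>R ?b) - pd i f x) has_vector_derivative pd j (pd i f) (x + 0 *\<^sub>R ?b) - 0) (at 0 within {0..1})"
    by (intro has_vector_derivative_diff smooth_line_derivative_axis smooth_pd f has_vector_derivative_const)
  ultimately show "pd i (pd j f) x = pd j (pd i f) x"
    using vector_derivative_unique_within_closed_interval[of 0 1 0] by (fastforce simp: p_def)
qed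


section \<open>The ring of constant-coefficient differential operators\<close>

text \<open>Operators are \<open>0\<close> on non-smooth functions, so that they are determined by their action on
  smooth ones and commute everywhere.\<close>

inductive_set diffops :: "((real ^ 'n \<Rightarrow> complex) \<Rightarrow> real ^ 'n \<Rightarrow> complex) set" where
  cst: "(\<lambda>f x. if smooth f then c * f x else 0) \<in> diffops"
| var: "(\<lambda>f x. if smooth f then pd i f x else 0) \<in> diffops"
| add: "A \<in> diffops \<Longrightarrow> B \<in> diffops \<Longrightarrow> (\<lambda>f x. A f x + B f x) \<in> diffops"
| mult: "A \<in> diffops \<Longrightarrow> B \<in> diffops \<Longrightarrow> (\<lambda>f. A (B f)) \<in> diffops"

lemma diffops_smooth: "A \<in> diffops \<Longrightarrow> smooth f \<Longrightarrow> smooth (A f)"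
  by (induction arbitrary: f rule: diffops.induct) (auto intro: smooth_cmult smooth_pd smooth_add)

lemma diffops_zero: "A \<in> diffops \<Longrightarrow> A (\<lambda>_. 0) = (\<lambda>_. 0)"
  by (induction rule: diffops.induct) auto

lemma diffops_junk: "A \<in> diffops \<Longrightarrow> \<not> smooth f \<Longrightarrow> A f = (\<lambda>_. 0)"
  by (induction rule: diffops.induct) (auto simp: diffops_zero)

lemma diffops_linear:
  assumes "A \<in> diffops" "smooth f" "smooth g"
  shows "A (\<lambda>x. c * f x + g x) = (\<lambda>x. c * A f x + A g x)"
  using assms
proof (induction arbitrary: f g rule: diffops.induct)
  case (var i)
  then show ?case
    by (auto simp: smooth_add smooth_cmult pd_add pd_cmult smooth_differentiable)
next
  case (mult A B)
  then show ?case by (simp add: diffops_smooth)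
qed (auto simp: smooth_add smooth_cmult algebra_simps)

lemma diffops_cst_commute:
  assumes "A \<in> diffops" "smooth f"
  shows "A (\<lambda>x. c * f x) = (\<lambda>x. c * A f x)"
  using diffops_linear[OF assms smooth_const[of 0], of c] diffops_zero[OF assms(1)] by simp

lemma diffops_add_distrib:
  assumes "A \<in> diffops" "smooth f" "smooth g"
  shows "A (\<lambda>x. f x + g x) = (\<lambda>x. A f x + A g x)"
  using diffops_linear[OF assms, of 1] by simp

lemma diffops_var_commute:
  assumes "A \<in> diffops" "smooth f"
  shows "A (pd i f) = pd i (A f)"
  using assms
proof (induction arbitrary: f rule: diffops.induct)
  case (cst c)
  then show ?case by (auto simp: smooth_pd pd_cmult smooth_differentiable)
next
  case (var j)
  then show ?case by (simp add: smooth_pd pd_commute[of f i j])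
next
  case (add A B)
  then show ?case by (auto simp: pd_add diffops_smooth smooth_differentiable)
next
  case (mult A B)
  then show ?case by (auto simp: diffops_smooth smooth_pd)
qed

lemma diffops_commute:
  assumes "A \<in> diffops" "B \<in> diffops"
  shows "A (B f) = B (A f)"
proof (cases "smooth f")
  case True
  show ?thesis using assms(1) True
  proof (induction arbitrary: f rule: diffops.induct)
    case (cst c)
    then show ?case by (auto simp: diffops_smooth assms diffops_cst_commute)
  next
    case (var j)
    then show ?case by (simp add: diffops_smooth assms diffops_var_commute)
  next
    case (add A C)
    then show ?case by (simp add: diffops_smooth assms diffops_add_distrib)
  next
    case (mult A C)
    then show ?case by (simp add: diffops_smooth)
  qed
qed (use assms in \<open>simp add: diffops_junk diffops_zero\<close>)

text \<open>A type of its own, so that operators form a \<open>comm_ring_1\<close> and can be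
  coefficients and arguments of library polynomials.\<close>

typedef 'n diffop = "diffops :: ((real ^ 'n \<Rightarrow> complex) \<Rightarrow> real ^ 'n \<Rightarrow> complex) set"
  morphisms app Abs_diffop
  using diffops.cst by blast

lemma app_in: "app A \<in> diffops" by (rule app)

lemma diffop_eqI:
  assumes "\<And>f. smooth f \<Longrightarrow> app A f = app B f"
  shows "A = B"
proof -
  have "app A f = app B f" for f
    using assms[of f] diffops_junk[OF app_in, of f] by (cases "smooth f") auto
  thus ?thesis by (simp add: app_inject[symmetric] ext)
qed

definition cst :: "complex \<Rightarrow> 'n::finite diffop" where
  "cst c = Abs_diffop (\<lambda>f x. if smooth f then c * f x else 0)"
definition X :: "'n::finite \<Rightarrow> 'n diffop" where
  "X i = Abs_diffop (\<lambda>f x. if smooth f then pd i f x else 0)"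

lemma app_cst: "smooth f \<Longrightarrow> app (cst c) f = (\<lambda>x. c * f x)"
  by (simp add: cst_def Abs_diffop_inverse diffops.cst)

lemma app_X: "smooth f \<Longrightarrow> app (X i) f = pd i f"
  by (simp add: X_def Abs_diffop_inverse diffops.var)

lemma smooth_app: "smooth f \<Longrightarrow> smooth (app A f)"
  by (rule diffops_smooth[OF app_in])

lemma app_fadd: "smooth f \<Longrightarrow> smooth g \<Longrightarrow> app A (\<lambda>x. f x + g x) = (\<lambda>x. app A f x + app A g x)"
  by (rule diffops_add_distrib[OF app_in])

lemma app_fcmult: "smooth f \<Longrightarrow> app A (\<lambda>x. c * f x) = (\<lambda>x. c * app A f x)"
  by (rule diffops_cst_commute[OF app_in])

lemma app_fzero: "app A (\<lambda>_. 0) = (\<lambda>_. 0)"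
  by (rule diffops_zero[OF app_in])

instantiation diffop :: (finite) comm_ring_1
begin

definition zero_diffop :: "'a diffop" where "0 = cst 0"
definition one_diffop :: "'a diffop" where "1 = cst 1"
definition plus_diffop :: "'a diffop \<Rightarrow> 'a diffop \<Rightarrow> 'a diffop" where
  "A + B = Abs_diffop (\<lambda>f x. app A f x + app B f x)"
definition times_diffop :: "'a diffop \<Rightarrow> 'a diffop \<Rightarrow> 'a diffop" where
  "A * B = Abs_diffop (\<lambda>f. app A (app B f))"
definition uminus_diffop :: "'a diffop \<Rightarrow> 'a diffop" where "- A = cst (-1) * A"
definition minus_diffop :: "'a diffop \<Rightarrow> 'a diffop \<Rightarrow> 'a diffop" where "A - B = (A + (- B) :: 'a diffop)"

lemma app_add: "app (A + B) f = (\<lambda>x. app A f x + app B f x)"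
  and app_mult: "app (A * B) f = app A (app B f)"
  by (simp_all add: plus_diffop_def times_diffop_def Abs_diffop_inverse diffops.add diffops.mult app_in)

instance
proof
  fix A B C :: "'a diffop"
  show "A * B * C = A * (B * C)" "A + B + C = A + (B + C)" "A + B = B + A"
    by (rule diffop_eqI; simp add: app_add app_mult algebra_simps)+
  show "A * B = B * A"
    by (rule diffop_eqI) (simp add: app_mult diffops_commute app_in)
  show "1 * A = A" "0 + A = A" "- A + A = 0" "A - B = A + - B" "(A + B) * C = A * C + B * C"
    by (rule diffop_eqI; simp add: app_add app_mult app_cst zero_diffop_def one_diffop_def uminus_diffop_def
        minus_diffop_def smooth_app)+
  have "app (0 :: 'a diffop) (\<lambda>_. 1) 0 \<noteq> app 1 (\<lambda>_. 1) 0"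
    by (simp add: zero_diffop_def one_diffop_def app_cst)
  thus "(0 :: 'a diffop) \<noteq> 1" by metis
qed

end

lemma app_zero: "app 0 f = (\<lambda>_. 0)"
  using app_cst[of f 0] diffops_junk[OF app_in, of f] by (cases "smooth f") (auto simp: zero_diffop_def)

lemma app_one: "smooth f \<Longrightarrow> app 1 f = f"
  by (simp add: one_diffop_def app_cst)

lemma app_uminus: "app (- A) f = (\<lambda>x. - app A f x)"
  using app_add[of A "-A" f] by (simp add: app_zero fun_eq_iff eq_neg_iff_add_eq_0 add.commute)

lemma app_minus: "app (A - B) f = (\<lambda>x. app A f x - app B f x)"
  using app_add[of A "-B" f] by (simp add: app_uminus)

lemma cst_simps: "cst 0 = 0" "cst 1 = 1" "cst (a + b) = cst a + cst b" "cst (a * b) = cst a * cst b"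
  by (rule diffop_eqI; simp add: app_cst app_zero app_one app_add app_mult smooth_cmult algebra_simps)+

lemma app_sum: "app (\<Sum>i\<in>I. A i) f = (\<lambda>x. \<Sum>i\<in>I. app (A i) f x)"
  by (induction I rule: infinite_finite_induct) (auto simp: app_zero app_add)

lemma diffop_induct [case_names cst X add mult, induct type: diffop]:
  fixes A :: "'n::finite diffop"
  assumes "\<And>c. P (cst c)" "\<And>i. P (X i)" "\<And>A B. P A \<Longrightarrow> P B \<Longrightarrow> P (A + B)" "\<And>A B. P A \<Longrightarrow> P B \<Longrightarrow> P (A * B)"
  shows "P A"
proof -
  have "P (Abs_diffop a)" if "a \<in> diffops" for a
    using that
  proof (induction rule: diffops.induct)
    case (add a b)
    have "Abs_diffop (\<lambda>f x. a f x + b f x) = Abs_diffop a + Abs_diffop b"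
      using add by (simp add: plus_diffop_def Abs_diffop_inverse)
    then show ?case using add assms(3) by simp
  next
    case (mult a b)
    have "Abs_diffop (\<lambda>f. a (b f)) = Abs_diffop a * Abs_diffop b"
      using mult by (simp add: times_diffop_def Abs_diffop_inverse)
    then show ?case using mult assms(4) by simp
  qed (use assms in \<open>auto simp: cst_def[symmetric] X_def[symmetric]\<close>)
  from this[OF app_in[of A]] show ?thesis by (simp add: app_inverse)
qed

subsection \<open>Symbols\<close>

definition cexp :: "complex ^ 'n \<Rightarrow> real ^ 'n \<Rightarrow> complex" where
  "cexp z x = exp (cdot z (of_real_vec x))"

lemma cdot_of_real_vec: "cdot z (of_real_vec x) = (\<Sum>i\<in>UNIV. z $ i * complex_of_real (x $ i))"
  by (simp add: cdot_def of_real_vec_def)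

lemma cexp_has_derivative:
  "(cexp z has_derivative (\<lambda>h. cdot z (of_real_vec h) * cexp z x)) (at x)"
proof -
  have "((\<lambda>x. cdot z (of_real_vec x)) has_derivative (\<lambda>h. cdot z (of_real_vec h))) (at x)"
    unfolding cdot_of_real_vec
    by (intro has_derivative_sum has_derivative_mult_right has_derivative_of_real
        bounded_linear_imp_has_derivative[OF bounded_linear_vec_nth])
  from has_derivative_compose[OF this DERIV_exp[unfolded has_field_derivative_def]] show ?thesis
    unfolding cexp_def[abs_def] by (simp add: mult.commute)
qed

lemma pd_cexp: "pd i (cexp z) = (\<lambda>x. z $ i * cexp z x)"
  by (rule ext, subst pd_eqI[OF cexp_has_derivative])
     (simp add: cdot_of_real_vec axis_def if_distrib cong: if_cong)

lemma smooth_cexp: "smooth (cexp z)"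
proof (rule smooth_upto[where B="{cexp z}"])
  fix f i assume "f \<in> {cexp z}"
  then show "pd i f \<in> smooth_span {cexp z}"
    by (auto simp: pd_cexp intro!: smooth_span.mult[OF smooth_span.smooth] intro: smooth_span.base)
next
  fix f x assume "f \<in> {cexp z}"
  then show "f differentiable (at x)" using cexp_has_derivative differentiable_def by blast
qed (auto intro: smooth_span.base)

text \<open>Exponentials are common eigenfunctions of all operators, so the symbol at
  \<open>z\<close> is an eigenvalue; it is read off at the origin, where \<open>cexp z\<close>
  equals 1. This makes it multiplicative.\<close>

definition ev :: "'n::finite diffop \<Rightarrow> complex ^ 'n \<Rightarrow> complex" where
  "ev A z = app A (cexp z) 0"

lemma cexp_0 [simp]: "cexp z 0 = 1"
  by (simp add: cexp_def cdot_of_real_vec)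

lemma app_cexp: "app A (cexp z) = (\<lambda>x. ev A z * cexp z x)"
proof -
  have "\<exists>c. app A (cexp z) = (\<lambda>x. c * cexp z x)"
  proof (induction A rule: diffop_induct)
    case (add A B)
    then obtain a b where *: "app A (cexp z) = (\<lambda>x. a * cexp z x)" "app B (cexp z) = (\<lambda>x. b * cexp z x)" by auto
    show ?case by (rule exI[of _ "a + b"]) (simp add: app_add * distrib_right)
  next
    case (mult A B)
    then obtain a b where *: "app A (cexp z) = (\<lambda>x. a * cexp z x)" "app B (cexp z) = (\<lambda>x. b * cexp z x)" by auto
    show ?case by (rule exI[of _ "b * a"]) (simp add: app_mult * app_fcmult smooth_cexp mult.assoc)
  qed (auto simp: app_cst app_X smooth_cexp pd_cexp)
  then show ?thesis by (auto simp: ev_def)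
qed

lemma ev_cst [simp]: "ev (cst c) z = c"
  and ev_X [simp]: "ev (X i) z = z $ i"
  and ev_add [simp]: "ev (A + B) z = ev A z + ev B z"
  and ev_mult [simp]: "ev (A * B) z = ev A z * ev B z"
  and ev_0 [simp]: "ev 0 z = 0"
  and ev_1 [simp]: "ev 1 z = 1"
  and ev_uminus [simp]: "ev (- A) z = - ev A z"
  and ev_minus [simp]: "ev (A - B) z = ev A z - ev B z"
proof -
  show "ev (A * B) z = ev A z * ev B z"
    unfolding ev_def[of "A * B"] app_mult by (simp add: app_cexp app_fcmult smooth_cexp)
qed (simp_all add: ev_def app_cst app_X smooth_cexp pd_cexp app_add app_zero app_one app_uminus app_minus)

lemma ev_sum [simp]: "ev (\<Sum>i\<in>I. A i) z = (\<Sum>i\<in>I. ev (A i) z)"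
  by (induction I rule: infinite_finite_induct) auto

lemma ev_power [simp]: "ev (A ^ n) z = ev A z ^ n"
  by (induction n) auto

text \<open>Lets a sphere with centre \<open>a\<close> be moved to the origin.\<close>

lemma ex_shifted_symbol: "\<exists>B. \<forall>z. ev B z = ev A (a + z)"
proof (induction A rule: diffop_induct)
  case (cst c)
  then show ?case by (intro exI[of _ "cst c"]) auto
next
  case (X i)
  then show ?case by (intro exI[of _ "cst (a $ i) + X i"]) auto
next
  case (add A B)
  then obtain A' B' where "\<forall>z. ev A' z = ev A (a + z)" "\<forall>z. ev B' z = ev B (a + z)" by blast
  then show ?case by (intro exI[of _ "A' + B'"]) auto
next
  case (mult A B)
  then obtain A' B' where "\<forall>z. ev A' z = ev A (a + z)" "\<forall>z. ev B' z = ev B (a + z)" by blast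
  then show ?case by (intro exI[of _ "A' * B'"]) auto
qed

subsection \<open>Infinitesimal rotations\<close>

definition Lrot :: "'n \<Rightarrow> 'n \<Rightarrow> (real ^ 'n \<Rightarrow> complex) \<Rightarrow> real ^ 'n \<Rightarrow> complex" where
  "Lrot k l f x = complex_of_real (x $ k) * pd l f x - complex_of_real (x $ l) * pd k f x"

lemma smooth_diff: "smooth f \<Longrightarrow> smooth g \<Longrightarrow> smooth (\<lambda>x. f x - g x)"
  using smooth_add[of f "\<lambda>x. (-1) * g x"] smooth_cmult[of g "-1"] by simp

lemma pd_diff:
  assumes "smooth f" "smooth g"
  shows "pd i (\<lambda>x. f x - g x) x = pd i f x - pd i g x"
  using pd_add[of f x "\<lambda>x. (-1) * g x" i] pd_cmult[of g x i "-1"] smooth_cmult[OF assms(2), of "-1"] assms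
  by (simp add: smooth_differentiable)

lemma smooth_Lrot: "smooth f \<Longrightarrow> smooth (Lrot k l f)"
  unfolding Lrot_def[abs_def] by (intro smooth_diff smooth_mult smooth_coord smooth_pd)

lemma Lrot_add: "smooth f \<Longrightarrow> smooth g \<Longrightarrow> Lrot k l (\<lambda>x. f x + g x) = (\<lambda>x. Lrot k l f x + Lrot k l g x)"
  by (auto simp: Lrot_def pd_add smooth_differentiable algebra_simps)

lemma Lrot_cmult: "smooth f \<Longrightarrow> Lrot k l (\<lambda>x. c * f x) = (\<lambda>x. c * Lrot k l f x)"
  by (auto simp: Lrot_def pd_cmult smooth_differentiable algebra_simps)

lemma Lrot_commutator_X:
  assumes f: "smooth f"
  shows "pd m (Lrot k l f) x = Lrot k l (pd m f) x + (if m = k then pd l f x else 0) - (if m = l then pd k f x else 0)"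
proof -
  have "pd m (Lrot k l f) x = pd m (\<lambda>x. complex_of_real (x $ k) * pd l f x) x - pd m (\<lambda>x. complex_of_real (x $ l) * pd k f x) x"
    unfolding Lrot_def[abs_def] by (intro pd_diff smooth_mult smooth_coord smooth_pd f)
  also have "\<dots> = Lrot k l (pd m f) x + (if m = k then pd l f x else 0) - (if m = l then pd k f x else 0)"
    by (auto simp: pd_mult smooth_differentiable smooth_coord smooth_pd f pd_coord Lrot_def pd_commute[OF f, of m])
  finally show ?thesis .
qed

text \<open>The commutator of \<open>A\<close> with the vector field \<open>Lrot k l\<close>. It
  again has constant coefficients and acts on symbols as an infinitesimal rotation of
  \<open>z\<close>, hence as a derivation. The choice is unambiguous, since operators are determined
  by their action on smooth functions.\<close>

definition dl :: "'n::finite \<Rightarrow> 'n \<Rightarrow> 'n diffop \<Rightarrow> 'n diffop" where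
  "dl k l A = (SOME B. \<forall>f. smooth f \<longrightarrow> app A (Lrot k l f) = (\<lambda>x. Lrot k l (app A f) x + app B f x))"

lemma dl_ex: "\<exists>B. \<forall>f. smooth f \<longrightarrow> app A (Lrot k l f) = (\<lambda>x. Lrot k l (app A f) x + app B f x)"
proof (induction A rule: diffop_induct)
  case (cst c)
  show ?case by (intro exI[of _ 0]) (auto simp: app_cst smooth_Lrot Lrot_cmult app_zero)
next
  case (X m)
  show ?case
    by (intro exI[of _ "(if m = k then X l else 0) - (if m = l then X k else 0)"])
       (auto simp: app_X smooth_Lrot Lrot_commutator_X app_minus app_zero)
next
  case (add A B)
  then obtain A' B' where "\<forall>f. smooth f \<longrightarrow> app A (Lrot k l f) = (\<lambda>x. Lrot k l (app A f) x + app A' f x)"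
    "\<forall>f. smooth f \<longrightarrow> app B (Lrot k l f) = (\<lambda>x. Lrot k l (app B f) x + app B' f x)" by blast
  then show ?case by (intro exI[of _ "A' + B'"]) (auto simp: app_add Lrot_add smooth_app)
next
  case (mult A B)
  then obtain A' B' where "\<forall>f. smooth f \<longrightarrow> app A (Lrot k l f) = (\<lambda>x. Lrot k l (app A f) x + app A' f x)"
    "\<forall>f. smooth f \<longrightarrow> app B (Lrot k l f) = (\<lambda>x. Lrot k l (app B f) x + app B' f x)" by blast
  then show ?case
    by (intro exI[of _ "A' * B + A * B'"])
       (auto simp: app_add app_mult smooth_app app_fadd smooth_Lrot)
qed

lemma app_Lrot: "smooth f \<Longrightarrow> app A (Lrot k l f) x = Lrot k l (app A f) x + app (dl k l A) f x"
  using someI_ex[OF dl_ex[of A k l]] unfolding dl_def[symmetric] by auto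

lemma app_Lrot_fun: "smooth f \<Longrightarrow> app A (Lrot k l f) = (\<lambda>x. Lrot k l (app A f) x + app (dl k l A) f x)"
  by (rule ext) (rule app_Lrot)

lemma dl_eqI: "(\<And>f x. smooth f \<Longrightarrow> app A (Lrot k l f) x = Lrot k l (app A f) x + app B f x) \<Longrightarrow> dl k l A = B"
  by (rule diffop_eqI) (auto simp: app_Lrot)

definition derivation :: "('a::comm_ring_1 \<Rightarrow> 'a) \<Rightarrow> bool" where
  "derivation d \<longleftrightarrow> (\<forall>a b. d (a + b) = d a + d b) \<and> (\<forall>a b. d (a * b) = d a * b + a * d b)"

lemma derivation_dl: "derivation (dl k l)"
  unfolding derivation_def
  by (intro conjI allI; rule dl_eqI)
     (auto simp: app_add app_mult app_Lrot_fun Lrot_add smooth_app app_fadd smooth_Lrot)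

lemma dl_cst: "dl k l (cst c) = 0"
  by (rule dl_eqI) (auto simp: app_cst smooth_Lrot Lrot_cmult app_zero)

lemma dl_X: "dl k l (X m) = (if m = k then X l else 0) - (if m = l then X k else 0)"
  by (rule dl_eqI) (auto simp: app_X smooth_Lrot Lrot_commutator_X app_minus app_zero)


section \<open>Subalgebras and the symbol map\<close>

inductive_set alg :: "'n::finite diffop set \<Rightarrow> 'n diffop set" for G where
  cst: "cst c \<in> alg G"
| gen: "A \<in> G \<Longrightarrow> A \<in> alg G"
| add: "A \<in> alg G \<Longrightarrow> B \<in> alg G \<Longrightarrow> A + B \<in> alg G"
| mult: "A \<in> alg G \<Longrightarrow> B \<in> alg G \<Longrightarrow> A * B \<in> alg G"

lemma alg_0: "0 \<in> alg G" and alg_1: "1 \<in> alg G"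
  using alg.cst[of 0] alg.cst[of 1] by (simp_all add: cst_simps)

lemma alg_uminus: "A \<in> alg G \<Longrightarrow> - A \<in> alg G"
  using alg.mult[OF alg.cst[of "-1"], of A G] by (simp add: uminus_diffop_def)

lemma alg_minus: "A \<in> alg G \<Longrightarrow> B \<in> alg G \<Longrightarrow> A - B \<in> alg G"
  using alg.add[OF _ alg_uminus, of A G B] by simp

lemma alg_sum: "(\<And>k. k \<in> I \<Longrightarrow> A k \<in> alg G) \<Longrightarrow> (\<Sum>k\<in>I. A k) \<in> alg G"
  by (induction I rule: infinite_finite_induct) (auto intro: alg.add alg_0)

lemma alg_power: "A \<in> alg G \<Longrightarrow> A ^ k \<in> alg G"
  by (induction k) (auto intro: alg.mult alg_1)

lemma alg_mono: "A \<in> alg G \<Longrightarrow> G \<subseteq> H \<Longrightarrow> A \<in> alg H"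
  by (induction rule: alg.induct) (auto intro: alg.intros)

text \<open>Singling out one generator prepares inductions on the number of variables.\<close>

lemma alg_insert_poly:
  assumes "A \<in> alg (insert g G)"
  obtains p where "\<And>k. coeff p k \<in> alg G" "A = poly p g"
proof -
  have "\<exists>p. (\<forall>k. coeff p k \<in> alg G) \<and> A = poly p g"
    using assms
  proof (induction rule: alg.induct)
    case (cst c)
    then show ?case by (intro exI[of _ "[:cst c:]"]) (auto simp: coeff_pCons alg_0 alg.cst split: nat.split)
  next
    case (gen A)
    show ?case
    proof (cases "A = g")
      case True
      then show ?thesis by (intro exI[of _ "[:0, 1:]"]) (auto simp: coeff_pCons alg_0 alg_1 split: nat.split)
    next
      case False
      with gen have "A \<in> alg G" by (auto intro: alg.gen)
      then show ?thesis by (intro exI[of _ "[:A:]"]) (auto simp: coeff_pCons alg_0 split: nat.split)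
    qed
  next
    case (add A B)
    then obtain p q where "\<forall>k. coeff p k \<in> alg G" "A = poly p g" "\<forall>k. coeff q k \<in> alg G" "B = poly q g" by blast
    then show ?case by (intro exI[of _ "p + q"]) (auto intro: alg.add)
  next
    case (mult A B)
    then obtain p q where "\<forall>k. coeff p k \<in> alg G" "A = poly p g" "\<forall>k. coeff q k \<in> alg G" "B = poly q g" by blast
    then show ?case by (intro exI[of _ "p * q"]) (auto simp: coeff_mult intro!: alg_sum alg.mult)
  qed
  with that show ?thesis by blast
qed

lemma ev_poly: "ev (poly p g) z = (\<Sum>k\<le>degree p. ev (coeff p k) z * ev g z ^ k)"
  by (simp add: poly_altdef)

lemma alg_range_X: "A \<in> alg (range X)"
  by (induction A rule: diffop_induct) (auto intro: alg.intros)

lemma ev_alg_cong: "A \<in> alg G \<Longrightarrow> (\<And>B. B \<in> G \<Longrightarrow> ev B z = ev B w) \<Longrightarrow> ev A z = ev A w"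
  by (induction rule: alg.induct) auto

text \<open>Identity principle for polynomials, by induction on the variables: with all coordinates
  but the \<open>i\<close>-th fixed, a polynomial in one variable that vanishes everywhere has zero
  coefficients. Operators can thus be compared through their symbols.\<close>

lemma ev_eq_0_imp_eq_0:
  fixes A :: "'n::finite diffop"
  assumes "\<And>z. ev A z = 0"
  shows "A = 0"
proof -
  have *: "A = 0" if "finite I" "A \<in> alg (X ` I)" "\<forall>z. ev A z = 0" for I :: "'n set" and A
    using that
  proof (induction I arbitrary: A rule: finite_induct)
    case empty
    from empty(1) have "\<exists>c. A = cst c"
      by (simp, induction rule: alg.induct) (auto simp flip: cst_simps)
    then show ?case using empty by (auto simp: cst_simps)
  next
    case (insert i I)
    obtain p where p: "\<And>k. coeff p k \<in> alg (X ` I)" "A = poly p (X i)"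
      using insert.prems(1) by (auto elim: alg_insert_poly)
    have "coeff p k = 0" if k: "k \<le> degree p" for k
    proof (rule insert.IH[OF p(1)], rule allI)
      fix z
      have "(\<Sum>k\<le>degree p. ev (coeff p k) z * t ^ k) = 0" for t
      proof -
        define z' where "z' = (\<chi> l. if l = i then t else z $ l)"
        have "ev (coeff p k) z' = ev (coeff p k) z" for k
          by (rule ev_alg_cong[OF p(1)]) (use insert.hyps in \<open>auto simp: z'_def\<close>)
        then have "ev A z' = (\<Sum>k\<le>degree p. ev (coeff p k) z * t ^ k)"
          by (simp add: p(2) ev_poly) (simp add: z'_def)
        thus ?thesis using insert.prems(2) by simp
      qed
      then show "ev (coeff p k) z = 0"
        using polyfun_eq_0[of "\<lambda>k. ev (coeff p k) z" "degree p"] k by auto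
    qed
    then have "p = 0" by (metis leading_coeff_0_iff order_refl)
    then show ?case using p by simp
  qed
  show ?thesis by (rule *[of UNIV]) (simp_all add: assms alg_range_X)
qed

lemma derivation_zero: "derivation d \<Longrightarrow> d 0 = 0"
  unfolding derivation_def by (metis add.right_neutral add_left_cancel)

text \<open>Both sides obey the Leibniz rule, so it is enough that \<open>c\<close> is an integral
  curve, up to the factor \<open>w\<close>, of the vector field belonging to \<open>d\<close>; this
  concerns the coordinates only.\<close>

lemma ev_curve_derivative:
  assumes d: "derivation d" "\<And>c. d (cst c) = 0"
    and X: "\<And>m. ((\<lambda>t. c t $ m) has_field_derivative ev (d (X m)) (c t0) * w) (at t0)"
  shows "((\<lambda>t. ev A (c t)) has_field_derivative ev (d A) (c t0) * w) (at t0)"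
proof (induction A rule: diffop_induct)
  case (add A B)
  then show ?case using d(1) by (auto simp: derivation_def algebra_simps intro!: derivative_eq_intros)
next
  case (mult A B)
  then show ?case using d(1) by (auto simp: derivation_def algebra_simps intro!: derivative_eq_intros)
qed (auto simp: d X)

lemma derivation_cmult: "derivation d \<Longrightarrow> derivation (\<lambda>a. c * d a)"
  by (auto simp: derivation_def algebra_simps)

section \<open>Orbit coordinates\<close>

text \<open>On \<open>\<zeta> \<noteq> 0\<close> the functions \<open>\<zeta> = z\<^sub>i + \<i> z\<^sub>j\<close>, \<open>sq = z \<cdot> z\<close> and \<open>z\<^sub>l\<close> (\<open>l \<noteq> i, j\<close>) are
  coordinates, and \<open>pt\<close> is the inverse chart.\<close>

locale plane =
  fixes i j :: "'n::finite"
  assumes ij: "i \<noteq> j"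
begin

definition \<zeta> :: "'n diffop" where "\<zeta> = X i + cst \<i> * X j"
definition sq :: "'n diffop" where "sq = (\<Sum>l\<in>UNIV. X l * X l)"
definition rest :: "'n set" where "rest = UNIV - {i, j}"

text \<open>Solved from \<open>(z\<^sub>i + \<i> z\<^sub>j) (z\<^sub>i - \<i> z\<^sub>j) =
  z\<^sub>i\<^sup>2 + z\<^sub>j\<^sup>2\<close>: the first factor is \<open>w\<close>, and the
  product is what \<open>s\<close> leaves after subtracting the squares in
  \<open>rest\<close>.\<close>

definition pt :: "complex \<Rightarrow> complex \<Rightarrow> complex ^ 'n \<Rightarrow> complex ^ 'n" where
  "pt w s z = (\<chi> l. if l = i then (w + (s - (\<Sum>l\<in>rest. (z $ l)\<^sup>2)) / w) / 2
     else if l = j then (w - (s - (\<Sum>l\<in>rest. (z $ l)\<^sup>2)) / w) / (2 * \<i>) else z $ l)"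

lemma sum_rest: "(\<Sum>l\<in>UNIV. f l) = f i + f j + (\<Sum>l\<in>rest. f l)" for f :: "'n \<Rightarrow> 'b::comm_monoid_add"
proof -
  have "UNIV = insert i (insert j rest)" by (auto simp: rest_def)
  then have "(\<Sum>l\<in>UNIV. f l) = (\<Sum>l\<in>insert i (insert j rest). f l)" by simp
  also have "\<dots> = f i + f j + (\<Sum>l\<in>rest. f l)" using ij by (simp add: rest_def add.assoc)
  finally show ?thesis .
qed

lemma ev_\<zeta>: "ev \<zeta> z = z $ i + \<i> * z $ j" by (simp add: \<zeta>_def)
lemma ev_sq: "ev sq z = (\<Sum>l\<in>UNIV. (z $ l)\<^sup>2)" by (simp add: sq_def power2_eq_square)

lemma pt_rest: "l \<in> rest \<Longrightarrow> pt w s z $ l = z $ l"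
  by (simp add: pt_def rest_def)

lemma ev_\<zeta>_pt: "ev \<zeta> (pt w s z) = w"
  using ij by (simp add: ev_\<zeta> pt_def field_simps)

lemma ev_sq_pt:
  assumes "w \<noteq> 0"
  shows "ev sq (pt w s z) = s"
proof -
  have "(\<Sum>l\<in>rest. (pt w s z $ l)\<^sup>2) = (\<Sum>l\<in>rest. (z $ l)\<^sup>2)" by (simp add: pt_rest)
  then show ?thesis
    using assms ij by (simp add: ev_sq sum_rest pt_def power2_eq_square field_simps)
qed

lemma pt_self:
  assumes "ev \<zeta> z \<noteq> 0"
  shows "pt (ev \<zeta> z) (ev sq z) z = z"
proof -
  define w where "w = ev \<zeta> z"
  have "ev sq z - (\<Sum>l\<in>rest. (z $ l)\<^sup>2) = w * (z $ i - \<i> * z $ j)"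
    by (simp add: ev_sq sum_rest w_def ev_\<zeta> power2_eq_square algebra_simps)
  then have "(ev sq z - (\<Sum>l\<in>rest. (z $ l)\<^sup>2)) / w = z $ i - \<i> * z $ j"
    using assms w_def by simp
  then show ?thesis
    using ij by (simp add: pt_def vec_eq_iff flip: w_def) (simp add: w_def ev_\<zeta>)
qed

definition S :: "'n diffop set" where "S = alg ({\<zeta>, sq} \<union> X ` rest)"

lemma \<zeta>_in_S: "\<zeta> \<in> S" and sq_in_S: "sq \<in> S" and rest_in_S: "l \<in> rest \<Longrightarrow> X l \<in> S"
  by (auto simp: S_def intro: alg.gen)

text \<open>Once \<zeta> is inverted, every polynomial is one in the orbit coordinates:
  \<open>X i\<close> and \<open>X j\<close> are combinations of \<zeta> and
  \<open>X i - \<i> X j\<close>, and the latter times \<zeta> is \<open>sq\<close> minus the squares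
  in \<open>rest\<close>.\<close>

lemma \<zeta>_power_in_S: "\<exists>N. \<zeta> ^ N * A \<in> S"
proof (induction A rule: diffop_induct)
  case (cst c)
  show ?case by (intro exI[of _ 0]) (auto simp: S_def intro: alg.cst)
next
  case (X m)
  define \<rho> :: "'n diffop" where "\<rho> = (\<Sum>l\<in>rest. X l * X l)"
  have rho: "\<rho> \<in> S" unfolding \<rho>_def
    using rest_in_S unfolding S_def by (auto intro!: alg_sum alg.mult)
  have h: "cst (1/2) + cst (1/2) = (1 :: 'n diffop)" "cst \<i> * cst \<i> = (-1 :: 'n diffop)"
    by (auto simp flip: cst_simps) (simp add: cst_simps uminus_diffop_def)
  have eq: "\<zeta> * (X i - cst \<i> * X j) = sq - \<rho>"
  proof -
    have "\<zeta> * (X i - cst \<i> * X j) = X i * X i - cst \<i> * cst \<i> * (X j * X j)"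
      unfolding \<zeta>_def by (simp add: algebra_simps)
    then show ?thesis by (simp add: h sq_def \<rho>_def sum_rest)
  qed
  have "\<zeta> * X i = cst (1/2) * (\<zeta> * \<zeta> + (sq - \<rho>))"
  proof -
    have "\<zeta> * X i = (cst (1/2) + cst (1/2)) * (\<zeta> * X i)" by (simp add: h)
    also have "\<dots> = cst (1/2) * (\<zeta> * \<zeta> + \<zeta> * (X i - cst \<i> * X j))" 
      unfolding \<zeta>_def by (simp add: algebra_simps)
    finally show ?thesis by (simp add: eq)
  qed
  moreover have "\<zeta> * X j = cst (-\<i>/2) * (\<zeta> * \<zeta> - (sq - \<rho>))"
  proof -
    have c: "cst (-\<i>/2) * cst \<i> + cst (-\<i>/2) * cst \<i> = (1 :: 'n diffop)"
      by (simp flip: cst_simps)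
    have "\<zeta> * X j = (cst (-\<i>/2) * cst \<i> + cst (-\<i>/2) * cst \<i>) * (\<zeta> * X j)" by (simp only: c mult_1)
    also have "\<dots> = cst (-\<i>/2) * (\<zeta> * \<zeta> - \<zeta> * (X i - cst \<i> * X j))" 
      unfolding \<zeta>_def by (simp add: algebra_simps)
    finally show ?thesis by (simp add: eq)
  qed
  ultimately have "\<zeta> * X m \<in> S"
  proof -
    have "\<zeta> * X i \<in> S" "\<zeta> * X j \<in> S"
      unfolding \<open>\<zeta> * X i = _\<close> \<open>\<zeta> * X j = _\<close>
      using rho \<zeta>_in_S sq_in_S unfolding S_def by (auto intro!: alg.mult alg.add alg_minus alg.cst)
    moreover have "\<zeta> * X m \<in> S" if "m \<in> rest"
      using rest_in_S[OF that] \<zeta>_in_S unfolding S_def by (rule alg.mult[rotated])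
    ultimately show ?thesis by (cases "m = i"; cases "m = j") (auto simp: rest_def)
  qed
  then show ?case by (intro exI[of _ 1]) simp
next
  case (add A B)
  then obtain N M where NM: "\<zeta> ^ N * A \<in> S" "\<zeta> ^ M * B \<in> S" by blast
  have "\<zeta> ^ (N + M) * (A + B) = \<zeta> ^ M * (\<zeta> ^ N * A) + \<zeta> ^ N * (\<zeta> ^ M * B)"
    by (simp add: power_add algebra_simps)
  then show ?case using NM \<zeta>_in_S unfolding S_def by (metis alg.add alg.mult alg_power)
next
  case (mult A B)
  then obtain N M where NM: "\<zeta> ^ N * A \<in> S" "\<zeta> ^ M * B \<in> S" by blast
  have "\<zeta> ^ (N + M) * (A * B) = (\<zeta> ^ N * A) * (\<zeta> ^ M * B)"
    by (simp add: power_add algebra_simps)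
  then show ?case using NM unfolding S_def by (metis alg.mult)
qed

text \<open>The segment is straight in the orbit coordinates, not in the ambient space, so it can
  join two points without leaving a level set of \<open>sq\<close>.\<close>

lemma S_path_poly:
  assumes "A \<in> S"
  shows "\<exists>q. \<forall>t. w + t * w' \<noteq> 0 \<longrightarrow> ev A (pt (w + t * w') (s + t * s') (\<chi> l. z $ l + t * z' $ l)) = poly q t"
  using assms unfolding S_def
proof (induction rule: alg.induct)
  case (cst c)
  show ?case by (intro exI[of _ "[:c:]"]) auto
next
  case (gen A)
  then consider "A = \<zeta>" | "A = sq" | l where "l \<in> rest" "A = X l" by blast
  then show ?case
  proof cases
    case 1 then show ?thesis by (intro exI[of _ "[:w, w':]"]) (auto simp: ev_\<zeta>_pt)
  next
    case 2 then show ?thesis by (intro exI[of _ "[:s, s':]"]) (auto simp: ev_sq_pt)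
  next
    case 3 then show ?thesis by (intro exI[of _ "[:z $ l, z' $ l:]"]) (auto simp: pt_rest)
  qed
next
  case (add A B)
  then obtain p q where "\<forall>t. w + t * w' \<noteq> 0 \<longrightarrow> ev A (pt (w + t * w') (s + t * s') (\<chi> l. z $ l + t * z' $ l)) = poly p t"
    "\<forall>t. w + t * w' \<noteq> 0 \<longrightarrow> ev B (pt (w + t * w') (s + t * s') (\<chi> l. z $ l + t * z' $ l)) = poly q t" by blast
  then show ?case by (intro exI[of _ "p + q"]) auto
next
  case (mult A B)
  then obtain p q where "\<forall>t. w + t * w' \<noteq> 0 \<longrightarrow> ev A (pt (w + t * w') (s + t * s') (\<chi> l. z $ l + t * z' $ l)) = poly p t"
    "\<forall>t. w + t * w' \<noteq> 0 \<longrightarrow> ev B (pt (w + t * w') (s + t * s') (\<chi> l. z $ l + t * z' $ l)) = poly q t" by blast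
  then show ?case by (intro exI[of _ "p * q"]) auto
qed

definition U :: "complex set \<Rightarrow> (complex ^ 'n) set" where
  "U \<Lambda> = {z. ev \<zeta> z \<noteq> 0 \<and> ev sq z \<in> \<Lambda>}"

text \<open>Irreducibility of \<open>U \<Lambda>\<close>: on a coordinate segment joining the two
  points, both functions become polynomials in \<open>t\<close> up to powers of \<zeta>, each
  nonzero at one end. If \<open>\<Lambda>\<close> is a single value, \<open>sq\<close> is constant
  on the segment.\<close>

lemma U_dense:
  assumes \<Lambda>: "\<Lambda> = UNIV \<or> \<Lambda> = {l}"
    and z1: "z1 \<in> U \<Lambda>" "ev A z1 \<noteq> 0" and z2: "z2 \<in> U \<Lambda>" "ev B z2 \<noteq> 0"
  shows "\<exists>z \<in> U \<Lambda>. ev A z \<noteq> 0 \<and> ev B z \<noteq> 0"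
proof -
  obtain N M where N: "\<zeta> ^ N * A \<in> S" and M: "\<zeta> ^ M * B \<in> S" using \<zeta>_power_in_S by blast
  define w where "w = ev \<zeta> z1"
  define w' where "w' = ev \<zeta> z2 - ev \<zeta> z1"
  define c where "c t = pt (w + t * w') (ev sq z1 + t * (ev sq z2 - ev sq z1)) (\<chi> l. z1 $ l + t * (z2 - z1) $ l)" for t
  obtain p where p: "\<And>t. w + t * w' \<noteq> 0 \<Longrightarrow> ev (\<zeta> ^ N * A) (c t) = poly p t"
    using S_path_poly[OF N] unfolding c_def by blast
  obtain q where q: "\<And>t. w + t * w' \<noteq> 0 \<Longrightarrow> ev (\<zeta> ^ M * B) (c t) = poly q t"
    using S_path_poly[OF M] unfolding c_def by blast
  have w: "w \<noteq> 0" "w + w' \<noteq> 0" using z1 z2 by (auto simp: w_def w'_def U_def)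
  have c0: "c 0 = z1"
    using pt_self[of z1] w by (simp add: c_def w_def)
  have c1: "c 1 = z2"
    using pt_self[of z2] w by (simp add: c_def w_def w'_def vec_lambda_eta)
  have "ev (\<zeta> ^ N * A) z1 \<noteq> 0" "ev (\<zeta> ^ M * B) z2 \<noteq> 0" using z1 z2 by (auto simp: U_def)
  then have "poly p 0 \<noteq> 0" "poly q 1 \<noteq> 0" using p[of 0] q[of 1] w by (simp_all only: c0 c1 mult_1 mult_zero_left add_0_right simp_thms not_False_eq_True)
  \<comment> \<open>The linear factor is \<zeta> along the segment; it keeps \<open>t\<close> away
    from the point where the chart fails.\<close>
  then have "p \<noteq> 0" "q \<noteq> 0" "[:w, w':] \<noteq> 0" using w by auto
  then have "p * q * [:w, w':] \<noteq> 0" by (metis mult_eq_0_iff)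
  then obtain t where "poly (p * q * [:w, w':]) t \<noteq> 0" using poly_all_0_iff_0 by metis
  then have "poly p t \<noteq> 0" "poly q t \<noteq> 0" "poly [:w, w':] t \<noteq> 0" by (auto simp only: poly_mult mult_eq_0_iff)
  then have t: "poly p t \<noteq> 0" "poly q t \<noteq> 0" "w + t * w' \<noteq> 0" by auto
  have "ev A (c t) \<noteq> 0" "ev B (c t) \<noteq> 0"
    using p[OF t(3)] q[OF t(3)] t by auto
  moreover have "c t \<in> U \<Lambda>"
    using \<Lambda> z1 z2 t(3) by (auto simp: U_def c_def ev_\<zeta>_pt ev_sq_pt)
  ultimately show ?thesis by blast
qed

subsection \<open>The torus action\<close>

text \<open>In the coordinates above \<open>D\<close> is \<open>\<zeta> \<partial>/\<partial>\<zeta>\<close>.\<close>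

definition D :: "'n diffop \<Rightarrow> 'n diffop" where "D A = cst \<i> * dl i j A"

lemma derivation_D: "derivation D"
  unfolding D_def[abs_def] by (intro derivation_cmult derivation_dl)

lemma D_cst: "D (cst c) = 0" by (simp add: D_def dl_cst)

text \<open>The orbit of \<open>z\<close> under complexified rotations of the plane
  \<open>i, j\<close>: they multiply \<zeta> by \<open>t\<close>, divide
  \<open>z\<^sub>i - \<i> z\<^sub>j\<close> by \<open>t\<close> and fix the other coordinates.
  Values of \<open>t\<close> on the unit circle belong to rotations by real angles.\<close>

definition orb :: "complex ^ 'n \<Rightarrow> complex \<Rightarrow> complex ^ 'n" where
  "orb z t = pt (t * ev \<zeta> z) (ev sq z) z"

lemma orb_1: "ev \<zeta> z \<noteq> 0 \<Longrightarrow> orb z 1 = z"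
  by (simp add: orb_def pt_self)

lemma orb_U: "z \<in> U \<Lambda> \<Longrightarrow> t \<noteq> 0 \<Longrightarrow> orb z t \<in> U \<Lambda>"
  by (auto simp: U_def orb_def ev_\<zeta>_pt ev_sq_pt)

lemma orb_coords:
  assumes "ev \<zeta> z \<noteq> 0" "t \<noteq> 0"
  shows "orb z t $ i = (t * ev \<zeta> z + (z $ i - \<i> * z $ j) / t) / 2"
    "orb z t $ j = (t * ev \<zeta> z - (z $ i - \<i> * z $ j) / t) / (2 * \<i>)"
    "l \<in> rest \<Longrightarrow> orb z t $ l = z $ l"
proof -
  define w where "w = ev \<zeta> z"
  have "ev sq z - (\<Sum>l\<in>rest. (z $ l)\<^sup>2) = w * (z $ i - \<i> * z $ j)"
    by (simp add: ev_sq sum_rest w_def ev_\<zeta> power2_eq_square algebra_simps)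
  then have *: "(ev sq z - (\<Sum>l\<in>rest. (z $ l)\<^sup>2)) / (t * w) = (z $ i - \<i> * z $ j) / t"
    using assms w_def by simp
  show "orb z t $ i = (t * ev \<zeta> z + (z $ i - \<i> * z $ j) / t) / 2"
    "orb z t $ j = (t * ev \<zeta> z - (z $ i - \<i> * z $ j) / t) / (2 * \<i>)"
    "l \<in> rest \<Longrightarrow> orb z t $ l = z $ l"
    using ij by (simp_all add: orb_def pt_def * flip: w_def) (auto simp: rest_def)
qed

lemma orb_coord_derivative:
  assumes z: "ev \<zeta> z \<noteq> 0" and t: "t \<noteq> 0"
  shows "((\<lambda>t. orb z t $ m) has_field_derivative ev (D (X m)) (orb z t) * (1 / t)) (at t)"
proof -
  define g where "g t = (if m = i then (t * ev \<zeta> z + (z $ i - \<i> * z $ j) / t) / 2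
    else if m = j then (t * ev \<zeta> z - (z $ i - \<i> * z $ j) / t) / (2 * \<i>) else z $ m)" for t
  have eq: "g t = orb z t $ m" if "t \<noteq> 0" for t
    using orb_coords[OF z that] by (auto simp: g_def rest_def)
  have "(g has_field_derivative ev (D (X m)) (orb z t) * (1 / t)) (at t)"
  proof -
    consider "m = i" | "m = j" | "m \<in> rest" by (auto simp: rest_def)
    then show ?thesis
    proof cases
      case 1
      then show ?thesis using t ij unfolding g_def[abs_def]
        by (auto intro!: derivative_eq_intros simp: D_def dl_X orb_coords[OF z t] field_simps power2_eq_square)
    next
      case 2
      then show ?thesis using t ij unfolding g_def[abs_def]
        by (auto intro!: derivative_eq_intros simp: D_def dl_X orb_coords[OF z t] field_simps power2_eq_square)
    next
      case 3
      then show ?thesis unfolding g_def[abs_def]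
        by (auto simp: D_def dl_X rest_def)
    qed
  qed
  then show ?thesis
    by (rule has_field_derivative_transform_within_open[where S="-{0}"]) (use t eq in auto)
qed

text \<open>\<open>D\<close> corresponds to \<open>t d/dt\<close>, whence the factor
  \<open>1 / t\<close>.\<close>

lemma orb_derivative:
  assumes "ev \<zeta> z \<noteq> 0" "t \<noteq> 0"
  shows "((\<lambda>t. ev A (orb z t)) has_field_derivative ev (D A) (orb z t) * (1 / t)) (at t)"
  by (rule ev_curve_derivative[OF derivation_D D_cst orb_coord_derivative[OF assms]])

lemma orb_poly:
  assumes "ev \<zeta> z \<noteq> 0"
  shows "\<exists>N q. \<forall>t. t \<noteq> 0 \<longrightarrow> ev A (orb z t) = poly q t / t ^ N"
proof -
  obtain N where N: "\<zeta> ^ N * A \<in> S" using \<zeta>_power_in_S by blast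
  obtain q where q: "\<And>t. t * ev \<zeta> z \<noteq> 0 \<Longrightarrow> ev (\<zeta> ^ N * A) (orb z t) = poly q t"
    using S_path_poly[OF N, of 0 "ev \<zeta> z" "ev sq z" 0 z 0] unfolding orb_def by (auto simp: vec_lambda_eta)
  have "ev A (orb z t) = poly (smult (1 / ev \<zeta> z ^ N) q) t / t ^ N" if "t \<noteq> 0" for t
    using q[of t] that assms by (simp add: orb_def ev_\<zeta>_pt power_mult_distrib field_simps)
  then show ?thesis by blast
qed

end


section \<open>Eliminating all vertices but one\<close>

context plane
begin

text \<open>\<open>D\<close> applied to the linear form with coefficients \<open>v\<close>, that is,
  the logarithmic derivative of \<open>exp (z \<cdot> v)\<close> along the torus action. It is
  linear in \<open>v\<close>, so rates of two vertices differ by the rate of their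
  difference.\<close>

definition rate :: "real ^ 'n \<Rightarrow> 'n diffop" where
  "rate v = cst (\<i> * complex_of_real (v $ i)) * X j - cst (\<i> * complex_of_real (v $ j)) * X i"

lemma cst_diff: "cst (a - b) = cst a - cst b"
  by (rule diffop_eqI) (simp add: app_cst app_minus left_diff_distrib)

definition vanishes :: "complex set \<Rightarrow> 'n diffop \<Rightarrow> bool" where
  "vanishes \<Lambda> A \<longleftrightarrow> (\<forall>z\<in>U \<Lambda>. ev A z = 0)"

lemma vanishes_D:
  assumes "vanishes \<Lambda> A"
  shows "vanishes \<Lambda> (D A)"
  unfolding vanishes_def
proof
  fix z assume z: "z \<in> U \<Lambda>"
  then have w: "ev \<zeta> z \<noteq> 0" by (simp add: U_def)
  have "((\<lambda>t. ev A (orb z t)) has_field_derivative 0) (at 1)"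
  proof (rule has_field_derivative_transform_within_open[OF DERIV_const[of 0], where S="-{0}"])
    show "0 = ev A (orb z t)" if "t \<in> -{0}" for t
      using assms orb_U[OF z, of t] that by (auto simp: vanishes_def)
  qed auto
  then have "ev (D A) (orb z 1) * (1 / 1) = 0"
    using orb_derivative[OF w, of 1 A] DERIV_unique by fastforce
  then show "ev (D A) z = 0" by (simp add: orb_1 w)
qed

lemma rate_orb:
  assumes "ev \<zeta> z \<noteq> 0" "t \<noteq> 0"
  shows "ev (rate u) (orb z t) = ev \<zeta> z * (u $ i - \<i> * u $ j) / 2 * t - (z $ i - \<i> * z $ j) * (u $ i + \<i> * u $ j) / 2 / t"
  using assms by (simp add: rate_def orb_coords field_simps)

lemma poly_deriv_at:
  fixes t :: complex
  assumes t: "t \<noteq> 0"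
  shows "((\<lambda>t. poly q t / t ^ N) has_field_derivative (poly (pderiv q) t - of_nat N * poly q t / t) / t ^ N) (at t)"
proof -
  have "of_nat N * t ^ (N - Suc 0) = of_nat N * t ^ N / t"
    using t by (cases N) auto
  moreover have "((\<lambda>t. poly q t / t ^ N) has_field_derivative
      (poly (pderiv q) t * t ^ N - poly q t * (of_nat N * t ^ (N - Suc 0))) / (t ^ N * t ^ N)) (at t)"
    using t by (auto intro!: derivative_eq_intros)
  ultimately show ?thesis using t by (auto simp: field_simps elim!: DERIV_cong)
qed

text \<open>Along an orbit the two logarithmic derivatives stay bounded as \<open>t \<rightarrow> \<infinity>\<close>, whereas the rate
  grows linearly.\<close>

lemma wronskian_not_vanishes:
  assumes z: "z \<in> U \<Lambda>" and A: "ev A z \<noteq> 0" and B: "ev B z \<noteq> 0" and u: "u $ i \<noteq> 0"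
  shows "\<not> vanishes \<Lambda> (B * D A - A * D B + rate u * (A * B))"
proof
  assume van: "vanishes \<Lambda> (B * D A - A * D B + rate u * (A * B))"
  have w: "ev \<zeta> z \<noteq> 0" using z by (simp add: U_def)
  obtain N a where a: "\<And>t. t \<noteq> 0 \<Longrightarrow> ev A (orb z t) = poly a t / t ^ N" using orb_poly[OF w, of A] by blast
  obtain M b where b: "\<And>t. t \<noteq> 0 \<Longrightarrow> ev B (orb z t) = poly b t / t ^ M" using orb_poly[OF w, of B] by blast
  have nz: "a \<noteq> 0" "b \<noteq> 0" using a[of 1] b[of 1] A B orb_1[OF w] by auto
  have der: "ev (D C) (orb z t) = (t * poly (pderiv c) t - of_nat K * poly c t) / t ^ K"
    if c: "\<And>t. t \<noteq> 0 \<Longrightarrow> ev C (orb z t) = poly c t / t ^ K" and t: "t \<noteq> 0" for C c K t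
  proof -
    have "((\<lambda>t. ev C (orb z t)) has_field_derivative (poly (pderiv c) t - of_nat K * poly c t / t) / t ^ K) (at t)"
      by (rule has_field_derivative_transform_within_open[OF poly_deriv_at[OF t], where S="-{0}"]) (use t c in auto)
    then have "ev (D C) (orb z t) * (1 / t) = (poly (pderiv c) t - of_nat K * poly c t / t) / t ^ K"
      using orb_derivative[OF w t, of C] DERIV_unique by blast
    then show ?thesis using t by (simp add: field_simps)
  qed
  define \<alpha> where "\<alpha> = ev \<zeta> z * (u $ i - \<i> * u $ j) / 2"
  define \<beta> where "\<beta> = (z $ i - \<i> * z $ j) * (u $ i + \<i> * u $ j) / 2"
  \<comment> \<open>Here it matters that \<open>u\<close> is real: the real part of this number is
    \<open>u $ i\<close>.\<close>
  have "u $ i - \<i> * u $ j \<noteq> 0" using u by (simp add: complex_eq_iff)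
  then have \<alpha>: "\<alpha> \<noteq> 0" using w by (simp add: \<alpha>_def)
  define T :: "complex poly" where "T = [:0, 1:]"
  \<comment> \<open>The identity multiplied by \<open>t ^ (N + M + 1)\<close>; the extra power
    clears the term \<open>\<beta> / t\<close> of the rate.\<close>
  let ?L = "[:-\<beta>, 0, \<alpha>:] * (a * b)"
  let ?R = "T * (a * (T * pderiv b - of_nat M * b) - b * (T * pderiv a - of_nat N * a))"
  \<comment> \<open>The factor \<open>T\<close> takes care of \<open>t = 0\<close>, which is not on
    the orbit.\<close>
  have "poly (T * (?L - ?R)) t = 0" for t
  proof (cases "t = 0")
    case False
    have e: "poly b t / t ^ M * ((t * poly (pderiv a) t - of_nat N * poly a t) / t ^ N)
      - poly a t / t ^ N * ((t * poly (pderiv b) t - of_nat M * poly b t) / t ^ M)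
      + (\<alpha> * t - \<beta> / t) * (poly a t / t ^ N * (poly b t / t ^ M)) = 0"
    proof -
      have "ev B (orb z t) * ev (D A) (orb z t) - ev A (orb z t) * ev (D B) (orb z t)
          + ev (rate u) (orb z t) * (ev A (orb z t) * ev B (orb z t)) = 0"
        using van orb_U[OF z False] by (simp add: vanishes_def)
      moreover have "ev (D A) (orb z t) = (t * poly (pderiv a) t - of_nat N * poly a t) / t ^ N"
        "ev (D B) (orb z t) = (t * poly (pderiv b) t - of_nat M * poly b t) / t ^ M"
        by (rule der; use a b False in auto)+
      ultimately show ?thesis
        by (simp only: a[OF False] b[OF False] rate_orb[OF w False] \<alpha>_def \<beta>_def)
    qed
    define x where "x = poly b t * (t * poly (pderiv a) t - of_nat N * poly a t)
      - poly a t * (t * poly (pderiv b) t - of_nat M * poly b t) + (\<alpha> * t - \<beta> / t) * (poly a t * poly b t)"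
    have "x / (t ^ N * t ^ M) = 0"
    proof -
      have gen: "b / y * (c / x) - a / x * (d / y) + g * (a / x * (b / y)) = (b * c - a * d + g * (a * b)) / (x * y)"
        for a b c d g x y :: complex
        by (simp add: add_divide_distrib diff_divide_distrib mult.commute[of x y])
      show ?thesis unfolding x_def using e unfolding gen .
    qed
    then have "x = 0" using False by simp
    define g where "g = \<alpha> * t - \<beta> / t"
    have g: "t * g = \<alpha> * t * t - \<beta>" using False by (simp add: g_def field_simps)
    have "poly ?L t - poly ?R t = t * (poly b t * (t * poly (pderiv a) t - of_nat N * poly a t)
      - poly a t * (t * poly (pderiv b) t - of_nat M * poly b t)) + (t * g) * (poly a t * poly b t)"
      unfolding g T_def by (simp add: algebra_simps)
    also have "\<dots> = t * x" unfolding x_def g_def[symmetric] by (simp add: algebra_simps)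
    finally have "poly ?L t - poly ?R t = 0" using \<open>x = 0\<close> by simp
    then show ?thesis by simp
  qed (simp add: T_def)
  then have "T * (?L - ?R) = 0" using poly_all_0_iff_0 by blast
  then have LR: "?L = ?R" by (simp add: T_def)
  \<comment> \<open>Multiplying a derivative by \<open>T\<close> does not exceed the original
    degree, so \<open>?R\<close> has degree at most \<open>1 + degree a + degree b\<close>, too
    small for equality.\<close>
  have "degree ?L = 2 + (degree a + degree b)"
    using \<alpha> nz by (subst degree_mult_eq) (auto simp: degree_mult_eq)
  moreover have "degree ?R \<le> 1 + (degree a + degree b)"
  proof -
    have d: "degree (T * pderiv c - of_nat K * c) \<le> degree c" for c :: "complex poly" and K
    proof (rule degree_diff_le)
      show "degree (T * pderiv c) \<le> degree c"
      proof (cases "degree c")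
        case 0
        then have "pderiv c = 0" by (simp add: pderiv_eq_0_iff)
        then show ?thesis by simp
      next
        case (Suc n)
        then show ?thesis by (intro order_trans[OF degree_mult_le]) (simp add: T_def degree_pderiv)
      qed
      show "degree (of_nat K * c) \<le> degree c" 
        by (intro order_trans[OF degree_mult_le]) simp
    qed
    have "degree (a * (T * pderiv b - of_nat M * b) - b * (T * pderiv a - of_nat N * a)) \<le> degree a + degree b"
    proof (rule degree_diff_le)
      show "degree (a * (T * pderiv b - of_nat M * b)) \<le> degree a + degree b"
        using d[of b M] by (intro order_trans[OF degree_mult_le]) simp
      show "degree (b * (T * pderiv a - of_nat N * a)) \<le> degree a + degree b"
        using d[of a N] by (intro order_trans[OF degree_mult_le]) simp
    qed
    then show ?thesis by (intro order_trans[OF degree_mult_le]) (simp add: T_def)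
  qed
  ultimately show False using LR by simp
qed

text \<open>\<open>Rel\<close> is abstract because it stands for exponential sums on a sphere as
  well as for operators on a function space. Combining a relation with its rotated version cancels
  the coefficient of \<open>w\<close> and turns every other one into a Wronskian with the rate of
  \<open>v - w\<close>. Coefficients that vanished before still do, and
  \<open>wronskian_not_vanishes\<close> keeps that of \<open>v0\<close> alive, so the number of live
  vertices drops without reaching 0.\<close>

lemma eliminate_vertices:
  fixes Rel :: "(real ^ 'n \<Rightarrow> 'n diffop) \<Rightarrow> bool"
  assumes \<Lambda>: "\<Lambda> = UNIV \<or> \<Lambda> = {l}" and V: "finite V"
    and sep: "\<And>v w. v \<in> V \<Longrightarrow> w \<in> V \<Longrightarrow> v \<noteq> w \<Longrightarrow> v $ i \<noteq> w $ i"
    and mult: "\<And>p A. Rel p \<Longrightarrow> Rel (\<lambda>v. A * p v)"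
    and diff: "\<And>p q. Rel p \<Longrightarrow> Rel q \<Longrightarrow> Rel (\<lambda>v. p v - q v)"
    and rot: "\<And>p. Rel p \<Longrightarrow> Rel (\<lambda>v. D (p v) + rate v * p v)"
    and p: "Rel p" "v0 \<in> V" "\<not> vanishes \<Lambda> (p v0)"
  shows "\<exists>q w. Rel q \<and> w \<in> V \<and> \<not> vanishes \<Lambda> (q w) \<and> (\<forall>v\<in>V. v \<noteq> w \<longrightarrow> vanishes \<Lambda> (q v))"
  using p
proof (induction "card {v\<in>V. \<not> vanishes \<Lambda> (p v)}" arbitrary: p v0 rule: less_induct)
  case less
  show ?case
  proof (cases "\<forall>v\<in>V. v \<noteq> v0 \<longrightarrow> vanishes \<Lambda> (p v)")
    case True
    then show ?thesis using less.prems by blast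
  next
    case False
    then obtain w where w: "w \<in> V" "w \<noteq> v0" "\<not> vanishes \<Lambda> (p w)" by blast
    define h where "h v = p w * (D (p v) + rate v * p v) - (D (p w) + rate w * p w) * p v" for v
    have h: "Rel h" unfolding h_def[abs_def]
      by (intro diff mult rot less.prems)
    have heq: "h v = p w * D (p v) - p v * D (p w) + rate (v - w) * (p v * p w)" for v
    proof -
      have "rate (v - w) = rate v - rate w"
        by (simp add: rate_def cst_diff left_diff_distrib right_diff_distrib)
      then show ?thesis unfolding h_def by (simp only:) (simp add: algebra_simps)
    qed
    have hw: "vanishes \<Lambda> (h w)" by (simp add: h_def vanishes_def)
    have "\<not> vanishes \<Lambda> (h v0)"
    proof -
      obtain z1 z2 where "z1 \<in> U \<Lambda>" "ev (p v0) z1 \<noteq> 0" "z2 \<in> U \<Lambda>" "ev (p w) z2 \<noteq> 0"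
        using less.prems w by (auto simp: vanishes_def)
      then obtain z where "z \<in> U \<Lambda>" "ev (p v0) z \<noteq> 0" "ev (p w) z \<noteq> 0"
        using U_dense[OF \<Lambda>] by blast
      from wronskian_not_vanishes[OF this, of "v0 - w"] show ?thesis
        using sep[OF less.prems(2) w(1)] w(2) by (simp add: heq)
    qed
    moreover have "vanishes \<Lambda> (h v)" if "vanishes \<Lambda> (p v)" for v
      using that vanishes_D[OF that] by (simp add: vanishes_def heq)
    then have "{v\<in>V. \<not> vanishes \<Lambda> (h v)} \<subset> {v\<in>V. \<not> vanishes \<Lambda> (p v)}"
      using w hw by blast
    then have "card {v\<in>V. \<not> vanishes \<Lambda> (h v)} < card {v\<in>V. \<not> vanishes \<Lambda> (p v)}"
      using V by (intro psubset_card_mono) auto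
    ultimately show ?thesis using less.hyps[OF _ h less.prems(2)] by blast
  qed
qed

section \<open>Non-vanishing on complex spheres\<close>

lemma cexp_orb_derivative:
  assumes "ev \<zeta> z \<noteq> 0"
  shows "((\<lambda>t. cexp (orb z t) v) has_field_derivative ev (rate v) z * cexp z v) (at 1)"
proof -
  have "((\<lambda>t. cdot (orb z t) (of_real_vec v)) has_field_derivative
      (\<Sum>m\<in>UNIV. ev (D (X m)) (orb z 1) * (1 / 1) * complex_of_real (v $ m))) (at 1)"
    unfolding cdot_of_real_vec
    by (intro DERIV_sum DERIV_cmult_right orb_coord_derivative assms) auto
  also have "(\<Sum>m\<in>UNIV. ev (D (X m)) (orb z 1) * (1 / 1) * complex_of_real (v $ m)) = ev (rate v) z"
    using ij assms by (simp add: orb_1 sum_rest D_def dl_X rate_def) (auto simp: rest_def intro!: sum.neutral)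
  finally show ?thesis
    unfolding cexp_def using assms by (auto intro!: derivative_eq_intros simp: orb_1)
qed

text \<open>The point \<open>z0\<close> provides the start of the elimination: \<open>Q\<close> is
  nonzero at its shift, so by \<open>nv\<close> some coefficient is not identically zero on the
  shifted sphere.\<close>

lemma exponential_sum_not_vanishes:
  fixes I :: "complex ^ 'n \<Rightarrow> complex"
  assumes V: "finite V" and sep: "\<And>v w. v \<in> V \<Longrightarrow> w \<in> V \<Longrightarrow> v \<noteq> w \<Longrightarrow> v $ i \<noteq> w $ i"
    and I: "\<And>z. ev Q z * I z = (\<Sum>v\<in>V. ev (p v) z * cexp z v)"
    and nv: "\<And>z. ev Q z \<noteq> 0 \<Longrightarrow> \<exists>v\<in>V. ev (p v) z \<noteq> 0"
    and z0: "z0 \<in> U {l}" "ev Q (a + z0) \<noteq> 0"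
  shows "\<exists>z \<in> U {l}. I (a + z) \<noteq> 0"
proof (rule ccontr)
  assume "\<not> ?thesis"
  then have I0: "I (a + z) = 0" if "z \<in> U {l}" for z using that by blast
  obtain p' where p': "\<And>v z. ev (p' v) z = ev (p v) (a + z)"
    using ex_shifted_symbol[of "p _" a] by metis
  define Rel where "Rel q \<longleftrightarrow> (\<forall>z\<in>U {l}. (\<Sum>v\<in>V. ev (q v) z * cexp z v) = 0)" for q
  \<comment> \<open>Recentring at the origin: \<open>exp ((a + z) \<cdot> v)\<close> contributes the
    constant \<open>exp (a \<cdot> v)\<close> to the coefficient of \<open>v\<close>.\<close>
  have "Rel (\<lambda>v. cst (cexp a v) * p' v)"
    unfolding Rel_def
  proof
    fix z assume z: "z \<in> U {l}"
    have "cexp (a + z) v = cexp a v * cexp z v" for v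
      by (simp add: cexp_def cdot_of_real_vec algebra_simps sum.distrib exp_add)
    then have "(\<Sum>v\<in>V. ev (cst (cexp a v) * p' v) z * cexp z v) = ev Q (a + z) * I (a + z)"
      by (subst I) (simp add: p' mult_ac)
    then show "(\<Sum>v\<in>V. ev (cst (cexp a v) * p' v) z * cexp z v) = 0" using I0[OF z] by simp
  qed
  moreover obtain v0 where v0: "v0 \<in> V" "ev (p v0) (a + z0) \<noteq> 0" using nv[OF z0(2)] by blast
  then have "\<not> vanishes {l} (cst (cexp a v0) * p' v0)"
    using z0 by (auto simp: vanishes_def p' cexp_def)
  moreover have "Rel (\<lambda>v. D (q v) + rate v * q v)" if q: "Rel q" for q
    unfolding Rel_def
  proof
    fix z assume z: "z \<in> U {l}"
    then have w: "ev \<zeta> z \<noteq> 0" by (simp add: U_def)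
    have "((\<lambda>t. \<Sum>v\<in>V. ev (q v) (orb z t) * cexp (orb z t) v) has_field_derivative 0) (at 1)"
    proof (rule has_field_derivative_transform_within_open[OF DERIV_const[of 0], where S="-{0}"])
      show "0 = (\<Sum>v\<in>V. ev (q v) (orb z t) * cexp (orb z t) v)" if "t \<in> -{0}" for t
        using q orb_U[OF z, of t] that by (auto simp: Rel_def)
    qed auto
    moreover have "((\<lambda>t. \<Sum>v\<in>V. ev (q v) (orb z t) * cexp (orb z t) v) has_field_derivative
      (\<Sum>v\<in>V. (ev (D (q v)) (orb z 1) * (1/1)) * cexp (orb z 1) v + ev (rate v) z * cexp z v * ev (q v) (orb z 1))) (at 1)"
      by (intro DERIV_sum DERIV_mult orb_derivative cexp_orb_derivative w) auto
    ultimately have "(\<Sum>v\<in>V. (ev (D (q v)) (orb z 1) * (1/1)) * cexp (orb z 1) v + ev (rate v) z * cexp z v * ev (q v) (orb z 1)) = 0"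
      using DERIV_unique by blast
    then show "(\<Sum>v\<in>V. ev (D (q v) + rate v * q v) z * cexp z v) = 0"
      using w by (simp add: orb_1 algebra_simps)
  qed
  moreover have "Rel (\<lambda>v. A * q v)" if "Rel q" for q A
    using that by (auto simp: Rel_def mult.assoc simp flip: sum_distrib_left)
  moreover have "Rel (\<lambda>v. q v - r v)" if "Rel q" "Rel r" for q r
    using that by (auto simp: Rel_def left_diff_distrib sum_subtractf)
  ultimately obtain q w where qw: "Rel q" "w \<in> V" "\<not> vanishes {l} (q w)" "\<forall>v\<in>V. v \<noteq> w \<longrightarrow> vanishes {l} (q v)"
    using eliminate_vertices[of "{l}" l V Rel "\<lambda>v. cst (cexp a v) * p' v" v0] V sep v0(1) by blast
  then obtain z where z: "z \<in> U {l}" "ev (q w) z \<noteq> 0" by (auto simp: vanishes_def)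
  have "(\<Sum>v\<in>V. ev (q v) z * cexp z v) = (\<Sum>v\<in>{w}. ev (q v) z * cexp z v)"
    by (rule sum.mono_neutral_right) (use V qw z in \<open>auto simp: vanishes_def\<close>)
  then show False using qw(1) z by (auto simp: Rel_def cexp_def)
qed

end


section \<open>Rotation-invariant spaces of smooth functions\<close>

definition kills :: "(real ^ 'n \<Rightarrow> complex) set \<Rightarrow> 'n::finite diffop \<Rightarrow> bool" where
  "kills W A \<longleftrightarrow> (\<forall>f\<in>W. app A f = (\<lambda>_. 0))"

lemma kills_mult: "kills W A \<Longrightarrow> kills W (B * A)"
  and kills_mult_right: "kills W A \<Longrightarrow> kills W (A * B)"
  by (auto simp: kills_def app_mult app_fzero mult.commute[of A B])

lemma kills_add: "kills W A \<Longrightarrow> kills W B \<Longrightarrow> kills W (A + B)"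
  and kills_minus: "kills W A \<Longrightarrow> kills W B \<Longrightarrow> kills W (A - B)"
  and kills_0: "kills W 0"
  by (auto simp: kills_def app_add app_minus app_zero)

lemma kills_uminus: "kills W A \<Longrightarrow> kills W (- A)"
  by (auto simp: kills_def app_uminus)

text \<open>Translation and rotation invariance in infinitesimal form: closure under derivatives and
  under \<open>Lrot\<close>.\<close>

definition invariant_space :: "(real ^ 'n::finite \<Rightarrow> complex) set \<Rightarrow> bool" where
  "invariant_space W \<longleftrightarrow> (\<forall>f\<in>W. smooth f \<and> (\<forall>A. app A f \<in> W) \<and> (\<forall>k l. Lrot k l f \<in> W))"

text \<open>On \<open>f\<close> the operator \<open>dl k l A\<close> is a commutator, and
  \<open>A\<close> annihilates both \<open>f\<close> and \<open>Lrot k l f\<close>. So the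
  annihilator of \<open>W\<close> is stable under infinitesimal rotations.\<close>

lemma kills_dl:
  assumes "invariant_space W" "kills W A"
  shows "kills W (dl k l A)"
  unfolding kills_def
proof (intro ballI ext)
  fix f x assume f: "f \<in> W"
  have "app A (Lrot k l f) x = Lrot k l (app A f) x + app (dl k l A) f x"
    using assms f by (intro app_Lrot) (auto simp: invariant_space_def)
  moreover have "app A (Lrot k l f) = (\<lambda>_. 0)" "app A f = (\<lambda>_. 0)"
    using assms f by (auto simp: invariant_space_def kills_def)
  ultimately show "app (dl k l A) f x = 0" by (simp add: Lrot_def)
qed

lemma poly_coeffs_eq_0:
  fixes c :: "nat \<Rightarrow> complex"
  assumes "\<And>t. t \<noteq> 0 \<Longrightarrow> (\<Sum>k\<le>n. c k * t ^ k) = 0" "k \<le> n"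
  shows "c k = 0"
proof (rule ccontr)
  assume "c k \<noteq> 0"
  then have "finite {z. (\<Sum>k\<le>n. c k * z ^ k) = 0}"
    using polyfun_rootbound[where c=c] assms(2) by blast
  moreover have "UNIV - {0} \<subseteq> {z. (\<Sum>k\<le>n. c k * z ^ k) = 0}" using assms by auto
  ultimately have "finite (UNIV - {0::complex})" by (rule finite_subset[rotated])
  then show False by (simp add: infinite_UNIV_char_0)
qed

lemma derivation_power:
  "derivation d \<Longrightarrow> d 1 = 0 \<Longrightarrow> d (x ^ k) = of_nat k * x ^ (k - 1) * d x"
proof (induction k)
  case (Suc k)
  have "d (x ^ Suc k) = d x * x ^ k + x * (of_nat k * x ^ (k - 1) * d x)"
    using Suc by (simp add: derivation_def)
  then show ?case by (cases k) (simp_all add: algebra_simps)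
qed simp

lemma derivation_sum: "derivation d \<Longrightarrow> d (\<Sum>k\<in>I. f k) = (\<Sum>k\<in>I. d (f k))"
  by (induction I rule: infinite_finite_induct) (auto simp: derivation_zero derivation_def)

lemma derivation_alg_0:
  assumes "derivation d" "\<And>c. d (cst c) = 0" "\<And>B. B \<in> G \<Longrightarrow> d B = 0" "A \<in> alg G"
  shows "d A = 0"
  using assms(4) by (induction rule: alg.induct) (use assms in \<open>auto simp: derivation_def\<close>)

lemma of_nat_cst: "of_nat k = cst (of_nat k)"
  by (induction k) (auto simp: cst_simps)

lemma ev_of_nat [simp]: "ev (of_nat k) z = of_nat k"
  by (simp add: of_nat_cst)

lemma alg_of_nat: "of_nat k \<in> alg G"
  by (simp add: of_nat_cst alg.cst)

lemma dl_sq: "dl k l (\<Sum>m\<in>UNIV. X m * X m) = 0"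
proof (cases "k = l")
  case True
  have "dl k k A = 0" for A :: "'a diffop"
    by (rule dl_eqI) (simp add: Lrot_def[abs_def] app_zero app_fzero)
  with True show ?thesis by simp
next
  case False
  have X: "dl k l (X m * X m) = (if m = k then cst 2 * X k * X l else 0) - (if m = l then cst 2 * X k * X l else 0)" for m
  proof -
    have c2: "cst 2 = (1 + 1 :: 'a diffop)" using cst_simps(3)[of 1 1] by (simp add: cst_simps)
    have "dl k l (X m * X m) = dl k l (X m) * X m + X m * dl k l (X m)"
      using derivation_dl[of k l] unfolding derivation_def by blast
    then show ?thesis using False by (auto simp: dl_X c2 algebra_simps)
  qed
  show ?thesis
    by (simp add: derivation_sum[OF derivation_dl] X sum_subtractf)
qed

context plane
begin

text \<open>Elimination leaves a relation in which all coefficients but one vanish on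
  \<open>U \<Lambda>\<close>. By \<open>nil\<close> a common power of \<zeta> makes these annihilate
  \<open>W\<close>, and the relation then forces the remaining one to do so. Thus \<open>nil\<close>
  replaces evaluation at points; it is supplied by \<open>vanishes_UNIV_nil\<close> or
  \<open>vanishes_eigen_nil\<close>.\<close>

lemma single_vertex:
  assumes W: "invariant_space W" and \<Lambda>: "\<Lambda> = UNIV \<or> \<Lambda> = {l}"
    and nil: "\<And>A. vanishes \<Lambda> A \<Longrightarrow> \<exists>N. kills W (\<zeta> ^ N * A)"
    and V: "finite V" and sep: "\<And>v w. v \<in> V \<Longrightarrow> w \<in> V \<Longrightarrow> v \<noteq> w \<Longrightarrow> v $ i \<noteq> w $ i"
    and rel: "\<And>f x. f \<in> W \<Longrightarrow> (\<Sum>v\<in>V. app (p v) f (x + v)) = 0"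
    and nz: "v0 \<in> V" "\<not> vanishes \<Lambda> (p v0)"
  shows "\<exists>A. kills W A \<and> \<not> vanishes \<Lambda> A"
proof -
  define Rel where "Rel p \<longleftrightarrow> (\<forall>f\<in>W. \<forall>x. (\<Sum>v\<in>V. app (p v) f (x + v)) = 0)" for p
  note W' = W[unfolded invariant_space_def, rule_format]
  have mult: "Rel (\<lambda>v. A * q v)" if "Rel q" for q A
    using that W' unfolding Rel_def mult.commute[of A] app_mult by blast
  have diff: "Rel (\<lambda>v. q v - r v)" if "Rel q" "Rel r" for q r
    using that by (auto simp: Rel_def app_minus sum_subtractf)
  have add: "Rel (\<lambda>v. q v + r v)" if "Rel q" "Rel r" for q r
    using that by (auto simp: Rel_def app_add sum.distrib)
  have rot: "Rel (\<lambda>v. D (q v) + rate v * q v)" if q: "Rel q" for q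
  proof -
    have "Rel (\<lambda>v. dl i j (q v) + (cst (complex_of_real (v $ i)) * X j - cst (complex_of_real (v $ j)) * X i) * q v)"
      unfolding Rel_def
    proof (intro ballI allI)
      fix f x assume f: "f \<in> W"
      have sf: "smooth f" using W' f by blast
      \<comment> \<open>The coefficients of \<open>Lrot i j\<close> at \<open>x + v\<close> split
        into a part from \<open>v\<close>, which becomes the rate, and a part from \<open>x\<close>,
        which only multiplies sums already known to vanish.\<close>
      have t: "app (dl i j (q v) + (cst (complex_of_real (v $ i)) * X j - cst (complex_of_real (v $ j)) * X i) * q v) f (x + v)
        = app (q v) (Lrot i j f) (x + v)
          - complex_of_real (x $ i) * app (X j * q v) f (x + v) + complex_of_real (x $ j) * app (X i * q v) f (x + v)" for v
        by (simp add: app_add app_mult app_minus app_cst app_X sf smooth_app smooth_pd app_Lrot Lrot_def left_diff_distrib)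
           (simp add: algebra_simps)
      show "(\<Sum>v\<in>V. app (dl i j (q v) + (cst (complex_of_real (v $ i)) * X j - cst (complex_of_real (v $ j)) * X i) * q v) f (x + v)) = 0"
        unfolding t sum.distrib sum_subtractf sum_distrib_left[symmetric]
        using q mult[OF q] f W' by (simp add: Rel_def)
    qed
    from mult[OF this, of "cst \<i>"] show ?thesis
      by (simp add: D_def rate_def cst_simps algebra_simps)
  qed
  have "Rel p" using rel by (auto simp: Rel_def)
  then obtain q w where qw: "Rel q" "w \<in> V" "\<not> vanishes \<Lambda> (q w)" "\<forall>v\<in>V. v \<noteq> w \<longrightarrow> vanishes \<Lambda> (q v)"
    using eliminate_vertices[OF \<Lambda> V sep mult diff rot, of p v0] nz by blast
  obtain N where N: "\<And>v. v \<in> V \<Longrightarrow> v \<noteq> w \<Longrightarrow> kills W (\<zeta> ^ N v * q v)"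
  proof -
    have "\<forall>v\<in>V - {w}. \<exists>N. kills W (\<zeta> ^ N * q v)" using nil qw(4) by blast
    then have "\<exists>N. \<forall>v\<in>V - {w}. kills W (\<zeta> ^ N v * q v)" by (rule bchoice)
    then show ?thesis using that by blast
  qed
  define M where "M = (\<Sum>v\<in>V. N v)"
  have M: "kills W (\<zeta> ^ M * q v)" if "v \<in> V" "v \<noteq> w" for v
  proof -
    have "N v \<le> M" unfolding M_def using V that by (intro member_le_sum) auto
    then have "\<zeta> ^ M * q v = \<zeta> ^ (M - N v) * (\<zeta> ^ N v * q v)"
      by (simp add: mult.assoc[symmetric] power_add[symmetric])
    then show ?thesis using kills_mult[OF N[OF that]] by simp
  qed
  have "kills W (\<zeta> ^ M * q w)"
    unfolding kills_def
  proof (intro ballI ext)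
    fix f x assume f: "f \<in> W"
    have "(\<Sum>v\<in>V. app (\<zeta> ^ M * q v) f ((x - w) + v)) = 0"
      using mult[OF qw(1)] f unfolding Rel_def by blast
    moreover have "(\<Sum>v\<in>V. app (\<zeta> ^ M * q v) f ((x - w) + v)) = (\<Sum>v\<in>{w}. app (\<zeta> ^ M * q v) f ((x - w) + v))"
      by (rule sum.mono_neutral_right) (use V qw M f in \<open>auto simp: kills_def\<close>)
    ultimately show "app (\<zeta> ^ M * q w) f x = 0" by simp
  qed
  moreover have "\<not> vanishes \<Lambda> (\<zeta> ^ M * q w)"
    using qw(3) by (auto simp: vanishes_def U_def)
  ultimately show ?thesis by blast
qed

subsection \<open>Raising operators\<close>

text \<open>In the coordinates above \<open>E l\<close> is \<open>\<zeta> \<partial>/\<partial>z\<^sub>l\<close>.\<close>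

definition E :: "'n \<Rightarrow> 'n diffop \<Rightarrow> 'n diffop" where
  "E l A = - dl i l A - cst \<i> * dl j l A"

lemma derivation_E: "derivation (E l)"
  using derivation_dl[of i l] derivation_dl[of j l] unfolding derivation_def E_def by (simp add: algebra_simps)

lemma E_cst: "E l (cst c) = 0" by (simp add: E_def dl_cst)

lemma cst_i_i: "cst \<i> * cst \<i> = - 1"
  by (simp add: uminus_diffop_def flip: cst_simps)

lemma cst_i_i_mult: "cst \<i> * (cst \<i> * A) = - A"
  using cst_i_i by (metis mult.assoc mult_1 mult_minus_left)

lemma E_gens:
  assumes "l \<in> rest"
  shows "E l (X l) = \<zeta>" "E l \<zeta> = 0" "E l sq = 0" "m \<in> rest \<Longrightarrow> m \<noteq> l \<Longrightarrow> E l (X m) = 0"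
proof -
  have l: "l \<noteq> i" "l \<noteq> j" using assms by (auto simp: rest_def)
  show "E l (X l) = \<zeta>" using l by (simp add: E_def dl_X \<zeta>_def)
  show "E l sq = 0" by (simp add: E_def sq_def dl_sq)
  show "m \<in> rest \<Longrightarrow> m \<noteq> l \<Longrightarrow> E l (X m) = 0" using l by (auto simp: E_def dl_X rest_def)
  have "dl k m \<zeta> = dl k m (X i) + cst \<i> * dl k m (X j)" for k m
    using derivation_dl[of k m] by (simp add: \<zeta>_def derivation_def dl_cst)
  then show "E l \<zeta> = 0" using l ij by (simp add: E_def dl_X cst_i_i_mult)
qed

lemma kills_E: "invariant_space W \<Longrightarrow> kills W A \<Longrightarrow> kills W (E l A)"
  unfolding E_def by (intro kills_minus kills_uminus kills_mult kills_dl)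

lemma D_gens: "D \<zeta> = \<zeta>" "D sq = 0"
proof -
  have "dl k m \<zeta> = dl k m (X i) + cst \<i> * dl k m (X j)" for k m
    using derivation_dl[of k m] by (simp add: \<zeta>_def derivation_def dl_cst)
  then have "dl i j \<zeta> = X j - cst \<i> * X i" using ij by (simp add: dl_X)
  then have "D \<zeta> = cst \<i> * X j - cst \<i> * (cst \<i> * X i)" by (simp add: D_def right_diff_distrib)
  then show "D \<zeta> = \<zeta>" by (simp add: cst_i_i_mult) (simp add: \<zeta>_def)
  show "D sq = 0" by (simp add: D_def sq_def dl_sq)
qed

lemma one_cst: "(1 :: 'n diffop) = cst 1" by (simp add: cst_simps)

text \<open>\<open>E l\<close> maps annihilators of \<open>W\<close> to annihilators and lowers the
  degree in \<open>X l\<close>. Should \<open>E l A\<close> vanish on \<open>U \<Lambda>\<close>,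
  then \<open>A\<close> does not depend on the coordinate \<open>z\<^sub>l\<close> there, so it
  agrees with \<open>B 0\<close>, and \<open>nil\<close> passes the annihilation on to
  \<open>B 0\<close> times a power of \<zeta>.\<close>

lemma kills_coordinate_elimination_step:
  assumes W: "invariant_space W"
    and nil: "\<And>A. vanishes \<Lambda> A \<Longrightarrow> \<exists>N. kills W (\<zeta> ^ N * A)"
    and l: "l \<in> rest" "l \<notin> I" and I: "I \<subseteq> rest"
    and B: "\<And>k. B k \<in> alg ({\<zeta>, sq} \<union> X ` I)"
    and A: "A = (\<Sum>k\<le>n. B k * X l ^ k)" "kills W A" "\<not> vanishes \<Lambda> A"
  shows "\<exists>C\<in>alg ({\<zeta>, sq} \<union> X ` I). kills W C \<and> \<not> vanishes \<Lambda> C"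
  using B A
proof (induction n arbitrary: A B)
  case 0
  then show ?case by (intro bexI[of _ "B 0"]) auto
next
  case (Suc n)
  define B' where "B' k = of_nat (Suc k) * B (Suc k) * \<zeta>" for k
  have EB: "E l (B k) = 0" for k
    by (rule derivation_alg_0[OF derivation_E E_cst _ Suc.prems(1)])
       (use l I in \<open>auto simp: E_gens intro!: E_gens(4)\<close>)
  have EA: "E l A = (\<Sum>k\<le>n. B' k * X l ^ k)"
  proof -
    have "E l A = (\<Sum>k\<le>Suc n. of_nat k * B k * \<zeta> * X l ^ (k - 1))"
      unfolding Suc.prems(2) derivation_sum[OF derivation_E]
    proof (rule sum.cong)
      fix k
      have "E l (B k * X l ^ k) = E l (B k) * X l ^ k + B k * E l (X l ^ k)"
        using derivation_E by (auto simp: derivation_def)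
      then show "E l (B k * X l ^ k) = of_nat k * B k * \<zeta> * X l ^ (k - 1)"
        using derivation_power[OF derivation_E, of l "X l" k] E_cst[of l 1] l
        by (simp add: EB E_gens one_cst mult_ac)
    qed auto
    then show ?thesis by (subst (asm) sum.atMost_Suc_shift) (simp add: B'_def)
  qed
  have B': "B' k \<in> alg ({\<zeta>, sq} \<union> X ` I)" for k
    unfolding B'_def by (intro alg.mult alg_of_nat Suc.prems(1) alg.gen) auto
  have EK: "kills W (E l A)" by (rule kills_E[OF W Suc.prems(3)])
  show ?case
  proof (cases "vanishes \<Lambda> (E l A)")
    case False
    show ?thesis by (rule Suc.IH[OF B' EA EK False])
  next
    case True
    have eq: "ev A z = ev (B 0) z" if z: "z \<in> U \<Lambda>" for z
    proof -
      have w: "ev \<zeta> z \<noteq> 0" using z by (simp add: U_def)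
      \<comment> \<open>Moves \<open>z\<^sub>l\<close> alone, with \<zeta>, \<open>sq\<close> and
        the other coordinates in \<open>rest\<close> held fixed.\<close>
      define z' where "z' t = pt (ev \<zeta> z) (ev sq z) (\<chi> m. if m = l then t else z $ m)" for t
      have Bz: "ev C (z' t) = ev C z" if "C \<in> alg ({\<zeta>, sq} \<union> X ` I)" for C t
        by (rule ev_alg_cong[OF that]) (use l I w in \<open>auto simp: z'_def ev_\<zeta>_pt ev_sq_pt pt_rest\<close>)
      have Xz: "ev (X l) (z' t) = t" for t using l by (simp add: z'_def pt_rest)
      have "(\<Sum>k\<le>n. ev (B' k) z * t ^ k) = 0" for t
      proof -
        have "z' t \<in> U \<Lambda>" using z by (simp add: z'_def U_def ev_\<zeta>_pt ev_sq_pt)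
        then have "ev (E l A) (z' t) = 0" using True by (simp add: vanishes_def)
        then show ?thesis unfolding EA using Xz[of t] by (simp add: Bz[OF B'])
      qed
      then have "ev (B' k) z = 0" if "k \<le> n" for k
        using poly_coeffs_eq_0[where n=n and c="\<lambda>k. ev (B' k) z" and k=k] that by blast
      then have "ev (B (Suc k)) z = 0" if "k \<le> n" for k
        using that w by (simp add: B'_def del: of_nat_Suc)
      then show ?thesis
        unfolding Suc.prems(2) by (subst sum.atMost_Suc_shift) simp
    qed
    then have "vanishes \<Lambda> (A - B 0)" by (simp add: vanishes_def)
    then obtain N where "kills W (\<zeta> ^ N * (A - B 0))" using nil by blast
    then have "kills W (\<zeta> ^ N * A - \<zeta> ^ N * (A - B 0))" by (rule kills_minus[OF kills_mult[OF Suc.prems(3)]])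
    moreover have "\<zeta> ^ N * A - \<zeta> ^ N * (A - B 0) = \<zeta> ^ N * B 0" by (simp add: algebra_simps)
    ultimately have "kills W (\<zeta> ^ N * B 0)" by simp
    moreover have "\<not> vanishes \<Lambda> (\<zeta> ^ N * B 0)"
      using Suc.prems(4) eq by (auto simp: vanishes_def U_def)
    moreover have "\<zeta> ^ N * B 0 \<in> alg ({\<zeta>, sq} \<union> X ` I)"
      by (intro alg.mult alg_power alg.gen Suc.prems(1)) auto
    ultimately show ?thesis by blast
  qed
qed

text \<open>A power of \<zeta> first brings \<open>A\<close> into \<open>S\<close>; then the
  coordinates in \<open>rest\<close> are removed one by one.\<close>

lemma kills_coordinate_elimination:
  assumes W: "invariant_space W"
    and nil: "\<And>A. vanishes \<Lambda> A \<Longrightarrow> \<exists>N. kills W (\<zeta> ^ N * A)"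
    and A: "kills W A" "\<not> vanishes \<Lambda> A"
  shows "\<exists>C\<in>alg {\<zeta>, sq}. kills W C \<and> \<not> vanishes \<Lambda> C"
proof -
  have ind: "\<exists>C\<in>alg {\<zeta>, sq}. kills W C \<and> \<not> vanishes \<Lambda> C"
    if "finite I" "I \<subseteq> rest" "A \<in> alg ({\<zeta>, sq} \<union> X ` I)" "kills W A" "\<not> vanishes \<Lambda> A" for I A
    using that
  proof (induction I arbitrary: A rule: finite_induct)
    case empty
    then show ?case by auto
  next
    case (insert l I)
    have "A \<in> alg (insert (X l) ({\<zeta>, sq} \<union> X ` I))" using insert.prems(2) by (simp add: insert_commute)
    then obtain p where p: "\<And>k. coeff p k \<in> alg ({\<zeta>, sq} \<union> X ` I)" "A = poly p (X l)"
      by (rule alg_insert_poly) blast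
    have "\<exists>C\<in>alg ({\<zeta>, sq} \<union> X ` I). kills W C \<and> \<not> vanishes \<Lambda> C"
      by (rule kills_coordinate_elimination_step[where l=l and I=I and B="coeff p" and A=A and n="degree p", OF W nil])
         (use insert p in \<open>auto simp: poly_altdef\<close>)
    then show ?case using insert by blast
  qed
  obtain N where N: "\<zeta> ^ N * A \<in> S" using \<zeta>_power_in_S by blast
  show ?thesis
    by (rule ind[of rest "\<zeta> ^ N * A"]) (use N A in \<open>auto simp: S_def kills_mult vanishes_def U_def\<close>)
qed

text \<open>\<open>\<zeta> ^ k\<close> has weight \<open>k\<close> under \<open>D\<close>, so
  subtracting the top weight removes the top term and multiplies the others by nonzero numbers. If
  the result vanishes on \<open>U \<Lambda>\<close>, comparing powers of \<open>t\<close> along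
  orbits shows that \<open>A\<close> equals its top term there.\<close>

lemma kills_weight_elimination:
  assumes W: "invariant_space W"
    and nil: "\<And>A. vanishes \<Lambda> A \<Longrightarrow> \<exists>N. kills W (\<zeta> ^ N * A)"
    and B: "\<And>k. B k \<in> alg {sq}"
    and A: "A = (\<Sum>k\<le>n. B k * \<zeta> ^ k)" "kills W A" "\<not> vanishes \<Lambda> A"
  shows "\<exists>K. \<exists>C\<in>alg {sq}. kills W (\<zeta> ^ K * C) \<and> \<not> vanishes \<Lambda> C"
  using B A
proof (induction n arbitrary: A B)
  case 0
  then show ?case by (intro exI[of _ 0] bexI[of _ "B 0"]) auto
next
  case (Suc n)
  define B' where "B' k = (of_nat k - of_nat (Suc n)) * B k" for k
  have DB: "D (B k) = 0" for k
    by (rule derivation_alg_0[OF derivation_D D_cst _ Suc.prems(1)]) (use D_gens in auto)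
  have DA: "D A - of_nat (Suc n) * A = (\<Sum>k\<le>n. B' k * \<zeta> ^ k)"
  proof -
    have "D A = (\<Sum>k\<le>Suc n. of_nat k * B k * \<zeta> ^ k)"
      unfolding Suc.prems(2) derivation_sum[OF derivation_D]
    proof (rule sum.cong)
      fix k
      have "D (B k * \<zeta> ^ k) = D (B k) * \<zeta> ^ k + B k * D (\<zeta> ^ k)"
        using derivation_D by (auto simp: derivation_def)
      then show "D (B k * \<zeta> ^ k) = of_nat k * B k * \<zeta> ^ k"
        using derivation_power[OF derivation_D, of \<zeta> k] D_cst[of 1]
        by (cases k) (simp_all add: DB D_gens one_cst mult_ac)
    qed auto
    then have "D A - of_nat (Suc n) * A = (\<Sum>k\<le>Suc n. B' k * \<zeta> ^ k)"
      unfolding Suc.prems(2) by (simp add: sum_distrib_left B'_def left_diff_distrib sum_subtractf mult.assoc del: sum.atMost_Suc)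
    then show ?thesis by (simp add: B'_def)
  qed
  have B': "B' k \<in> alg {sq}" for k
    unfolding B'_def by (intro alg.mult alg_of_nat alg_minus Suc.prems(1))
  have DK: "kills W (D A - of_nat (Suc n) * A)"
    unfolding D_def by (intro kills_minus kills_mult kills_dl W Suc.prems(3))
  show ?case
  proof (cases "vanishes \<Lambda> (D A - of_nat (Suc n) * A)")
    case False
    show ?thesis by (rule Suc.IH[OF B' DA DK False])
  next
    case True
    have eq: "ev A z = ev (\<zeta> ^ Suc n * B (Suc n)) z" if z: "z \<in> U \<Lambda>" for z
    proof -
      have w: "ev \<zeta> z \<noteq> 0" using z by (simp add: U_def)
      have Bz: "ev C (orb z t) = ev C z" if "C \<in> alg {sq}" "t \<noteq> 0" for C t
        by (rule ev_alg_cong[OF that(1)]) (use w that in \<open>auto simp: orb_def ev_sq_pt\<close>)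
      have "(\<Sum>k\<le>n. (ev (B' k) z * ev \<zeta> z ^ k) * t ^ k) = 0" if "t \<noteq> 0" for t
      proof -
        have "ev (D A - of_nat (Suc n) * A) (orb z t) = 0" using True orb_U[OF z that] unfolding vanishes_def by blast
        then have "(\<Sum>k\<le>n. ev (B' k) (orb z t) * ev \<zeta> (orb z t) ^ k) = 0" unfolding DA by simp
        moreover have "ev \<zeta> (orb z t) = t * ev \<zeta> z" by (simp add: orb_def ev_\<zeta>_pt)
        ultimately show ?thesis by (simp add: Bz[OF B' that] power_mult_distrib mult_ac)
      qed
      then have BK: "ev (B' k) z * ev \<zeta> z ^ k = 0" if "k \<le> n" for k
        using poly_coeffs_eq_0[where n=n and c="\<lambda>k. ev (B' k) z * ev \<zeta> z ^ k" and k=k] that by blast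
      have "ev (B k) z = 0" if "k \<le> n" for k
      proof -
        have "of_nat k - of_nat (Suc n) \<noteq> (0::complex)"
          using that by (metis eq_iff_diff_eq_0 not_less_eq_eq of_nat_eq_iff order_refl)
        then show ?thesis using w BK[OF that] by (simp add: B'_def del: of_nat_Suc)
      qed
      then show ?thesis
        unfolding Suc.prems(2) by (simp add: mult.commute)
    qed
    then have "vanishes \<Lambda> (A - \<zeta> ^ Suc n * B (Suc n))" by (simp add: vanishes_def)
    then obtain N where "kills W (\<zeta> ^ N * (A - \<zeta> ^ Suc n * B (Suc n)))" using nil by blast
    then have "kills W (\<zeta> ^ N * A - \<zeta> ^ N * (A - \<zeta> ^ Suc n * B (Suc n)))" by (rule kills_minus[OF kills_mult[OF Suc.prems(3)]])
    moreover have "\<zeta> ^ N * A - \<zeta> ^ N * (A - \<zeta> ^ Suc n * B (Suc n)) = \<zeta> ^ (N + Suc n) * B (Suc n)"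
      by (simp add: power_add algebra_simps)
    ultimately have "kills W (\<zeta> ^ (N + Suc n) * B (Suc n))" by simp
    moreover have "\<not> vanishes \<Lambda> (B (Suc n))"
      using Suc.prems(4) eq by (auto simp: vanishes_def U_def)
    ultimately show ?thesis using Suc.prems(1) by blast
  qed
qed

lemma kills_zeta_power_times_radial:
  assumes W: "invariant_space W"
    and nil: "\<And>A. vanishes \<Lambda> A \<Longrightarrow> \<exists>N. kills W (\<zeta> ^ N * A)"
    and A: "kills W A" "\<not> vanishes \<Lambda> A"
  shows "\<exists>K. \<exists>C\<in>alg {sq}. kills W (\<zeta> ^ K * C) \<and> \<not> vanishes \<Lambda> C"
proof -
  obtain C where C: "C \<in> alg {\<zeta>, sq}" "kills W C" "\<not> vanishes \<Lambda> C"
    using kills_coordinate_elimination[OF assms] by blast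
  obtain p where p: "\<And>k. coeff p k \<in> alg {sq}" "C = poly p \<zeta>"
    using alg_insert_poly[OF C(1)] by blast
  show ?thesis
    by (rule kills_weight_elimination[where n="degree p" and A=C, OF W nil p(1)]) (use p C in \<open>auto simp: poly_altdef\<close>)
qed

end


section \<open>Polynomials in the Laplacian, and nilpotency of \<zeta>\<close>

definition at_op :: "complex poly \<Rightarrow> 'n::finite diffop \<Rightarrow> 'n diffop" where
  "at_op q A = poly (map_poly cst q) A"

lemma at_op_simps:
  "at_op 0 A = 0" "at_op (pCons c q) A = cst c + A * at_op q A"
  "at_op (p + q) A = at_op p A + at_op q A" "at_op (smult c q) A = cst c * at_op q A"
  "at_op (p * q) A = at_op p A * at_op q A"
proof -
  have 0: "cst 0 = (0 :: 'a diffop)" by (simp add: cst_simps)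
  show z: "at_op 0 A = 0" by (simp add: at_op_def)
  show c: "at_op (pCons c q) A = cst c + A * at_op q A" for c q by (simp add: at_op_def map_poly_pCons 0)
  show a: "at_op (p + q) A = at_op p A + at_op q A" for p q
  proof (induction p q rule: poly_induct2)
    case (pCons a p b q)
    show ?case by (simp only: add_pCons c pCons.IH cst_simps(3)) (simp only: distrib_left add_ac)
  qed (simp add: z)
  show s: "at_op (smult c q) A = cst c * at_op q A" for c q
  proof (induction q)
    case (pCons a q)
    show ?case by (simp only: smult_pCons c pCons.IH cst_simps(4)) (simp only: distrib_left mult_ac)
  qed (simp add: z)
  show "at_op (p * q) A = at_op p A * at_op q A"
  proof (induction p)
    case (pCons b p)
    show ?case by (simp only: mult_pCons_left c a s pCons.IH 0 add_0) (simp only: distrib_right distrib_left mult_ac)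
  qed (simp add: z)
qed

lemma alg_single_at_op:
  assumes "C \<in> alg {A}"
  obtains q where "C = at_op q A"
proof -
  have "\<exists>q. C = at_op q A"
    using assms
  proof (induction rule: alg.induct)
    case (cst c)
    then show ?case by (intro exI[of _ "[:c:]"]) (simp add: at_op_simps)
  next
    case (gen B)
    then show ?case by (intro exI[of _ "[:0, 1:]"]) (simp add: at_op_simps cst_simps)
  next
    case (add B C)
    then show ?case by (metis at_op_simps(3))
  next
    case (mult B C)
    then show ?case by (metis at_op_simps(5))
  qed
  with that show ?thesis by blast
qed

text \<open>Over the complex numbers \<open>q\<close> splits into linear factors, and each
  \<open>A - cst a\<close> is injective on \<open>W\<close> because \<open>W\<close> contains no
  nonzero eigenfunction. Factors are peeled off one at a time.\<close>

lemma at_op_injective: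
  assumes W: "invariant_space W"
    and inj: "\<And>l f. f \<in> W \<Longrightarrow> app A f = (\<lambda>x. l * f x) \<Longrightarrow> f = (\<lambda>_. 0)"
    and "q \<noteq> 0" "f \<in> W" "app (at_op q A) f = (\<lambda>_. 0)"
  shows "f = (\<lambda>_. 0)"
  using assms(3-5)
proof (induction "degree q" arbitrary: q f)
  case 0
  then obtain c where c: "q = [:c:]" "c \<noteq> 0" by (metis degree_0_id degree_eq_zeroE pCons_0_0)
  have "smooth f" using 0 W by (auto simp: invariant_space_def)
  then show ?case using 0(4) c by (simp add: at_op_simps app_add app_mult app_cst app_zero app_fzero fun_eq_iff)
next
  case (Suc n)
  then have "\<not> constant (poly q)" using constant_degree[of q] by simp
  then obtain a where "poly q a = 0" using fundamental_theorem_of_algebra by blast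
  then obtain q' where q': "q = [:-a, 1:] * q'" by (auto simp: poly_eq_0_iff_dvd)
  have q'0: "q' \<noteq> 0" using q' Suc.prems(1) by auto
  have deg: "n = degree q'" using Suc.hyps(2) q'0 unfolding q' by (subst (asm) degree_mult_eq) auto
  have sf: "smooth f" and g: "app (at_op q' A) f \<in> W" and sg: "smooth (app (at_op q' A) f)" 
    using W Suc.prems(2) by (auto simp: invariant_space_def)
  have "at_op [:-a, 1:] A = A - cst a"
    by (simp add: at_op_simps cst_simps) (simp add: uminus_diffop_def flip: cst_simps)
  then have "app (A - cst a) (app (at_op q' A) f) = (\<lambda>_. 0)"
    using Suc.prems(3) unfolding q' at_op_simps(5) app_mult by simp
  then have "app A (app (at_op q' A) f) = (\<lambda>x. a * app (at_op q' A) f x)"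
    using sg by (simp add: app_minus app_cst fun_eq_iff)
  then have "app (at_op q' A) f = (\<lambda>_. 0)" using inj[OF g] by blast
  then show ?case using Suc.hyps(1)[OF deg q'0 Suc.prems(2)] by blast
qed

context plane
begin

text \<open>Some coefficient has to survive on every level \<open>l\<close> of \<open>sq\<close>,
  because the eigenvalue of the Laplacian that will occur is not known in advance.\<close>

definition vertex_relation :: "(real ^ 'n \<Rightarrow> complex) set \<Rightarrow> bool" where
  "vertex_relation W \<longleftrightarrow> (\<exists>V p. finite V \<and> (\<forall>v\<in>V. \<forall>w\<in>V. v \<noteq> w \<longrightarrow> v $ i \<noteq> w $ i)
     \<and> (\<forall>f\<in>W. \<forall>x. (\<Sum>v\<in>V. app (p v) f (x + v)) = 0)
     \<and> (\<forall>l. \<exists>v\<in>V. \<not> vanishes {l} (p v)))"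

lemma vanishes_UNIV_nil: "vanishes UNIV A \<Longrightarrow> \<exists>N. kills W (\<zeta> ^ N * A)"
proof (rule exI[of _ 1])
  assume "vanishes UNIV A"
  then have "\<zeta> ^ 1 * A = 0"
    by (intro ev_eq_0_imp_eq_0) (auto simp: vanishes_def U_def)
  then show "kills W (\<zeta> ^ 1 * A)" by (simp add: kills_0)
qed

lemma S_mod_sq:
  assumes k: "kills W (sq - cst l)" and "B \<in> S"
  shows "\<exists>B'\<in>alg ({\<zeta>} \<union> X ` rest). kills W (B - B') \<and> (\<forall>z\<in>U {l}. ev B z = ev B' z)"
  using assms(2) unfolding S_def
proof (induction rule: alg.induct)
  case (cst c)
  then show ?case by (intro bexI[of _ "cst c"]) (auto simp: kills_0 intro: alg.cst)
next
  case (gen B)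
  then consider "B = sq" | "B \<in> {\<zeta>} \<union> X ` rest" by blast
  then show ?case
  proof cases
    case 1
    then show ?thesis using k by (intro bexI[of _ "cst l"]) (auto simp: U_def intro: alg.cst)
  next
    case 2
    then show ?thesis by (intro bexI[of _ B]) (auto simp: kills_0 intro: alg.gen)
  qed
next
  case (add B C)
  then obtain B' C' where "B' \<in> alg ({\<zeta>} \<union> X ` rest)" "kills W (B - B')" "\<forall>z\<in>U {l}. ev B z = ev B' z"
    "C' \<in> alg ({\<zeta>} \<union> X ` rest)" "kills W (C - C')" "\<forall>z\<in>U {l}. ev C z = ev C' z" by blast
  moreover have "B + C - (B' + C') = (B - B') + (C - C')" by simp
  ultimately show ?case using kills_add[of W "B - B'" "C - C'"]
    by (intro bexI[of _ "B' + C'"]) (auto simp only: ev_add alg.add simp_thms)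
next
  case (mult B C)
  then obtain B' C' where "B' \<in> alg ({\<zeta>} \<union> X ` rest)" "kills W (B - B')" "\<forall>z\<in>U {l}. ev B z = ev B' z"
    "C' \<in> alg ({\<zeta>} \<union> X ` rest)" "kills W (C - C')" "\<forall>z\<in>U {l}. ev C z = ev C' z" by blast
  moreover have "B * C - B' * C' = (B - B') * C + B' * (C - C')" by (simp add: algebra_simps)
  ultimately show ?case by (intro bexI[of _ "B' * C'"]) (auto intro: alg.mult kills_add kills_mult kills_mult_right)
qed

text \<open>Modulo operators killing \<open>W\<close>, \<open>sq\<close> may be replaced by
  \<open>l\<close>, which leaves a polynomial \<open>B\<close> in \<zeta> and the coordinates in
  \<open>rest\<close>. On \<open>U {l}\<close> these take all values with
  \<open>\<zeta> \<noteq> 0\<close>, so \<open>B\<close> vanishes wherever \<zeta> does not.\<close>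

lemma vanishes_eigen_nil:
  assumes k: "kills W (sq - cst l)" and van: "vanishes {l} A"
  shows "\<exists>N. kills W (\<zeta> ^ N * A)"
proof -
  obtain N where "\<zeta> ^ N * A \<in> S" using \<zeta>_power_in_S by blast
  then obtain B where B: "B \<in> alg ({\<zeta>} \<union> X ` rest)" "kills W (\<zeta> ^ N * A - B)"
    "\<And>z. z \<in> U {l} \<Longrightarrow> ev (\<zeta> ^ N * A) z = ev B z" using S_mod_sq[OF k] by blast
  have "ev B z = 0" if z: "ev \<zeta> z \<noteq> 0" for z
  proof -
    \<comment> \<open>The point of \<open>U {l}\<close> with the same \<zeta> and the same
      \<open>rest\<close> coordinates as \<open>z\<close>.\<close>
    define y where "y = pt (ev \<zeta> z) l z"
    have y: "y \<in> U {l}" using z by (simp add: y_def U_def ev_\<zeta>_pt ev_sq_pt)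
    have "ev B z = ev B y"
      by (rule ev_alg_cong[OF B(1)]) (auto simp: y_def ev_\<zeta>_pt pt_rest)
    also have "\<dots> = ev (\<zeta> ^ N * A) y" using B(3)[OF y] by simp
    also have "\<dots> = 0" using van y by (simp add: vanishes_def)
    finally show ?thesis .
  qed
  then have "\<zeta> * B = 0" by (intro ev_eq_0_imp_eq_0) auto
  then have "\<zeta> ^ Suc N * A = \<zeta> * (\<zeta> ^ N * A - B)" by (simp add: algebra_simps)
  then show ?thesis using kills_mult[OF B(2), of \<zeta>] by metis
qed

lemma alg_sq_eigen:
  assumes k: "kills W (sq - cst l)" and "C \<in> alg {sq}"
  shows "\<exists>c. kills W (C - cst c) \<and> (\<forall>z\<in>U {l}. ev C z = c)"
proof -
  have "C \<in> S" using alg_mono[OF assms(2)] by (auto simp: S_def)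
  show ?thesis
    using assms(2)
  proof (induction rule: alg.induct)
    case (cst c)
    then show ?case by (intro exI[of _ c]) (auto simp: kills_0)
  next
    case (gen B)
    then show ?case using k by (intro exI[of _ l]) (auto simp: U_def)
  next
    case (add B C)
    then obtain b c where "kills W (B - cst b)" "\<forall>z\<in>U {l}. ev B z = b" "kills W (C - cst c)" "\<forall>z\<in>U {l}. ev C z = c" by blast
    moreover have "B + C - cst (b + c) = (B - cst b) + (C - cst c)" by (simp only: cst_simps(3)) simp
    ultimately show ?case using kills_add[of W "B - cst b" "C - cst c"] by (intro exI[of _ "b + c"]) (auto simp only: ev_add simp_thms)
  next
    case (mult B C)
    then obtain b c where "kills W (B - cst b)" "\<forall>z\<in>U {l}. ev B z = b" "kills W (C - cst c)" "\<forall>z\<in>U {l}. ev C z = c" by blast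
    moreover have "B * C - cst (b * c) = (B - cst b) * C + cst b * (C - cst c)" by (simp only: cst_simps(4)) (simp add: algebra_simps)
    ultimately show ?case by (intro exI[of _ "b * c"]) (auto intro: kills_add kills_mult kills_mult_right)
  qed
qed

text \<open>On an eigenspace the radial factor acts as a constant, which is nonzero because the
  factor does not vanish on \<open>U {l}\<close>; dividing by it leaves a power of \<zeta>.\<close>

lemma eigenspace_kills_zeta_power:
  assumes W: "invariant_space W" and k: "kills W (sq - cst l)" and rel: "vertex_relation W"
  shows "\<exists>K. kills W (\<zeta> ^ K)"
proof -
  obtain V p where V': "finite V" "\<forall>v\<in>V. \<forall>w\<in>V. v \<noteq> w \<longrightarrow> v $ i \<noteq> w $ i"
    "\<forall>f\<in>W. \<forall>x. (\<Sum>v\<in>V. app (p v) f (x + v)) = 0" "\<forall>l. \<exists>v\<in>V. \<not> vanishes {l} (p v)"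
    using rel unfolding vertex_relation_def by (elim exE conjE)
  obtain v where v: "v \<in> V" "\<not> vanishes {l} (p v)" using V'(4)[rule_format, of l] by (elim bexE)
  note V = V'(1) V'(2)[rule_format] V'(3)[rule_format] v
  note nil = vanishes_eigen_nil[OF k]
  have "\<exists>A. kills W A \<and> \<not> vanishes {l} A"
  proof (rule single_vertex[where p=p and V=V, OF W disjI2[OF refl]])
    show "\<And>A. vanishes {l} A \<Longrightarrow> \<exists>N. kills W (\<zeta> ^ N * A)" by (rule nil)
    show "\<And>v w. v \<in> V \<Longrightarrow> w \<in> V \<Longrightarrow> v \<noteq> w \<Longrightarrow> v $ i \<noteq> w $ i" by (rule V(2))
    show "\<And>f x. f \<in> W \<Longrightarrow> (\<Sum>v\<in>V. app (p v) f (x + v)) = 0" by (rule V(3))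
    show "finite V" "v \<in> V" "\<not> vanishes {l} (p v)" by (fact V(1) v(1) v(2))+
  qed
  then obtain A where A: "kills W A" "\<not> vanishes {l} A" by (elim exE conjE)
  have "\<exists>K. \<exists>C\<in>alg {sq}. kills W (\<zeta> ^ K * C) \<and> \<not> vanishes {l} C"
    by (rule kills_zeta_power_times_radial[OF W _ A]) (rule nil)
  then obtain K C where C: "C \<in> alg {sq}" "kills W (\<zeta> ^ K * C)" "\<not> vanishes {l} C"
    by (elim exE bexE conjE)
  obtain c where c: "kills W (C - cst c)" "\<forall>z\<in>U {l}. ev C z = c" using alg_sq_eigen[OF k C(1)] by blast
  have c0: "c \<noteq> 0" using c(2) C(3) by (auto simp: vanishes_def)
  have "kills W (cst (1/c) * (\<zeta> ^ K * C - \<zeta> ^ K * (C - cst c)))"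
    by (intro kills_mult[of W "\<zeta> ^ K * C - \<zeta> ^ K * (C - cst c)"] kills_minus[OF C(2)] kills_mult[OF c(1)])
  also have "\<zeta> ^ K * C - \<zeta> ^ K * (C - cst c) = \<zeta> ^ K * cst c" by (simp add: algebra_simps)
  also have "cst (1/c) * (\<zeta> ^ K * cst c) = \<zeta> ^ K * (cst (1/c) * cst c)" by (simp only: mult_ac)
  also have "cst (1/c) * cst c = (1 :: 'n diffop)" using c0 by (simp flip: cst_simps)
  finally show ?thesis by auto
qed

text \<open>Without eigenfunctions the radial factor, a polynomial in the Laplacian, is injective on
  \<open>W\<close> and can be cancelled.\<close>

lemma no_eigenfunction_kills_zeta_power:
  assumes W: "invariant_space W" and rel: "vertex_relation W"
    and inj: "\<And>l f. f \<in> W \<Longrightarrow> app sq f = (\<lambda>x. l * f x) \<Longrightarrow> f = (\<lambda>_. 0)"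
  shows "\<exists>K. kills W (\<zeta> ^ K)"
proof -
  obtain V p where V': "finite V" "\<forall>v\<in>V. \<forall>w\<in>V. v \<noteq> w \<longrightarrow> v $ i \<noteq> w $ i"
    "\<forall>f\<in>W. \<forall>x. (\<Sum>v\<in>V. app (p v) f (x + v)) = 0" "\<forall>l. \<exists>v\<in>V. \<not> vanishes {l} (p v)"
    using rel unfolding vertex_relation_def by (elim exE conjE)
  \<comment> \<open>Not vanishing on the level 0 implies not vanishing on
    \<open>U UNIV\<close>.\<close>
  obtain v where v: "v \<in> V" "\<not> vanishes {0} (p v)" using V'(4)[rule_format, of 0] by (elim bexE)
  note V = V'(1) V'(2)[rule_format] V'(3)[rule_format] v
  have vU: "\<not> vanishes UNIV (p v)" using v(2) by (auto simp: vanishes_def U_def)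
  have "\<exists>A. kills W A \<and> \<not> vanishes UNIV A"
  proof (rule single_vertex[where p=p and V=V, OF W disjI1[OF refl]])
    show "\<And>A. vanishes UNIV A \<Longrightarrow> \<exists>N. kills W (\<zeta> ^ N * A)" by (rule vanishes_UNIV_nil)
    show "\<And>v w. v \<in> V \<Longrightarrow> w \<in> V \<Longrightarrow> v \<noteq> w \<Longrightarrow> v $ i \<noteq> w $ i" by (rule V(2))
    show "\<And>f x. f \<in> W \<Longrightarrow> (\<Sum>v\<in>V. app (p v) f (x + v)) = 0" by (rule V(3))
    show "finite V" "v \<in> V" "\<not> vanishes UNIV (p v)" by (fact V(1) v(1) vU)+
  qed
  then obtain A where A: "kills W A" "\<not> vanishes UNIV A" by (elim exE conjE)
  have "\<exists>K. \<exists>C\<in>alg {sq}. kills W (\<zeta> ^ K * C) \<and> \<not> vanishes UNIV C"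
    by (rule kills_zeta_power_times_radial[OF W _ A]) (rule vanishes_UNIV_nil)
  then obtain K C where C: "C \<in> alg {sq}" "kills W (\<zeta> ^ K * C)" "\<not> vanishes UNIV C"
    by (elim exE bexE conjE)
  obtain q where q: "C = at_op q sq" using alg_single_at_op[OF C(1)] by blast
  have q0: "q \<noteq> 0" using C(3) by (auto simp: q at_op_simps vanishes_def)
  have "kills W (\<zeta> ^ K)"
    unfolding kills_def
  proof
    fix f assume f: "f \<in> W"
    have at: "app (at_op q sq) (app (\<zeta> ^ K) f) = (\<lambda>_. 0)"
      using C(2)[unfolded q, unfolded mult.commute[of "\<zeta> ^ K"]] f by (simp add: kills_def app_mult)
    have mem: "app (\<zeta> ^ K) f \<in> W" using W f by (auto simp: invariant_space_def)
    show "app (\<zeta> ^ K) f = (\<lambda>_. 0)"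
    proof (rule at_op_injective[OF W _ q0 mem at])
      fix l g assume "g \<in> W" "app sq g = (\<lambda>x. l * g x)"
      then show "g = (\<lambda>_. 0)" by (rule inj)
    qed
  qed
  then show ?thesis by blast
qed

end

section \<open>From nilpotent operators to constants\<close>

lemma common_kernel:
  assumes W: "invariant_space W" and "finite F" "\<And>A. A \<in> F \<Longrightarrow> \<exists>K. kills W (A ^ K)"
    and f: "f \<in> W" "f \<noteq> (\<lambda>_. 0)"
  shows "\<exists>g\<in>W. g \<noteq> (\<lambda>_. 0) \<and> (\<forall>A\<in>F. app A g = (\<lambda>_. 0))"
  using assms(2,3)
proof (induction F rule: finite_induct)
  case empty
  then show ?case using f by auto
next
  case (insert A F)
  then obtain g where g: "g \<in> W" "g \<noteq> (\<lambda>_. 0)" "\<forall>A\<in>F. app A g = (\<lambda>_. 0)" by auto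
  obtain K where K: "kills W (A ^ K)" using insert.prems[of A] by auto
  \<comment> \<open>The last nonzero \<open>app (A ^ n) g\<close> lies in the kernel of
    \<open>A\<close>, and it stays in the kernels of the other operators because all operators
    commute.\<close>
  define m where "m = (LEAST m. app (A ^ m) g = (\<lambda>_. 0))"
  have m: "app (A ^ m) g = (\<lambda>_. 0)"
    unfolding m_def by (rule LeastI[of _ K]) (use K g in \<open>auto simp: kills_def\<close>)
  have sg: "smooth g" using W g by (auto simp: invariant_space_def)
  have "m \<noteq> 0" using m g sg by (auto simp: app_one)
  then obtain n where n: "m = Suc n" by (cases m) auto
  have "app (A ^ n) g \<noteq> (\<lambda>_. 0)" using not_less_Least[of n "\<lambda>m. app (A ^ m) g = (\<lambda>_. 0)"] n m_def by auto
  moreover have "app A (app (A ^ n) g) = (\<lambda>_. 0)" using m by (simp add: n app_mult)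
  moreover have "app B (app (A ^ n) g) = (\<lambda>_. 0)" if "B \<in> F" for B
    using g(3) that by (metis app_fzero app_mult mult.commute)
  moreover have "app (A ^ n) g \<in> W" using W g by (auto simp: invariant_space_def)
  ultimately show ?case by auto
qed

theorem invariant_space_contains_constant:
  fixes W :: "(real ^ 'n \<Rightarrow> complex) set"
  assumes card: "CARD('n) \<ge> 2" and W: "invariant_space W"
    and rel: "\<And>i j. i \<noteq> j \<Longrightarrow> plane.vertex_relation i j W"
    and f: "f \<in> W" "f \<noteq> (\<lambda>_. 0)"
  shows "\<exists>c. c \<noteq> 0 \<and> (\<lambda>_. c) \<in> W"
proof -
  define lap :: "'n diffop" where "lap = (\<Sum>m\<in>UNIV. X m * X m)"
  have pl: "plane i j" if "i \<noteq> j" for i j :: 'n using that by unfold_locales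
  have sq: "plane.sq = lap" if "i \<noteq> j" for i j :: 'n
    using plane.sq_def[OF pl[OF that]] by (simp add: lap_def)
  have "\<exists>W'\<subseteq>W. invariant_space W' \<and> (\<exists>f\<in>W'. f \<noteq> (\<lambda>_. 0)) \<and> (\<forall>i j. i \<noteq> j \<longrightarrow> (\<exists>K. kills W' (plane.\<zeta> i j ^ K)))"
  \<comment> \<open>Either pass to an eigenspace, again an invariant space because the Laplacian
    commutes with derivatives and rotations, or keep \<open>W\<close>.\<close>
  proof (cases "\<exists>l. \<exists>f\<in>W. app lap f = (\<lambda>x. l * f x) \<and> f \<noteq> (\<lambda>_. 0)")
    case True
    then obtain l g where g: "g \<in> W" "app lap g = (\<lambda>x. l * g x)" "g \<noteq> (\<lambda>_. 0)" by blast
    define W' where "W' = {f\<in>W. app lap f = (\<lambda>x. l * f x)}"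
    have W': "invariant_space W'"
      unfolding invariant_space_def
    proof (intro ballI conjI allI)
      fix f assume f: "f \<in> W'"
      show sf: "smooth f" using W f by (auto simp: W'_def invariant_space_def)
      show "app A f \<in> W'" for A
      proof -
        have "app lap (app A f) = app A (app lap f)" by (metis app_mult mult.commute)
        then show ?thesis using W f sf by (auto simp: W'_def invariant_space_def app_fcmult)
      qed
      show "Lrot k m f \<in> W'" for k m
        using W f sf by (auto simp: W'_def invariant_space_def app_Lrot_fun Lrot_cmult dl_sq lap_def app_zero)
    qed
    have "\<exists>K. kills W' (plane.\<zeta> i j ^ K)" if "i \<noteq> j" for i j
    proof (rule plane.eigenspace_kills_zeta_power[OF pl[OF that] W'])
      show "kills W' (plane.sq - cst l)"
        using W' by (auto simp: sq[OF that] kills_def W'_def app_minus app_cst invariant_space_def)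
      show "plane.vertex_relation i j W'"
        using rel[OF that] unfolding plane.vertex_relation_def[OF pl[OF that]] W'_def by blast
    qed
    then show ?thesis using W' g by (intro exI[of _ W']) (auto simp: W'_def)
  next
    case False
    have "\<exists>K. kills W (plane.\<zeta> i j ^ K)" if "i \<noteq> j" for i j
      by (rule plane.no_eigenfunction_kills_zeta_power[OF pl[OF that] W rel[OF that]])
         (use False sq[OF that] in auto)
    then show ?thesis using W f by blast
  qed
  then obtain W' f' where W': "W' \<subseteq> W" "invariant_space W'" "f' \<in> W'" "f' \<noteq> (\<lambda>_. 0)"
    "\<And>i j. i \<noteq> j \<Longrightarrow> \<exists>K. kills W' (plane.\<zeta> i j ^ K)" by blast
  define F :: "'n diffop set" where "F = (\<lambda>(i, j). plane.\<zeta> i j) ` {(i, j). i \<noteq> j}"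
  have "finite F" unfolding F_def by (rule finite_imageI) (rule finite)
  moreover have "\<exists>K. kills W' (A ^ K)" if "A \<in> F" for A using that W'(5) by (auto simp: F_def)
  ultimately obtain g where g: "g \<in> W'" "g \<noteq> (\<lambda>_. 0)" "\<forall>A\<in>F. app A g = (\<lambda>_. 0)"
    using common_kernel[OF W'(2) _ _ W'(3,4)] by blast
  have sg: "smooth g" using g W'(2) by (auto simp: invariant_space_def)
  have "pd i g = (\<lambda>_. 0)" for i
  proof -
    obtain j where j: "j \<noteq> i"
    proof -
      have "UNIV \<noteq> {i}" using card by (metis card_1_singleton_iff card.empty One_nat_def Suc_1 not_less_eq_eq order_refl is_singletonI is_singleton_altdef)
      then show ?thesis using that by blast
    qed
    \<comment> \<open>Both orders of the pair are available, and \<open>2 \<partial>\<^sub>i =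
      \<zeta>\<^sub>i\<^sub>j - \<i> \<zeta>\<^sub>j\<^sub>i\<close>.\<close>
    have z: "app (plane.\<zeta> i j) g = (\<lambda>_. 0)" "app (plane.\<zeta> j i) g = (\<lambda>_. 0)"
      using g(3) j unfolding F_def by auto
    have "pd i g x + \<i> * pd j g x = 0" "pd j g x + \<i> * pd i g x = 0" for x
      using fun_cong[OF z(1), of x] fun_cong[OF z(2), of x] j
      by (simp_all add: plane.\<zeta>_def[OF pl] app_add app_mult app_X app_cst sg smooth_pd)
    then have "pd i g x = 0" for x
    proof -
      assume *: "\<And>x. pd i g x + \<i> * pd j g x = 0" "\<And>x. pd j g x + \<i> * pd i g x = 0"
      have "2 * pd i g x = (pd i g x + \<i> * pd j g x) - \<i> * (pd j g x + \<i> * pd i g x)" by (simp add: algebra_simps)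
      then show ?thesis using * by simp
    qed
    then show ?thesis by auto
  qed
  then have "(g has_derivative (\<lambda>h. 0)) (at x within UNIV)" for x
    using smooth_has_pd[OF sg, of x] by simp
  then obtain c where c: "\<And>x. x \<in> UNIV \<Longrightarrow> g x = c"
    using has_derivative_zero_constant[of UNIV g] by auto
  then have "g = (\<lambda>_. c)" by auto
  then show ?thesis using g W'(1) by auto
qed


section \<open>Integrals over simplices\<close>

text \<open>\<open>simplex_integral us x r f\<close> is the integral of \<open>f (x + t\<^sub>1 u\<^sub>1 + \<dots> + t\<^sub>k u\<^sub>k)\<close> over
  \<open>t \<ge> 0\<close>, \<open>t\<^sub>1 + \<dots> + t\<^sub>k \<le> r\<close>.\<close>

fun simplex_integral :: "(real ^ 'n) list \<Rightarrow> real ^ 'n \<Rightarrow> real \<Rightarrow> (real ^ 'n \<Rightarrow> complex) \<Rightarrow> complex" where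
  "simplex_integral [] x r f = f x"
| "simplex_integral (u # us) x r f =
     integral {0..1} (\<lambda>t. r *\<^sub>R simplex_integral us (x + (r * t) *\<^sub>R u) (r * (1 - t)) f)"

lemma continuous_on_uncurry_compose:
  assumes "continuous_on UNIV (\<lambda>(x, y). g x y)" "continuous_on S a" "continuous_on S b"
  shows "continuous_on S (\<lambda>t. g (a t) (b t))"
  using continuous_on_compose2[OF assms(1) continuous_on_Pair[OF assms(2,3)]] by auto

lemma continuous_simplex_integral:
  assumes "continuous_on UNIV f"
  shows "continuous_on UNIV (\<lambda>(x, r). simplex_integral us x r f)"
proof (induction us)
  case Nil
  have "continuous_on UNIV (\<lambda>p. f (fst p))"
    by (rule continuous_on_compose2[OF assms continuous_on_fst[OF continuous_on_id]]) auto
  then show ?case by (simp add: case_prod_beta)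
next
  case (Cons u us)
  have "continuous_on (UNIV \<times> cbox 0 1) (\<lambda>(p, t). snd p *\<^sub>R simplex_integral us (fst p + (snd p * t) *\<^sub>R u) (snd p * (1 - t)) f)"
    unfolding case_prod_beta
    by (intro continuous_on_scaleR continuous_on_uncurry_compose[OF Cons] continuous_intros)
  from integral_continuous_on_param[OF this] show ?case
    by (simp add: case_prod_beta)
qed

lemma simplex_integral_integrable:
  assumes "continuous_on UNIV f"
  shows "(\<lambda>t. r *\<^sub>R simplex_integral us (x + (r * t) *\<^sub>R u) (r * (1 - t)) f) integrable_on {0..1}"
  by (intro integrable_continuous_interval continuous_on_scaleR
      continuous_on_uncurry_compose[OF continuous_simplex_integral[OF assms]] continuous_intros)

definition dirop :: "real ^ 'n \<Rightarrow> 'n::finite diffop" where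
  "dirop u = (\<Sum>i\<in>UNIV. cst (complex_of_real (u $ i)) * X i)"

lemma app_dirop: "smooth f \<Longrightarrow> app (dirop u) f x = (\<Sum>i\<in>UNIV. (u $ i) *\<^sub>R pd i f x)"
  by (simp add: dirop_def app_sum app_mult app_cst app_X smooth_pd scaleR_conv_of_real)

lemma ev_dirop: "ev (dirop u) z = cdot z (of_real_vec u)"
  by (simp add: dirop_def cdot_of_real_vec mult.commute)

text \<open>The divided-difference recursion of Hermite and Genocchi.\<close>

lemma simplex_integral_snoc:
  assumes f: "smooth f"
  shows "simplex_integral (us @ [u]) x r (app (dirop u) f) =
    simplex_integral (map (\<lambda>v. v - u) us) (x + r *\<^sub>R u) r f - simplex_integral us x r f"
proof (induction us arbitrary: x r)
  case Nil
  have "((\<lambda>t. r *\<^sub>R app (dirop u) f (x + (r * t) *\<^sub>R u)) has_integral f (x + 1 *\<^sub>R (r *\<^sub>R u)) - f (x + 0 *\<^sub>R (r *\<^sub>R u))) {0..1}"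
  proof (rule fundamental_theorem_of_calculus)
    fix t :: real
    show "((\<lambda>t. f (x + t *\<^sub>R (r *\<^sub>R u))) has_vector_derivative r *\<^sub>R app (dirop u) f (x + (r * t) *\<^sub>R u)) (at t within {0..1})"
      by (rule has_vector_derivative_eq_rhs[OF smooth_line_derivative[OF f]])
         (simp add: app_dirop f scaleR_sum_right mult.commute)
  qed simp
  from integral_unique[OF this] show ?case by simp
next
  case (Cons v us)
  \<comment> \<open>The far end of the \<open>u\<close>-segments: seen from
    \<open>x + r *\<^sub>R u\<close>, the facet opposite \<open>x\<close> has the edges
    \<open>v - u\<close>. The result is the difference of the integrals over two facets.\<close>
  have eq: "x + (r * t) *\<^sub>R v + (r * (1 - t)) *\<^sub>R u = (x + r *\<^sub>R u) + (r * t) *\<^sub>R (v - u)" for t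
    by (simp add: algebra_simps)
  show ?case
    unfolding append_Cons simplex_integral.simps Cons.IH list.map eq
    by (subst integral_diff[symmetric], (intro simplex_integral_integrable smooth_continuous f)+)
       (simp only: scaleR_diff_right)
qed

subsection \<open>Functionals supported at finitely many points\<close>

definition homogeneous :: "nat \<Rightarrow> 'n::finite diffop \<Rightarrow> bool" where
  "homogeneous k A \<longleftrightarrow> (\<forall>c z. ev A (c *s z) = c ^ k * ev A z)"

lemma homogeneous_simps:
  "homogeneous k 0" "homogeneous 0 1" "homogeneous k A \<Longrightarrow> homogeneous k (cst c * A)"
  "homogeneous k A \<Longrightarrow> homogeneous k B \<Longrightarrow> homogeneous k (A + B)"
  "homogeneous k A \<Longrightarrow> homogeneous l B \<Longrightarrow> homogeneous (k + l) (A * B)"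
  by (auto simp: homogeneous_def algebra_simps power_add)

lemma homogeneous_dirop: "homogeneous 1 (dirop u)"
  by (simp add: homogeneous_def ev_dirop cdot_of_real_vec sum_distrib_left mult.assoc)

lemma homogeneous_dirops: "homogeneous (length us) (prod_list (map dirop us))"
  by (induction us) (auto simp: homogeneous_simps intro: homogeneous_simps(5)[OF homogeneous_dirop, simplified])

text \<open>The common degree \<open>k\<close> of all coefficients is recorded for the scaling
  argument in \<open>ex_vertex_formula\<close>.\<close>

definition point_sum :: "nat \<Rightarrow> ((real ^ 'n::finite \<Rightarrow> complex) \<Rightarrow> complex) \<Rightarrow> bool" where
  "point_sum k F \<longleftrightarrow> (\<exists>V p. finite V \<and> (\<forall>v. homogeneous k (p v)) \<and>
     (\<forall>f. smooth f \<longrightarrow> F f = (\<Sum>v\<in>V. app (p v) f v)))"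

lemma point_sum_eval: "point_sum 0 (\<lambda>f. f x)"
  unfolding point_sum_def
  by (rule exI[of _ "{x}"], rule exI[of _ "\<lambda>_. 1"]) (auto simp: homogeneous_simps app_one)

lemma point_sum_lincomb:
  assumes "point_sum k F" "point_sum k G"
  shows "point_sum k (\<lambda>f. a * F f + b * G f)"
proof -
  obtain V p where V: "finite V" "\<And>v. homogeneous k (p v)" "\<And>f. smooth f \<Longrightarrow> F f = (\<Sum>v\<in>V. app (p v) f v)"
    using assms(1) by (auto simp: point_sum_def)
  obtain W q where W: "finite W" "\<And>v. homogeneous k (q v)" "\<And>f. smooth f \<Longrightarrow> G f = (\<Sum>v\<in>W. app (q v) f v)"
    using assms(2) by (auto simp: point_sum_def)
  define r where "r v = cst a * (if v \<in> V then p v else 0) + cst b * (if v \<in> W then q v else 0)" for v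
  have "a * F f + b * G f = (\<Sum>v\<in>V \<union> W. app (r v) f v)" if f: "smooth f" for f
  proof -
    have "(\<Sum>v\<in>V \<union> W. app (r v) f v) = (\<Sum>v\<in>V \<union> W. a * (if v \<in> V then app (p v) f v else 0))
        + (\<Sum>v\<in>V \<union> W. b * (if v \<in> W then app (q v) f v else 0))"
      unfolding sum.distrib[symmetric] r_def
      by (intro sum.cong) (auto simp: app_add app_mult app_cst smooth_app f app_zero)
    also have "\<dots> = a * (\<Sum>v\<in>V \<union> W. if v \<in> V then app (p v) f v else 0) + b * (\<Sum>v\<in>V \<union> W. if v \<in> W then app (q v) f v else 0)"
      by (simp add: sum_distrib_left)
    also have "(\<Sum>v\<in>V \<union> W. if v \<in> V then app (p v) f v else 0) = F f"
      using V(1) W(1) unfolding V(3)[OF f] by (intro sum.mono_neutral_cong_right) auto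
    also have "(\<Sum>v\<in>V \<union> W. if v \<in> W then app (q v) f v else 0) = G f"
      using V(1) W(1) unfolding W(3)[OF f] by (intro sum.mono_neutral_cong_right) auto
    finally show ?thesis by simp
  qed
  moreover have "homogeneous k (r v)" for v
    unfolding r_def by (intro homogeneous_simps(4) homogeneous_simps(3)) (auto simp: V W homogeneous_simps)
  ultimately show ?thesis unfolding point_sum_def using V(1) W(1) by (intro exI[of _ "V \<union> W"] exI[of _ r]) auto
qed

lemma point_sum_diff: "point_sum k F \<Longrightarrow> point_sum k G \<Longrightarrow> point_sum k (\<lambda>f. F f - G f)"
  using point_sum_lincomb[of k F G 1 "-1"] by simp

lemma point_sum_cmult: "point_sum k F \<Longrightarrow> point_sum k (\<lambda>f. a * F f)"
  using point_sum_lincomb[of k F F a 0] by simp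

lemma point_sum_app:
  assumes "point_sum k F" "homogeneous l A"
  shows "point_sum (k + l) (\<lambda>f. F (app A f))"
proof -
  obtain V p where V: "finite V" "\<And>v. homogeneous k (p v)" "\<And>f. smooth f \<Longrightarrow> F f = (\<Sum>v\<in>V. app (p v) f v)"
    using assms(1) by (auto simp: point_sum_def)
  show ?thesis
    unfolding point_sum_def
    by (rule exI[of _ V], rule exI[of _ "\<lambda>v. p v * A"])
       (auto simp: V smooth_app app_mult intro: homogeneous_simps assms)
qed

lemma point_sum_cong: "(\<And>f. smooth f \<Longrightarrow> F f = G f) \<Longrightarrow> point_sum k F \<longleftrightarrow> point_sum k G"
  by (simp add: point_sum_def)

text \<open>Induction on the dimension: the derivative along the last edge \<open>u\<close> leads to
  two facets, with edges \<open>v\<close> and \<open>v - u\<close>, which are again distinct and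
  nonzero. Each facet comes with its own product of directions, and multiplying both products
  together serves the two at once. Every integration consumes one derivative, so the degree
  \<open>k\<close> is the number of directions minus the dimension.\<close>

lemma simplex_integral_point_sum:
  assumes "distinct us" "0 \<notin> set us"
  shows "\<exists>ds k. 0 \<notin> set ds \<and> k + length us = length ds \<and>
    (\<forall>x. point_sum k (\<lambda>f. simplex_integral us x 1 (app (prod_list (map dirop ds)) f)))"
  using assms
proof (induction "length us" arbitrary: us)
  case 0
  have "point_sum 0 (\<lambda>f. app 1 f x)" for x :: "real ^ 'a"
    using point_sum_eval[of x] by (rule point_sum_cong[THEN iffD1, rotated]) (simp add: app_one)
  then show ?case using 0 by (intro exI[of _ "[]"] exI[of _ 0]) auto
next
  case (Suc n)
  then obtain vs u where us: "us = vs @ [u]" by (metis length_Suc_conv_rev)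
  have n: "n = length vs" "n = length (map (\<lambda>v. v - u) vs)" using Suc.hyps(2) us by auto
  obtain ds1 k1 where 1: "0 \<notin> set ds1" "k1 + length vs = length ds1"
    "\<And>x. point_sum k1 (\<lambda>f. simplex_integral vs x 1 (app (prod_list (map dirop ds1)) f))"
    using Suc.hyps(1)[OF n(1)] Suc.prems us by auto
  obtain ds2 k2 where 2: "0 \<notin> set ds2" "k2 + length vs = length ds2"
    "\<And>x. point_sum k2 (\<lambda>f. simplex_integral (map (\<lambda>v. v - u) vs) x 1 (app (prod_list (map dirop ds2)) f))"
  proof -
    have "distinct (map (\<lambda>v. v - u) vs)" using Suc.prems us by (simp add: distinct_map inj_on_def)
    moreover have "0 \<notin> set (map (\<lambda>v. v - u) vs)" using Suc.prems us by auto
    ultimately show ?thesis using Suc.hyps(1)[OF n(2)] that by auto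
  qed
  define k where "k = k1 + length ds2"
  have k2: "k = k2 + length ds1" using 1(2) 2(2) by (simp add: k_def)
  define Q1 Q2 where "Q1 = prod_list (map dirop ds1)" and "Q2 = prod_list (map dirop ds2)"
  have "point_sum k (\<lambda>f. simplex_integral us x 1 (app (prod_list (map dirop (u # ds1 @ ds2))) f))" for x
  proof -
    have a: "point_sum k (\<lambda>f. simplex_integral (map (\<lambda>v. v - u) vs) (x + u) 1 (app Q2 (app Q1 f)))"
      unfolding k2 Q1_def Q2_def using point_sum_app[OF 2(3) homogeneous_dirops] by blast
    have b: "point_sum k (\<lambda>f. simplex_integral vs x 1 (app Q1 (app Q2 f)))"
      unfolding k_def Q1_def Q2_def using point_sum_app[OF 1(3) homogeneous_dirops] by blast
    have "simplex_integral us x 1 (app (prod_list (map dirop (u # ds1 @ ds2))) f)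
      = simplex_integral (map (\<lambda>v. v - u) vs) (x + u) 1 (app Q2 (app Q1 f)) - simplex_integral vs x 1 (app Q1 (app Q2 f))"
      if "smooth f" for f
    proof -
      have "app (prod_list (map dirop (u # ds1 @ ds2))) f = app (dirop u) (app (Q1 * Q2) f)"
        by (simp add: app_mult Q1_def Q2_def)
      moreover have "app Q2 (app Q1 f) = app (Q1 * Q2) f" "app Q1 (app Q2 f) = app (Q1 * Q2) f"
        by (metis app_mult mult.commute)+
      ultimately show ?thesis
        using simplex_integral_snoc[OF smooth_app[OF that], of vs u x 1 "Q1 * Q2"] by (simp add: us)
    qed
    then show ?thesis using point_sum_diff[OF a b] by (subst point_sum_cong) auto
  qed
  moreover have "k + length us = length (u # ds1 @ ds2)" using 1(2) k_def us by simp
  moreover have "0 \<notin> set (u # ds1 @ ds2)" using 1 2 Suc.prems us by auto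
  ultimately show ?case by blast
qed


section \<open>Simplex integrals as Lebesgue integrals\<close>

lemma finite_PiM_simplex_integrable:
  fixes f :: "real ^ 'n \<Rightarrow> complex" and M :: "'b \<Rightarrow> real ^ 'n"
  assumes f: "continuous_on UNIV f" and B: "finite B"
  shows "integrable (Pi\<^sub>M B (\<lambda>_. lborel))
    (\<lambda>y. indicator {y. (\<forall>b\<in>B. 0 \<le> y b) \<and> sum y B \<le> r} y *\<^sub>R f (x + (\<Sum>b\<in>B. y b *\<^sub>R M b)))"
proof -
  interpret product_sigma_finite "\<lambda>_::'b. lborel :: real measure" by standard
  let ?P = "Pi\<^sub>M B (\<lambda>_. lborel :: real measure)"
  let ?T = "{y. (\<forall>b\<in>B. 0 \<le> y b) \<and> sum y B \<le> r}"
  have [measurable]: "f \<in> borel_measurable borel" using f by (rule borel_measurable_continuous_onI)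
  have T: "?T \<inter> space ?P \<in> sets ?P"
  proof -
    have "?T \<inter> space ?P = Pi\<^sub>E B (\<lambda>_. {0..}) \<inter> (\<lambda>x. sum x B) -` {..r} \<inter> space ?P"
      by (auto simp: space_PiM)
    also have "\<dots> \<in> sets ?P" using B by measurable
    finally show ?thesis .
  qed
  define R where "R = norm x + (\<Sum>b\<in>B. r * norm (M b))"
  have "compact (f ` cball 0 R)" by (intro compact_continuous_image continuous_on_subset[OF f]) auto
  then obtain K where K: "\<And>y. y \<in> cball 0 R \<Longrightarrow> norm (f y) \<le> K"
    using compact_imp_bounded bounded_iff by (metis imageI)
  have fin: "emeasure ?P (Pi\<^sub>E B (\<lambda>_. {0..r})) < \<infinity>"
    by (subst emeasure_PiM)
       (use B in \<open>auto simp: less_top[symmetric] ennreal_power power_0_left emeasure_lborel_Icc_eq\<close>)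
  have "integrable ?P (\<lambda>y. indicator (Pi\<^sub>E B (\<lambda>_. {0..r})) y *\<^sub>R K)"
    using fin B by (intro integrable_scaleR_left integrable_real_indicator) auto
  then have "integrable ?P (\<lambda>y. indicator (?T \<inter> space ?P) y *\<^sub>R f (x + (\<Sum>b\<in>B. y b *\<^sub>R M b)))"
  proof (rule Bochner_Integration.integrable_bound)
    show "(\<lambda>y. indicator (?T \<inter> space ?P) y *\<^sub>R f (x + (\<Sum>b\<in>B. y b *\<^sub>R M b))) \<in> borel_measurable ?P"
      using T by measurable
    show "AE y in ?P. norm (indicator (?T \<inter> space ?P) y *\<^sub>R f (x + (\<Sum>b\<in>B. y b *\<^sub>R M b)))
        \<le> norm (indicator (Pi\<^sub>E B (\<lambda>_. {0..r})) y *\<^sub>R K)"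
    proof (intro AE_I2)
      fix y assume y: "y \<in> space ?P"
      show "norm (indicator (?T \<inter> space ?P) y *\<^sub>R f (x + (\<Sum>b\<in>B. y b *\<^sub>R M b))) \<le> norm (indicator (Pi\<^sub>E B (\<lambda>_. {0..r})) y *\<^sub>R K)"
      proof (cases "y \<in> ?T")
        case True
        have le: "y b \<le> r" if "b \<in> B" for b
        proof -
          have "y b \<le> sum y B" using True B that by (intro member_le_sum) auto
          then show ?thesis using True by auto
        qed
        then have "y \<in> Pi\<^sub>E B (\<lambda>_. {0..r})" using y True by (auto simp: space_PiM)
        moreover have "norm (x + (\<Sum>b\<in>B. y b *\<^sub>R M b)) \<le> R"
        proof -
          have "norm (\<Sum>b\<in>B. y b *\<^sub>R M b) \<le> (\<Sum>b\<in>B. r * norm (M b))"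
            using True le by (intro sum_norm_le) (auto intro!: mult_right_mono)
          then show ?thesis unfolding R_def using norm_triangle_ineq order_trans by (smt (verit))
        qed
        then have "norm (f (x + (\<Sum>b\<in>B. y b *\<^sub>R M b))) \<le> K" by (intro K) simp
        ultimately show ?thesis using True y by simp
      next
        case False
        then have "indicator (?T \<inter> space ?P) y = (0 :: real)" by (auto simp: indicator_def)
        then show ?thesis by simp
      qed
    qed
  qed
  then show ?thesis
    by (rule Bochner_Integration.integrable_cong[OF refl, THEN iffD1, rotated]) (auto simp: indicator_def)
qed

text \<open>Fubini splits off the coordinate \<open>b\<close>; the slice at \<open>t\<close> is a
  simplex of size \<open>r - t\<close> based at \<open>x + t *\<^sub>R M b\<close>, and rescaling
  \<open>t\<close> by \<open>r\<close> gives the recursion.\<close>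

lemma PiM_simplex_integral:
  fixes f :: "real ^ 'n \<Rightarrow> complex" and M :: "'b \<Rightarrow> real ^ 'n"
  assumes f: "continuous_on UNIV f" and "distinct bs" "0 \<le> r"
  shows "(LINT y|Pi\<^sub>M (set bs) (\<lambda>_. lborel).
      indicator {y. (\<forall>b\<in>set bs. 0 \<le> y b) \<and> sum y (set bs) \<le> r} y *\<^sub>R f (x + (\<Sum>b\<in>set bs. y b *\<^sub>R M b)))
    = simplex_integral (map M bs) x r f"
  using assms(2,3)
proof (induction bs arbitrary: x r)
  case Nil
  interpret product_sigma_finite "\<lambda>_::'b. lborel :: real measure" by standard
  interpret finite_measure "Pi\<^sub>M {} (\<lambda>_::'b. lborel :: real measure)"
    by rule (simp add: space_PiM)
  show ?case using Nil by (simp add: space_PiM measure_def)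
next
  case (Cons b bs)
  interpret product_sigma_finite "\<lambda>_::'b. lborel :: real measure" by standard
  define B where "B = set bs"
  have B: "finite B" "b \<notin> B" using Cons.prems by (auto simp: B_def)
  define h where "h y = indicator {y. (\<forall>b\<in>insert b B. 0 \<le> y b) \<and> sum y (insert b B) \<le> r} y *\<^sub>R f (x + (\<Sum>b\<in>insert b B. y b *\<^sub>R M b))" for y
  have int: "integrable (Pi\<^sub>M (insert b B) (\<lambda>_. lborel)) h"
    unfolding h_def[abs_def] using B by (intro finite_PiM_simplex_integrable f) auto
  define g where "g t = (if t \<in> {0..r} then simplex_integral (map M bs) (x + t *\<^sub>R M b) (r - t) f else 0)" for t
  have inner: "(LINT y|Pi\<^sub>M B (\<lambda>_. lborel). h (y(b := t))) = g t" for t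
  proof -
    have eq: "h (y(b := t)) = (if t \<in> {0..r} then
        indicator {y. (\<forall>b\<in>B. 0 \<le> y b) \<and> sum y B \<le> r - t} y *\<^sub>R f ((x + t *\<^sub>R M b) + (\<Sum>b\<in>B. y b *\<^sub>R M b)) else 0)" for y
    proof -
      have s: "(\<Sum>c\<in>B. if c = b then t else y c) = sum y B" "(\<Sum>c\<in>B. (if c = b then t else y c) *\<^sub>R M c) = (\<Sum>c\<in>B. y c *\<^sub>R M c)"
        using B by (auto intro!: sum.cong)
      have all: "(\<forall>c\<in>B. 0 \<le> (if c = b then t else y c)) \<longleftrightarrow> (\<forall>c\<in>B. 0 \<le> y c)" using B by auto
      have "(\<forall>c\<in>B. 0 \<le> y c) \<Longrightarrow> 0 \<le> sum y B" by (rule sum_nonneg) auto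
      then show ?thesis using B unfolding h_def by (auto simp: indicator_def s all add.assoc)
    qed
    show ?thesis
    proof (cases "t \<in> {0..r}")
      case True
      then show ?thesis using Cons.IH[of "r - t" "x + t *\<^sub>R M b"] Cons.prems unfolding eq g_def B_def by simp
    next
      case False
      show ?thesis unfolding eq g_def by (simp only: False if_False) simp
    qed
  qed
  have "(LINT y|Pi\<^sub>M (insert b B) (\<lambda>_. lborel). h y) = (LINT y|Pi\<^sub>M ({b} \<union> B) (\<lambda>_. lborel). h y)" by simp
  also have "\<dots> = (LINT z|Pi\<^sub>M {b} (\<lambda>_. lborel). LINT y|Pi\<^sub>M B (\<lambda>_. lborel). h (merge {b} B (z, y)))"
    using int B by (intro product_integral_fold) auto
  also have "\<dots> = (LINT z|Pi\<^sub>M {b} (\<lambda>_. lborel). g (z b))"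
  proof (intro Bochner_Integration.integral_cong refl)
    fix z :: "'b \<Rightarrow> real"
    have "(LINT y|Pi\<^sub>M B (\<lambda>_. lborel). h (merge {b} B (z, y))) = (LINT y|Pi\<^sub>M B (\<lambda>_. lborel). h (y(b := z b)))"
      using B by (intro Bochner_Integration.integral_cong refl arg_cong[where f=h])
        (auto simp: merge_def space_PiM PiE_def extensional_def fun_eq_iff)
    then show "(LINT y|Pi\<^sub>M B (\<lambda>_. lborel). h (merge {b} B (z, y))) = g (z b)" using inner by simp
  qed
  also have "\<dots> = (LINT t|lborel. g t)"
  proof (rule product_integral_singleton)
    have c: "continuous_on {0..r} (\<lambda>t. simplex_integral (map M bs) (x + t *\<^sub>R M b) (r - t) f)"
      by (intro continuous_on_uncurry_compose[OF continuous_simplex_integral[OF f]] continuous_intros)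
    have "(\<lambda>t. if t \<in> {0..r} then simplex_integral (map M bs) (x + t *\<^sub>R M b) (r - t) f else 0) \<in> borel_measurable borel"
      by (rule borel_measurable_continuous_on_if) (use c in auto)
    then show "g \<in> borel_measurable lborel" by (simp add: g_def[abs_def])
  qed
  also have "\<dots> = simplex_integral (map M (b # bs)) x r f"
  \<comment> \<open>The rescaling needs \<open>r > 0\<close>; for \<open>r = 0\<close> the integrand
    lives on a single point, and the recursion carries the factor 0.\<close>
  proof (cases "r = 0")
    case True
    have "AE t in lborel. g t = 0"
      using AE_lborel_singleton[of 0] by eventually_elim (auto simp: g_def True)
    then have "(LINT t|lborel. g t) = 0" by (rule integral_eq_zero_AE)
    then show ?thesis by (simp add: True)
  next
    case False
    then have r: "r > 0" using Cons.prems by simp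
    have "(LINT t|lborel. g t) = r *\<^sub>R (LINT t|lborel. g (0 + r * t))"
      using lborel_integral_real_affine[of r g 0] r by simp
    also have "(LINT t|lborel. g (0 + r * t)) = (LINT t:{0..1}|lborel. simplex_integral (map M bs) (x + (r * t) *\<^sub>R M b) (r * (1 - t)) f)"
      unfolding set_lebesgue_integral_def
    proof (intro Bochner_Integration.integral_cong refl)
      fix t :: real
      have "r * t \<in> {0..r} \<longleftrightarrow> t \<in> {0..1}" using r by (auto simp: mult_le_cancel_left1 zero_le_mult_iff)
      then show "g (0 + r * t) = indicator {0..1} t *\<^sub>R simplex_integral (map M bs) (x + (r * t) *\<^sub>R M b) (r * (1 - t)) f"
        by (auto simp: g_def right_diff_distrib)
    qed
    also have "\<dots> = integral {0..1} (\<lambda>t. simplex_integral (map M bs) (x + (r * t) *\<^sub>R M b) (r * (1 - t)) f)"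
      by (intro set_borel_integral_eq_integral borel_integrable_atLeastAtMost'
          continuous_on_uncurry_compose[OF continuous_simplex_integral[OF f]] continuous_intros)
    finally show ?thesis by simp
  qed
  finally show ?case by (simp add: h_def B_def)
qed

lemma lborel_integral_translate:
  fixes f :: "'a::euclidean_space \<Rightarrow> complex"
  assumes [measurable]: "f \<in> borel_measurable borel"
  shows "(LINT y|lborel. f (a + y)) = (LINT y|lborel. f y)"
  by (subst (2) lborel_distr_plus[of a, symmetric]) (simp add: integral_distr)

text \<open>The edges issuing from one vertex \<open>x\<close> form a basis, so an affine map takes
  the standard simplex to \<open>convex hull C\<close>. The constant is the absolute determinant of
  its linear part.\<close>

lemma integral_over_simplex:
  fixes C :: "(real ^ 'n) set"
  assumes C: "\<not> affine_dependent C" "card C = CARD('n) + 1"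
  shows "\<exists>c us x. distinct us \<and> 0 \<notin> set us \<and> length us = CARD('n) \<and>
    (\<forall>f :: real ^ 'n \<Rightarrow> complex. continuous_on UNIV f \<longrightarrow>
      (LINT y|lborel. indicator (convex hull C) y *\<^sub>R f y) = complex_of_real c * simplex_integral us x 1 f)"
proof -
  have finC: "finite C" using C(2) card.infinite by force
  obtain x where x: "x \<in> C" using C(2) by fastforce
  define D where "D = (\<lambda>v. v - x) ` (C - {x})"
  have indD: "independent D"
    using C(1) affine_dependent_iff_dependent2[OF x] by (simp add: D_def image_image)
  have cardD: "card D = CARD('n)"
    unfolding D_def using x C(2) finC by (subst card_image) (auto simp: inj_on_def)
  have finD: "finite D" by (simp add: D_def finC)
  obtain h where h: "bij_betw h (Basis :: (real ^ 'n) set) D"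
    using finite_same_card_bij[OF finite_Basis finD] cardD by (metis DIM_cart DIM_real mult.right_neutral)
  obtain g where g: "linear g" "\<And>b. b \<in> Basis \<Longrightarrow> g b = h b"
    using linear_independent_extend[OF independent_Basis, of h] by blast
  have gB: "g ` Basis = D" using h g by (auto simp: bij_betw_def)
  have "span D = UNIV"
    using card_eq_dim[of D UNIV] indD cardD finD by (auto simp: dim_UNIV)
  then have "surj g" using linear_span_image[OF g(1), of Basis] gB by simp
  then have inj: "inj g" using linear_surjective_imp_injective[OF g(1)] by blast
  obtain bs where bs: "set bs = (Basis :: (real ^ 'n) set)" "distinct bs"
    using finite_distinct_list[OF finite_Basis] by blast
  have g0: "g 0 = 0" using g(1) by (rule linear_0)
  let ?S = "convex hull (insert 0 Basis) :: (real ^ 'n) set"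
  have hull: "convex hull C = (\<lambda>z. x + g z) ` ?S"
  proof -
    have "C = (\<lambda>z. x + z) ` (g ` insert 0 Basis)"
      using x by (auto simp: gB D_def g0 image_image)
    then have "convex hull C = (\<lambda>z. x + z) ` (convex hull (g ` insert 0 Basis))"
      by (simp only: convex_hull_translation)
    also have "convex hull (g ` insert 0 Basis) = g ` ?S" by (rule convex_hull_linear_image[OF g(1), symmetric])
    finally show ?thesis by (simp add: image_image)
  qed
  obtain c where c: "c > 0" "\<forall>f :: real ^ 'n \<Rightarrow> complex. f \<in> borel_measurable borel \<longrightarrow> (LINT y|lborel. f (g y)) = c *\<^sub>R (LINT y|lborel. f y)"
    using integral_linear_image_scaled[OF g(1) inj] by blast
  have "compact (convex hull C)" by (rule finite_imp_compact_convex_hull[OF finC])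
  then have [measurable]: "convex hull C \<in> sets borel" by (rule borel_compact)
  have "(LINT y|lborel. indicator (convex hull C) y *\<^sub>R f y) = complex_of_real (1 / c) * simplex_integral (map g bs) x 1 f"
    if f: "continuous_on UNIV f" for f :: "real ^ 'n \<Rightarrow> complex"
  proof -
    have [measurable]: "f \<in> borel_measurable borel" "g \<in> borel_measurable borel"
      using f g(1) by (auto intro!: borel_measurable_continuous_onI simp: linear_continuous_on linear_conv_bounded_linear)
    have [measurable]: "?S \<in> sets borel" by (intro borel_compact finite_imp_compact_convex_hull) auto
    have "c *\<^sub>R (LINT y|lborel. indicator (convex hull C) y *\<^sub>R f y)
        = c *\<^sub>R (LINT y|lborel. indicator (convex hull C) (x + y) *\<^sub>R f (x + y))"
      by (subst lborel_integral_translate) auto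
    also have "\<dots> = (LINT z|lborel. indicator (convex hull C) (x + g z) *\<^sub>R f (x + g z))"
      by (subst c(2)[rule_format, symmetric]) auto
    also have "\<dots> = (LINT z|lborel. indicator ?S z *\<^sub>R f (x + g z))"
    proof (intro Bochner_Integration.integral_cong refl)
      fix z
      have "x + g z \<in> convex hull C \<longleftrightarrow> z \<in> ?S" 
      proof -
        have "inj (\<lambda>z. x + g z)" using inj by (simp add: inj_def)
        then show ?thesis unfolding hull by (rule inj_image_mem_iff)
      qed
      then show "indicator (convex hull C) (x + g z) *\<^sub>R f (x + g z) = indicator ?S z *\<^sub>R f (x + g z)"
        by (auto simp: indicator_def)
    qed
    also have "\<dots> = (LINT y|Pi\<^sub>M Basis (\<lambda>_. lborel). indicator ?S (\<Sum>b\<in>Basis. y b *\<^sub>R b) *\<^sub>R f (x + g (\<Sum>b\<in>Basis. y b *\<^sub>R b)))"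
      by (subst lborel_eq, subst integral_distr) auto
    also have "\<dots> = (LINT y|Pi\<^sub>M (set bs) (\<lambda>_. lborel).
      indicator {y. (\<forall>b\<in>set bs. 0 \<le> y b) \<and> sum y (set bs) \<le> 1} y *\<^sub>R f (x + (\<Sum>b\<in>set bs. y b *\<^sub>R g b)))"
      unfolding bs(1)
    proof (intro Bochner_Integration.integral_cong refl)
      fix y :: "real ^ 'n \<Rightarrow> real"
      have "g (\<Sum>b\<in>Basis. y b *\<^sub>R b) = (\<Sum>b\<in>Basis. y b *\<^sub>R g b)"
        by (simp add: linear_sum[OF g(1)] linear_cmul[OF g(1)])
      moreover have "(\<Sum>b\<in>Basis. y b *\<^sub>R b) \<in> ?S \<longleftrightarrow> (\<forall>b\<in>Basis. 0 \<le> y b) \<and> sum y Basis \<le> 1"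
        by (simp add: std_simplex)
      ultimately show "indicator ?S (\<Sum>b\<in>Basis. y b *\<^sub>R b) *\<^sub>R f (x + g (\<Sum>b\<in>Basis. y b *\<^sub>R b))
        = indicator {y. (\<forall>b\<in>Basis. 0 \<le> y b) \<and> sum y Basis \<le> 1} y *\<^sub>R f (x + (\<Sum>b\<in>Basis. y b *\<^sub>R g b))"
        by (simp add: indicator_def)
    qed
    also have "\<dots> = simplex_integral (map g bs) x 1 f"
      by (rule PiM_simplex_integral[OF f bs(2)]) simp
    finally show ?thesis using c(1) by (simp add: scaleR_conv_of_real field_simps)
  qed
  moreover have "distinct (map g bs)" using bs inj by (auto simp: distinct_map inj_on_def inj_def)
  moreover have "0 \<notin> set (map g bs)" using bs inj g0 by (auto simp: inj_def) (metis nonzero_Basis)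
  moreover have "length (map g bs) = CARD('n)"
    using bs distinct_card[OF bs(2)] by simp
  ultimately show ?thesis by blast
qed

section \<open>From simplices to unions of polytopes\<close>

definition vertex_set_integral :: "(real ^ 'n::finite) set \<Rightarrow> bool" where
  "vertex_set_integral P \<longleftrightarrow> (\<exists>ds k. 0 \<notin> set ds \<and> k + CARD('n) = length ds \<and>
    point_sum k (\<lambda>f. LINT y|lborel. indicator P y *\<^sub>R app (prod_list (map dirop ds)) f y))"

lemma vertex_set_integral_simplex:
  fixes C :: "(real ^ 'n) set"
  assumes C: "\<not> affine_dependent C" "card C = CARD('n) + 1"
  shows "vertex_set_integral (convex hull C)"
proof -
  obtain c us x where us: "distinct us" "0 \<notin> set us" "length us = CARD('n)"
    "\<And>f :: real ^ 'n \<Rightarrow> complex. continuous_on UNIV f \<Longrightarrow>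
      (LINT y|lborel. indicator (convex hull C) y *\<^sub>R f y) = complex_of_real c * simplex_integral us x 1 f"
    using integral_over_simplex[OF assms] by blast
  obtain ds k where ds: "0 \<notin> set ds" "k + length us = length ds"
    "\<And>x. point_sum k (\<lambda>f. simplex_integral us x 1 (app (prod_list (map dirop ds)) f))"
    using simplex_integral_point_sum[OF us(1,2)] by blast
  have "point_sum k (\<lambda>f. LINT y|lborel. indicator (convex hull C) y *\<^sub>R app (prod_list (map dirop ds)) f y)"
    by (subst point_sum_cong[OF us(4)]) (intro smooth_continuous smooth_app, assumption, intro point_sum_cmult ds)
  then show ?thesis unfolding vertex_set_integral_def using ds us by auto
qed

lemma integrable_on_compact_indicator:
  fixes f :: "'a::euclidean_space \<Rightarrow> complex"
  assumes "compact A" "continuous_on UNIV f"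
  shows "integrable lborel (\<lambda>y. indicator A y *\<^sub>R f y)"
  using borel_integrable_compact[OF assms(1) continuous_on_subset[OF assms(2)]]
  by (simp add: set_integrable_def[symmetric] indicator_scaleR_eq_if)

text \<open>Applying each product of directions on top of the other gives a common operator, and the
  overlap does not contribute to the integral.\<close>

lemma vertex_set_integral_Un:
  assumes A: "compact A" "vertex_set_integral A" and B: "compact B" "vertex_set_integral B" and N: "negligible (A \<inter> B)"
  shows "vertex_set_integral (A \<union> B :: (real ^ 'n) set)"
proof -
  obtain ds k where ds: "0 \<notin> set ds" "k + CARD('n) = length ds"
    "point_sum k (\<lambda>f. LINT y|lborel. indicator A y *\<^sub>R app (prod_list (map dirop ds)) f y)"
    using A(2) by (auto simp: vertex_set_integral_def)
  obtain es l where es: "0 \<notin> set es" "l + CARD('n) = length es"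
    "point_sum l (\<lambda>f. LINT y|lborel. indicator B y *\<^sub>R app (prod_list (map dirop es)) f y)"
    using B(2) by (auto simp: vertex_set_integral_def)
  have sum: "(LINT y|lborel. indicator (A \<union> B) y *\<^sub>R f y) = (LINT y|lborel. indicator A y *\<^sub>R f y) + (LINT y|lborel. indicator B y *\<^sub>R f y)"
    if f: "continuous_on UNIV f" for f :: "real ^ 'n \<Rightarrow> complex"
  proof -
    have i: "integrable lborel (\<lambda>y. indicator A y *\<^sub>R f y)" "integrable lborel (\<lambda>y. indicator B y *\<^sub>R f y)"
      "integrable lborel (\<lambda>y. indicator (A \<union> B) y *\<^sub>R f y)"
      using A B f by (auto intro: integrable_on_compact_indicator)
    have "closed (A \<inter> B)" using A B by (simp add: compact_imp_closed closed_Int)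
    then have "A \<inter> B \<in> null_sets lborel"
      using N by (simp add: negligible_iff_null_sets null_sets_completion_iff borel_closed)
    then have "AE y in lborel. y \<notin> A \<inter> B" by (rule AE_not_in)
    then have "AE y in lborel. indicator (A \<union> B) y *\<^sub>R f y = indicator A y *\<^sub>R f y + indicator B y *\<^sub>R f y"
      by eventually_elim (auto simp: indicator_def)
    then have "(LINT y|lborel. indicator (A \<union> B) y *\<^sub>R f y) = (LINT y|lborel. indicator A y *\<^sub>R f y + indicator B y *\<^sub>R f y)"
      using i by (intro integral_cong_AE) auto
    then show ?thesis using i by simp
  qed
  define Q1 Q2 where "Q1 = prod_list (map dirop ds)" and "Q2 = prod_list (map dirop es)"
  \<comment> \<open>Both degrees lag behind the number of directions by exactly
    \<open>CARD('n)\<close>; this is why that balance is part of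
    \<open>vertex_set_integral\<close>.\<close>
  have kl: "k + length es = l + length ds" using ds(2) es(2) by simp
  have "point_sum (k + length es) (\<lambda>f. 1 * (LINT y|lborel. indicator A y *\<^sub>R app Q1 (app Q2 f) y)
     + 1 * (LINT y|lborel. indicator B y *\<^sub>R app Q2 (app Q1 f) y))"
    using point_sum_app[OF ds(3) homogeneous_dirops[of es]] point_sum_app[OF es(3) homogeneous_dirops[of ds]]
    unfolding kl[symmetric] Q1_def Q2_def by (rule point_sum_lincomb)
  moreover have "(LINT y|lborel. indicator (A \<union> B) y *\<^sub>R app (prod_list (map dirop (ds @ es))) f y) =
     1 * (LINT y|lborel. indicator A y *\<^sub>R app Q1 (app Q2 f) y) + 1 * (LINT y|lborel. indicator B y *\<^sub>R app Q2 (app Q1 f) y)"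
    if f: "smooth f" for f
  proof -
    have "app Q2 (app Q1 f) = app (Q1 * Q2) f" "app Q1 (app Q2 f) = app (Q1 * Q2) f"
      by (metis app_mult mult.commute)+
    moreover have "app (prod_list (map dirop (ds @ es))) f = app (Q1 * Q2) f" by (simp add: Q1_def Q2_def)
    ultimately show ?thesis using sum[OF smooth_continuous[OF smooth_app[OF f]], of "Q1 * Q2"] by simp
  qed
  ultimately have "point_sum (k + length es) (\<lambda>f. LINT y|lborel. indicator (A \<union> B) y *\<^sub>R app (prod_list (map dirop (ds @ es))) f y)"
    by (subst point_sum_cong) auto
  then show ?thesis unfolding vertex_set_integral_def using ds es by (intro exI[of _ "ds @ es"] exI[of _ "k + length es"]) auto
qed

lemma vertex_set_integral_Union:
  fixes F :: "(real ^ 'n) set set"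
  assumes "finite F" "F \<noteq> {}" "\<And>A. A \<in> F \<Longrightarrow> compact A \<and> vertex_set_integral A"
    "\<And>A B. A \<in> F \<Longrightarrow> B \<in> F \<Longrightarrow> A \<noteq> B \<Longrightarrow> negligible (A \<inter> B)"
  shows "vertex_set_integral (\<Union>F)"
  using assms
proof (induction F rule: finite_ne_induct)
  case (insert A F)
  have c: "compact B" "vertex_set_integral B" if "B \<in> insert A F" for B
    using insert.prems(1)[OF that] by simp_all
  have neg: "negligible (A \<inter> \<Union>F)"
  proof -
    have "negligible (A \<inter> B)" if "B \<in> F" for B
      by (rule insert.prems(2)) (use that insert.hyps(3) in auto)
    then have "\<And>T. T \<in> (\<inter>) A ` F \<Longrightarrow> negligible T" by blast
    then have "negligible (\<Union> ((\<inter>) A ` F))"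
      by (rule negligible_Union[OF finite_imageI[OF insert.hyps(1)]])
    moreover have "A \<inter> \<Union>F = \<Union> ((\<inter>) A ` F)" by blast
    ultimately show ?thesis by (simp only:)
  qed
  have cU: "compact (\<Union>F)" by (rule compact_Union[OF insert.hyps(1)]) (rule c, simp)
  have vU: "vertex_set_integral (\<Union>F)"
  proof (rule insert.IH)
    show "compact B \<and> vertex_set_integral B" if "B \<in> F" for B using c that by simp
    show "negligible (B \<inter> C)" if "B \<in> F" "C \<in> F" "B \<noteq> C" for B C
      by (rule insert.prems(2)) (use that in auto)
  qed
  show ?case
    unfolding Union_insert by (rule vertex_set_integral_Un[OF c[OF insertI1] cU vU neg])
qed simp

text \<open>Two different full-dimensional simplices of a triangulation meet in a face that is
  proper in at least one of them, hence of lower dimension and measure zero.\<close>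

lemma vertex_set_integral_polytope:
  fixes P :: "(real ^ 'n) set"
  assumes "polytope P" "aff_dim P = int CARD('n)"
  shows "vertex_set_integral P"
proof -
  obtain T where T: "triangulation T" "\<And>k. k \<in> T \<Longrightarrow> aff_dim k = int CARD('n)" "\<Union>T = P"
    by (rule fine_triangular_subdivision_of_cell_complex[of 1 "{P}" "int CARD('n)"])
       (use assms in \<open>auto simp: face_of_refl polytope_imp_convex\<close>)
  have fT: "finite T" using T(1) by (simp add: triangulation_def)
  have simp: "compact A \<and> convex A \<and> vertex_set_integral A" if A: "A \<in> T" for A
  proof -
    obtain m where m: "m simplex A" using T(1) A by (auto simp: triangulation_def)
    then have "m = int CARD('n)" using aff_dim_simplex[OF m] T(2)[OF A] by simp
    then obtain C where C: "\<not> affine_dependent C" "int (card C) = int CARD('n) + 1" "A = convex hull C"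
      using m by (auto simp: simplex_def)
    then have "card C = CARD('n) + 1" by linarith
    from vertex_set_integral_simplex[OF C(1) this] show ?thesis using C(3) compact_simplex[OF m] by auto
  qed
  have neg: "negligible (A \<inter> B)" if AB: "A \<in> T" "B \<in> T" "A \<noteq> B" for A B
  proof -
    have f: "(A \<inter> B) face_of A" "(B \<inter> A) face_of B" using T(1) AB by (auto simp: triangulation_def)
    have "aff_dim (A \<inter> B) < int CARD('n)"
    proof (cases "A \<inter> B = A")
      case False
      then show ?thesis using face_of_aff_dim_lt[OF _ f(1)] simp[OF AB(1)] T(2)[OF AB(1)] by simp
    next
      case True
      then have "B \<inter> A \<noteq> B" using AB(3) by blast
      then show ?thesis using face_of_aff_dim_lt[OF _ f(2)] simp[OF AB(2)] T(2)[OF AB(2)] by (simp add: Int_commute)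
    qed
    then have "interior (A \<inter> B) = {}"
      using aff_dim_nonempty_interior[of "A \<inter> B"] by force
    then show ?thesis using simp AB by (subst negligible_convex_interior) (auto intro: convex_Int)
  qed
  have "T \<noteq> {}" using T(3) assms(2) by (auto simp: aff_dim_empty)
  then show ?thesis using vertex_set_integral_Union[OF fT _ _ neg] simp T(3) by blast
qed

lemma vertex_set_integral_polytopes:
  fixes P :: "'b \<Rightarrow> (real ^ 'n) set"
  assumes I: "finite I" "I \<noteq> {}" and P: "\<And>j. j \<in> I \<Longrightarrow> polytope (P j)" "\<And>j. j \<in> I \<Longrightarrow> aff_dim (P j) = int CARD('n)"
    and disj: "disjoint_family_on (\<lambda>j. interior (P j)) I"
  shows "vertex_set_integral (\<Union>j\<in>I. P j)"
proof (rule vertex_set_integral_Union)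
  show "finite (P ` I)" "P ` I \<noteq> {}" using I by auto
  show "compact A \<and> vertex_set_integral A" if "A \<in> P ` I" for A
    using that P by (auto simp: polytope_imp_compact vertex_set_integral_polytope)
  show "negligible (A \<inter> B)" if AB: "A \<in> P ` I" "B \<in> P ` I" "A \<noteq> B" for A B
  proof -
    obtain k l where kl: "k \<in> I" "l \<in> I" "A = P k" "B = P l" using AB by blast
    with AB(3) have "k \<noteq> l" by blast
    then have "interior (A \<inter> B) = {}" using kl disj by (simp add: disjoint_family_on_def)
    then show ?thesis using AB P by (subst negligible_convex_interior) (auto intro!: convex_Int simp: polytope_imp_convex)
  qed
qed


section \<open>Smooth functions with vanishing integrals over all congruent copies\<close>

text \<open>Copies are pulled back to the fixed domain \<open>P\<close>, so that differentiating in
  the parameters of the motion only affects the integrand.\<close>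

definition copy_integral_zero :: "(real ^ 'n) set \<Rightarrow> (real ^ 'n \<Rightarrow> complex) \<Rightarrow> bool" where
  "copy_integral_zero P f \<longleftrightarrow>
     (\<forall>a g. orthogonal_transformation g \<longrightarrow> (LINT y|lborel. indicator P y *\<^sub>R f (a + g y)) = 0)"

section \<open>Differentiation under the integral sign, and plane rotations\<close>

lemma vector_derivative_quotient_tendsto:
  assumes "(f has_vector_derivative d) (at a)"
  shows "((\<lambda>s. (f s - f a) /\<^sub>R (s - a)) \<longlongrightarrow> d) (at a)"
proof -
  have "((\<lambda>s. norm (f s - f a - (s - a) *\<^sub>R d) / norm (s - a)) \<longlongrightarrow> 0) (at a)"
    using assms by (simp add: has_vector_derivative_def has_derivative_iff_norm)
  moreover have "\<forall>\<^sub>F s in at a. norm (f s - f a - (s - a) *\<^sub>R d) / norm (s - a) = norm ((f s - f a) /\<^sub>R (s - a) - d)"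
    unfolding eventually_at_filter
  proof (intro always_eventually allI impI)
    fix s assume s: "s \<noteq> a"
    have "(f s - f a) /\<^sub>R (s - a) - d = (f s - f a - (s - a) *\<^sub>R d) /\<^sub>R (s - a)"
      using s by (simp add: scaleR_diff_right)
    then show "norm (f s - f a - (s - a) *\<^sub>R d) / norm (s - a) = norm ((f s - f a) /\<^sub>R (s - a) - d)"
      by (simp only: norm_scaleR) (simp add: divide_inverse mult.commute)
  qed
  ultimately have "((\<lambda>s. norm ((f s - f a) /\<^sub>R (s - a) - d)) \<longlongrightarrow> 0) (at a)"
    by (rule Lim_transform_eventually)
  then show ?thesis using Lim_null tendsto_norm_zero_iff by blast
qed

text \<open>The integral is 0 for every \<open>s\<close>, hence so are its difference quotients at
  0, and dominated convergence along \<open>s = 1 / (n + 1)\<close> passes to the limit. The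
  quotients are bounded because increments in \<open>s\<close> are integrals of \<open>F'\<close>,
  which is bounded on the compact set \<open>{0..1} \<times> P\<close>.\<close>

lemma integral_derivative_zero:
  fixes F F' :: "real \<Rightarrow> 'a::euclidean_space \<Rightarrow> complex"
  assumes P: "compact P"
    and F: "\<And>s. continuous_on UNIV (F s)"
    and F': "continuous_on UNIV (\<lambda>(s, y). F' s y)"
    and der: "\<And>s y. ((\<lambda>s. F s y) has_vector_derivative F' s y) (at s)"
    and zero: "\<And>s. (LINT y|lborel. indicator P y *\<^sub>R F s y) = 0"
  shows "(LINT y|lborel. indicator P y *\<^sub>R F' 0 y) = 0"
proof -
  have "compact ((\<lambda>(s, y). F' s y) ` ({0..1} \<times> P))"
    by (intro compact_continuous_image continuous_on_subset[OF F'] compact_Times P) auto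
  then obtain K where K: "\<And>s y. s \<in> {0..1} \<Longrightarrow> y \<in> P \<Longrightarrow> norm (F' s y) \<le> K"
    using compact_imp_bounded bounded_iff by (metis (mono_tags, lifting) SigmaI case_prod_conv image_eqI)
  have F'0: "continuous_on UNIV (F' 0)"
    by (rule continuous_on_uncurry_compose[OF F', of _ "\<lambda>_. 0" "\<lambda>y. y"]) (intro continuous_intros)+
  define h :: "nat \<Rightarrow> real" where "h n = 1 / real (Suc n)" for n
  have h: "0 < h n" "h n \<le> 1" for n by (auto simp: h_def)
  have h0: "h \<longlonglongrightarrow> 0" unfolding h_def by (rule LIMSEQ_Suc[OF lim_1_over_n])
  define u where "u n y = indicator P y *\<^sub>R ((F (h n) y - F 0 y) /\<^sub>R h n)" for n y
  have "(\<lambda>n. LINT y|lborel. u n y) \<longlonglongrightarrow> (LINT y|lborel. indicator P y *\<^sub>R F' 0 y)"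
  proof (rule integral_dominated_convergence[where w="\<lambda>y. indicator P y *\<^sub>R K"])
    have [measurable]: "P \<in> sets borel" using P by (rule borel_compact)
    show "(\<lambda>y. indicator P y *\<^sub>R F' 0 y) \<in> borel_measurable lborel"
      using borel_measurable_continuous_onI[OF F'0] by simp
    show "u n \<in> borel_measurable lborel" for n
      unfolding u_def[abs_def] using borel_measurable_continuous_onI[OF F] by simp
    show "integrable lborel (\<lambda>y. indicator P y *\<^sub>R K)"
      using P by (intro integrable_scaleR_left integrable_real_indicator) (use emeasure_compact_finite[OF P] in \<open>auto simp: less_top\<close>)
    show "AE y in lborel. (\<lambda>n. u n y) \<longlonglongrightarrow> indicator P y *\<^sub>R F' 0 y"
    proof (intro AE_I2)
      fix y
      have "((\<lambda>s. (F s y - F 0 y) /\<^sub>R (s - 0)) \<longlongrightarrow> F' 0 y) (at 0)"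
        by (rule vector_derivative_quotient_tendsto[OF der])
      moreover have "filterlim h (at 0) sequentially"
        using h0 h(1) by (auto simp: filterlim_at less_imp_neq[symmetric] intro!: always_eventually)
      ultimately have "(\<lambda>n. (F (h n) y - F 0 y) /\<^sub>R (h n - 0)) \<longlonglongrightarrow> F' 0 y"
        by (rule filterlim_compose)
      then show "(\<lambda>n. u n y) \<longlonglongrightarrow> indicator P y *\<^sub>R F' 0 y"
        unfolding u_def by (intro tendsto_scaleR tendsto_const) simp
    qed
    show "AE y in lborel. norm (u n y) \<le> indicator P y *\<^sub>R K" for n
    proof (intro AE_I2)
      fix y
      show "norm (u n y) \<le> indicator P y *\<^sub>R K"
      proof (cases "y \<in> P")
        case True
        have "((\<lambda>s. F' s y) has_integral F (h n) y - F 0 y) (cbox 0 (h n))"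
          using fundamental_theorem_of_calculus[of 0 "h n" "\<lambda>s. F s y" "\<lambda>s. F' s y"] h(1)[of n] der
          by (auto intro: has_vector_derivative_at_within)
        moreover have "0 \<le> K" using K[of 0 y] True norm_ge_zero order_trans by (metis atLeastAtMost_iff order_refl zero_le_one)
        ultimately have "norm (F (h n) y - F 0 y) \<le> K * measure lborel (cbox 0 (h n))"
          by (intro has_integral_bound[of K "\<lambda>s. F' s y"] K) (use True h[of n] in auto)
        then have "norm (F (h n) y - F 0 y) / h n \<le> K" using h(1)[of n] by (simp add: pos_divide_le_eq)
        moreover have "norm (u n y) = norm (F (h n) y - F 0 y) / h n"
          unfolding u_def using True h(1)[of n]
          by (simp only: indicator_simps scaleR_one norm_scaleR) (simp add: divide_inverse mult.commute)
        ultimately show ?thesis using True by simp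
      qed (simp add: u_def)
    qed
  qed
  moreover have "(LINT y|lborel. u n y) = 0" for n
  proof -
    have "u n = (\<lambda>y. (indicator P y *\<^sub>R F (h n) y - indicator P y *\<^sub>R F 0 y) /\<^sub>R h n)"
      by (auto simp: u_def algebra_simps)
    then show ?thesis
      using integrable_on_compact_indicator[OF P F[of "h n"]] integrable_on_compact_indicator[OF P F[of 0]] zero[of "h n"] zero[of 0]
      by (simp del: scaleR_right_diff_distrib)
  qed
  ultimately show ?thesis by (simp add: LIMSEQ_const_iff)
qed

definition plane_rotation :: "'n \<Rightarrow> 'n \<Rightarrow> real \<Rightarrow> real ^ 'n \<Rightarrow> real ^ 'n" where
  "plane_rotation k l s x = (\<chi> m. if m = k then cos s * x $ k - sin s * x $ l
     else if m = l then sin s * x $ k + cos s * x $ l else x $ m)"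

lemma plane_rotation_orthogonal:
  fixes k l :: "'n::finite"
  assumes "k \<noteq> l"
  shows "orthogonal_transformation (plane_rotation k l s)"
proof -
  interpret plane k l by unfold_locales (rule assms)
  have "linear (plane_rotation k l s)"
    by (rule linearI) (auto simp: plane_rotation_def vec_eq_iff algebra_simps)
  moreover have "norm (plane_rotation k l s x) = norm x" for x
  proof -
    have "(\<Sum>m\<in>rest. (plane_rotation k l s x $ m)\<^sup>2) = (\<Sum>m\<in>rest. (x $ m)\<^sup>2)"
      by (intro sum.cong) (auto simp: plane_rotation_def rest_def)
    moreover have "(plane_rotation k l s x $ k)\<^sup>2 + (plane_rotation k l s x $ l)\<^sup>2 = ((cos s)\<^sup>2 + (sin s)\<^sup>2) * ((x $ k)\<^sup>2 + (x $ l)\<^sup>2)"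
    proof -
      have "(c * a - d * b)\<^sup>2 + (d * a + c * b)\<^sup>2 = (c\<^sup>2 + d\<^sup>2) * (a\<^sup>2 + b\<^sup>2)" for a b c d :: real
        by (simp add: power2_eq_square algebra_simps)
      then show ?thesis using assms by (simp only: plane_rotation_def vec_lambda_beta if_True if_False simp_thms refl not_sym)
    qed
    ultimately have "(\<Sum>m\<in>UNIV. (plane_rotation k l s x $ m)\<^sup>2) = (\<Sum>m\<in>UNIV. (x $ m)\<^sup>2)"
      by (simp add: sum_rest)
    then show ?thesis by (simp add: norm_vec_def L2_set_def)
  qed
  ultimately show ?thesis by (simp add: orthogonal_transformation)
qed

lemma plane_rotation_0: "plane_rotation k l 0 x = x"
  by (simp add: plane_rotation_def vec_eq_iff)

lemma plane_rotation_derivative: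
  assumes "k \<noteq> l"
  shows "((\<lambda>s. plane_rotation k l s x) has_vector_derivative
    plane_rotation k l s x $ k *\<^sub>R axis l 1 - plane_rotation k l s x $ l *\<^sub>R axis k 1) (at s)"
proof -
  have "((\<lambda>s. plane_rotation k l s x $ m) has_vector_derivative
    (plane_rotation k l s x $ k *\<^sub>R axis l 1 - plane_rotation k l s x $ l *\<^sub>R axis k 1) $ m) (at s)" for m
    using assms
    by (cases "m = k"; cases "m = l")
       (auto simp: plane_rotation_def axis_def has_real_derivative_iff_has_vector_derivative[symmetric] intro!: derivative_eq_intros)
  then show ?thesis
    unfolding has_vector_derivative_def by (subst has_derivative_componentwise_within)
      (auto simp: Basis_vec_def inner_axis)
qed

lemma plane_rotation_continuous:
  fixes k l :: "'n::finite"
  shows "continuous_on UNIV (\<lambda>(s, x). plane_rotation k l s x)"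
  unfolding plane_rotation_def case_prod_beta
proof (intro continuous_on_vec_lambda)
  fix m :: 'n
  have cs: "continuous_on UNIV (\<lambda>x::real \<times> (real ^ 'n). cos (fst x))" "continuous_on UNIV (\<lambda>x::real \<times> (real ^ 'n). sin (fst x))"
    by (rule continuous_on_cos continuous_on_sin, rule continuous_on_fst, rule continuous_on_id)+
  show "continuous_on UNIV (\<lambda>x :: real \<times> (real ^ 'n). if m = k then cos (fst x) * snd x $ k - sin (fst x) * snd x $ l
      else if m = l then sin (fst x) * snd x $ k + cos (fst x) * snd x $ l else snd x $ m)"
    by (cases "m = k"; cases "m = l") (auto intro!: continuous_on_add continuous_on_diff continuous_on_mult continuous_on_component continuous_on_snd continuous_on_id cs)
qed

lemma copy_integral_zeroD:
  "copy_integral_zero P f \<Longrightarrow> orthogonal_transformation g \<Longrightarrow> (LINT y|lborel. indicator P y *\<^sub>R f (a + g y)) = 0"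
  by (simp add: copy_integral_zero_def)

lemma orthogonal_continuous_on:
  fixes g :: "'a::euclidean_space \<Rightarrow> 'a"
  shows "orthogonal_transformation g \<Longrightarrow> continuous_on S g"
  by (simp add: orthogonal_transformation_linear linear_continuous_on linear_conv_bounded_linear[symmetric])

lemma copy_integral_zero_pd:
  assumes P: "compact P" and f: "smooth f" "copy_integral_zero P f"
  shows "copy_integral_zero P (pd i f)"
  unfolding copy_integral_zero_def
proof (intro allI impI)
  fix a :: "real ^ 'a" and g :: "real ^ 'a \<Rightarrow> real ^ 'a" assume g: "orthogonal_transformation g"
  note c = continuous_on_compose2[OF smooth_continuous[of _ UNIV], OF _ _ subset_UNIV]
  have "(LINT y|lborel. indicator P y *\<^sub>R pd i f ((a + g y) + 0 *\<^sub>R axis i 1)) = 0"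
  proof (rule integral_derivative_zero[OF P, where F="\<lambda>s y. f ((a + g y) + s *\<^sub>R axis i 1)" and F'="\<lambda>s y. pd i f ((a + g y) + s *\<^sub>R axis i 1)"])
    show "continuous_on UNIV (\<lambda>y. f (a + g y + s *\<^sub>R axis i 1))" for s
      by (intro c[OF f(1)] continuous_intros orthogonal_continuous_on g)
    show "continuous_on UNIV (\<lambda>(s, y). pd i f (a + g y + s *\<^sub>R axis i 1))"
      unfolding case_prod_beta
      by (intro c[OF smooth_pd[OF f(1)]] continuous_intros continuous_on_compose2[OF orthogonal_continuous_on[OF g, of UNIV]]) auto
    show "((\<lambda>s. f (a + g y + s *\<^sub>R axis i 1)) has_vector_derivative pd i f (a + g y + s *\<^sub>R axis i 1)) (at s)" for s y
      by (rule smooth_line_derivative_axis[OF f(1)])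
    show "(LINT y|lborel. indicator P y *\<^sub>R f (a + g y + s *\<^sub>R axis i 1)) = 0" for s
      using copy_integral_zeroD[OF f(2) g, of "a + s *\<^sub>R axis i 1"] by (simp add: add_ac)
  qed
  then show "(LINT y|lborel. indicator P y *\<^sub>R pd i f (a + g y)) = 0" by simp
qed

text \<open>Rotating a copy gives a copy: \<open>plane_rotation k l s\<close> sends
  \<open>a + g y\<close> to a new base point plus a composite orthogonal map.
  \<open>Lrot k l f\<close> is the derivative in the angle \<open>s\<close>.\<close>

lemma copy_integral_zero_Lrot:
  assumes P: "compact P" and f: "smooth f" "copy_integral_zero P f"
  shows "copy_integral_zero P (Lrot k l f)"
proof (cases "k = l")
  case True
  then show ?thesis by (simp add: copy_integral_zero_def Lrot_def)
next
  case False
  show ?thesis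
    unfolding copy_integral_zero_def
  proof (intro allI impI)
    fix a :: "real ^ 'a" and g :: "real ^ 'a \<Rightarrow> real ^ 'a" assume g: "orthogonal_transformation g"
    note c = continuous_on_compose2[OF smooth_continuous[of _ UNIV], OF _ _ subset_UNIV]
    have rc: "continuous_on UNIV (\<lambda>y. plane_rotation k l s (a + g y))" for s
      by (intro continuous_on_uncurry_compose[OF plane_rotation_continuous] continuous_intros orthogonal_continuous_on g)
    have rc2: "continuous_on UNIV (\<lambda>(s, y). plane_rotation k l s (a + g y))"
      unfolding case_prod_beta
      by (intro continuous_on_uncurry_compose[OF plane_rotation_continuous] continuous_intros
          continuous_on_compose2[OF orthogonal_continuous_on[OF g, of UNIV]]) auto
    have "(LINT y|lborel. indicator P y *\<^sub>R Lrot k l f (plane_rotation k l 0 (a + g y))) = 0"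
    proof (rule integral_derivative_zero[OF P, where F="\<lambda>s y. f (plane_rotation k l s (a + g y))" and F'="\<lambda>s y. Lrot k l f (plane_rotation k l s (a + g y))"])
      show "continuous_on UNIV (\<lambda>y. f (plane_rotation k l s (a + g y)))" for s
        by (rule c[OF f(1) rc])
      show "continuous_on UNIV (\<lambda>(s, y). Lrot k l f (plane_rotation k l s (a + g y)))"
        using c[OF smooth_Lrot[OF f(1)] rc2] by (simp add: case_prod_beta)
      show "((\<lambda>s. f (plane_rotation k l s (a + g y))) has_vector_derivative Lrot k l f (plane_rotation k l s (a + g y))) (at s)" for s y
      proof -
        let ?x = "plane_rotation k l s (a + g y)"
        let ?v = "?x $ k *\<^sub>R axis l 1 - ?x $ l *\<^sub>R axis k (1::real)"
        have "((\<lambda>s. f (plane_rotation k l s (a + g y))) has_derivative (\<lambda>h. \<Sum>i\<in>UNIV. ((h *\<^sub>R ?v) $ i) *\<^sub>R pd i f ?x)) (at s)"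
          by (rule has_derivative_compose[OF plane_rotation_derivative[OF False, unfolded has_vector_derivative_def] smooth_has_pd[OF f(1)]])
        moreover have "(\<Sum>i\<in>UNIV. ((h *\<^sub>R ?v) $ i) *\<^sub>R pd i f ?x) = h *\<^sub>R Lrot k l f ?x" for h
        proof -
          have "(\<Sum>i\<in>UNIV. ((h *\<^sub>R ?v) $ i) *\<^sub>R pd i f ?x) = h *\<^sub>R (\<Sum>i\<in>UNIV. ((?x $ k) * axis l 1 $ i) *\<^sub>R pd i f ?x - ((?x $ l) * axis k 1 $ i) *\<^sub>R pd i f ?x)"
            by (simp add: scaleR_sum_right algebra_simps)
          also have "\<dots> = h *\<^sub>R Lrot k l f ?x"
          proof -
            have "(\<Sum>i\<in>UNIV. (c * axis m 1 $ i) *\<^sub>R pd i f ?x) = c *\<^sub>R pd m f ?x" for c m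
            proof -
              have "(\<Sum>i\<in>UNIV. (c * axis m 1 $ i) *\<^sub>R pd i f ?x) = (\<Sum>i\<in>UNIV. if i = m then c *\<^sub>R pd i f ?x else 0)"
                by (intro sum.cong) (auto simp: axis_def)
              then show ?thesis by simp
            qed
            then show ?thesis by (simp only: sum_subtractf Lrot_def scaleR_conv_of_real)
          qed
          finally show ?thesis .
        qed
        ultimately show ?thesis unfolding has_vector_derivative_def by simp
      qed
      show "(LINT y|lborel. indicator P y *\<^sub>R f (plane_rotation k l s (a + g y))) = 0" for s
      proof -
        have lin: "linear (plane_rotation k l s)" using plane_rotation_orthogonal[OF False] by (rule orthogonal_transformation_linear)
        have "orthogonal_transformation (plane_rotation k l s \<circ> g)"
          using orthogonal_transformation_compose[OF plane_rotation_orthogonal[OF False] g] .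
        from copy_integral_zeroD[OF f(2) this, of "plane_rotation k l s a"] show ?thesis
          by (simp add: linear_add[OF lin])
      qed
    qed
    then show "(LINT y|lborel. indicator P y *\<^sub>R Lrot k l f (a + g y)) = 0" by (simp add: plane_rotation_0)
  qed
qed

lemma copy_integral_zero_add:
  assumes P: "compact P" and f: "smooth f" "copy_integral_zero P f" and h: "smooth h" "copy_integral_zero P h"
  shows "copy_integral_zero P (\<lambda>x. f x + h x)"
  unfolding copy_integral_zero_def
proof (intro allI impI)
  fix a :: "real ^ 'a" and g :: "real ^ 'a \<Rightarrow> real ^ 'a" assume g: "orthogonal_transformation g"
  have "integrable lborel (\<lambda>y. indicator P y *\<^sub>R f (a + g y))" if "smooth f" for f
    by (intro integrable_on_compact_indicator P continuous_on_compose2[OF smooth_continuous[OF that, of UNIV]]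
        continuous_intros orthogonal_continuous_on g) auto
  then show "(LINT y|lborel. indicator P y *\<^sub>R (f (a + g y) + h (a + g y))) = 0"
    using f h copy_integral_zeroD[OF _ g] by (simp add: scaleR_add_right)
qed

lemma copy_integral_zero_invariant_space:
  fixes P :: "(real ^ 'n) set"
  assumes P: "compact P"
  shows "invariant_space {f. smooth f \<and> copy_integral_zero P f}"
proof -
  have "copy_integral_zero P (app A f)" if "smooth f" "copy_integral_zero P f" for A f
    using that
  proof (induction A arbitrary: f rule: diffop_induct)
    case (cst c)
    then show ?case
      by (simp add: app_cst copy_integral_zero_def flip: mult_scaleR_right)
  next
    case (X i)
    then show ?case using copy_integral_zero_pd[OF P] by (simp add: app_X)
  next
    case (add A B)
    then show ?case unfolding app_add by (intro copy_integral_zero_add P smooth_app) auto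
  next
    case (mult A B)
    then show ?case by (simp add: app_mult smooth_app)
  qed
  then show ?thesis
    unfolding invariant_space_def using copy_integral_zero_Lrot[OF P] by (auto intro: smooth_app smooth_Lrot)
qed


section \<open>Mollification\<close>

text \<open>The flat function \<open>exp (- 1 / t)\<close> divided by powers of \<open>t\<close>:
  the derivative of each member is a combination of the next two, so the family closes up under
  differentiation.\<close>

definition flat :: "nat \<Rightarrow> real \<Rightarrow> real" where
  "flat k t = (if t > 0 then exp (- 1 / t) / t ^ k else 0)"

lemma flat_tendsto_0: "(flat k \<longlongrightarrow> 0) (at 0)"
proof -
  have "((\<lambda>t. inverse t ^ k / exp (inverse t)) \<longlongrightarrow> (0::real)) (at_right 0)"
    using filterlim_compose[OF tendsto_power_div_exp_0 filterlim_inverse_at_top_right] .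
  then have "(flat k \<longlongrightarrow> 0) (at_right 0)"
    by (rule Lim_transform_eventually)
       (auto simp: flat_def eventually_at_filter exp_minus field_simps)
  moreover have "(flat k \<longlongrightarrow> 0) (at_left 0)"
    by (rule Lim_transform_eventually[OF tendsto_const]) (auto simp: flat_def eventually_at_filter)
  ultimately show ?thesis by (simp add: filterlim_split_at)
qed

lemma flat_derivative:
  "(flat k has_real_derivative (- real k * flat (Suc k) t + flat (Suc (Suc k)) t)) (at t)"
proof -
  consider "t > 0" | "t < 0" | "t = 0" by linarith
  then show ?thesis
  proof cases
    case 1
    have "((\<lambda>t. exp (- 1 / t) / t ^ k) has_real_derivative
        (exp (- 1 / t) * (1 / t\<^sup>2) * t ^ k - exp (- 1 / t) * (real k * t ^ (k - 1))) / (t ^ k * t ^ k)) (at t)"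
      using 1 by (auto intro!: derivative_eq_intros simp: power2_eq_square)
    moreover have "(exp (- 1 / t) * (1 / t\<^sup>2) * t ^ k - exp (- 1 / t) * (real k * t ^ (k - 1))) / (t ^ k * t ^ k)
        = - real k * flat (Suc k) t + flat (Suc (Suc k)) t"
      using 1 by (cases k) (simp_all add: flat_def field_simps power2_eq_square)
    ultimately have "((\<lambda>t. exp (- 1 / t) / t ^ k) has_real_derivative (- real k * flat (Suc k) t + flat (Suc (Suc k)) t)) (at t)" by simp
    then show ?thesis
      by (rule has_field_derivative_transform_within_open[where S="{0<..}"]) (use 1 in \<open>auto simp: flat_def\<close>)
  next
    case 2
    have "((\<lambda>_. 0) has_real_derivative (- real k * flat (Suc k) t + flat (Suc (Suc k)) t)) (at t)"
      using 2 by (simp add: flat_def)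
    then show ?thesis
      by (rule has_field_derivative_transform_within_open[where S="{..<0}"]) (use 2 in \<open>auto simp: flat_def\<close>)
  next
    case 3
    have "((\<lambda>h. (flat k h - flat k 0) / (h - 0)) \<longlongrightarrow> 0) (at 0)"
      by (rule Lim_transform_eventually[OF flat_tendsto_0[of "Suc k"]])
         (auto simp: flat_def eventually_at_filter)
    then show ?thesis using 3 by (simp add: has_field_derivative_iff flat_def)
  qed
qed

definition bump :: "nat \<Rightarrow> real ^ 'n \<Rightarrow> complex" where
  "bump k x = complex_of_real (flat k (1 - x \<bullet> x))"

lemma bump_has_derivative:
  "(bump k has_derivative (\<lambda>h. complex_of_real ((- real k * flat (Suc k) (1 - x \<bullet> x) + flat (Suc (Suc k)) (1 - x \<bullet> x)) * (- 2 * (x \<bullet> h))))) (at x)"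
proof -
  have "((\<lambda>x. 1 - x \<bullet> x) has_derivative (\<lambda>h. - 2 * (x \<bullet> h))) (at x)"
    by (auto intro!: derivative_eq_intros simp: inner_commute)
  from has_derivative_of_real[OF has_derivative_compose[OF this flat_derivative[unfolded has_field_derivative_def]]]
  show ?thesis by (simp add: bump_def[abs_def])
qed

lemma smooth_bump: "smooth (bump k)"
proof (rule smooth_upto[where B="range bump"])
  fix f :: "real ^ 'n \<Rightarrow> complex" and x assume "f \<in> range bump"
  then show "f differentiable (at x)" using bump_has_derivative differentiable_def by blast
next
  fix f :: "real ^ 'n \<Rightarrow> complex" and i assume "f \<in> range bump"
  then obtain k where f: "f = bump k" by auto
  have "pd i f = (\<lambda>x. (complex_of_real (- real k) * bump (Suc k) x + bump (Suc (Suc k)) x) * (complex_of_real (-2) * complex_of_real (x $ i)))"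
    unfolding f by (rule ext, subst pd_eqI[OF bump_has_derivative]) (simp add: bump_def inner_axis)
  also have "\<dots> \<in> smooth_span (range bump)"
    by (intro smooth_span.mult smooth_span.add smooth_span.smooth[OF smooth_coord] smooth_span.smooth[OF smooth_const] smooth_span.base rangeI)
  finally show "pd i f \<in> smooth_span (range bump)" .
qed (auto intro: smooth_span.base)

definition conv :: "(real ^ 'n \<Rightarrow> complex) \<Rightarrow> (real ^ 'n \<Rightarrow> complex) \<Rightarrow> real ^ 'n \<Rightarrow> complex" where
  "conv f \<psi> x = (LINT y|lborel. f y * \<psi> (x - y))"

lemma pd_zero_outside:
  assumes "\<And>x. norm x > r \<Longrightarrow> \<psi> x = 0" "norm x > r"
  shows "pd i \<psi> x = 0"
proof -
  have "(\<psi> has_derivative (\<lambda>_. 0)) (at x)"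
  proof (rule has_derivative_transform_within_open[OF has_derivative_const, where s="- cball 0 r"])
    show "x \<in> - cball 0 r" using assms(2) by simp
    show "0 = \<psi> y" if "y \<in> - cball 0 r" for y using assms(1)[of y] that by auto
  qed auto
  then show ?thesis by (subst pd_eqI) auto
qed

lemma conv_eq_integral:
  assumes f: "continuous_on UNIV f" and \<psi>: "smooth \<psi>" "\<And>x. norm x > r \<Longrightarrow> \<psi> x = 0"
    and R: "cball 0 (norm x + r) \<subseteq> cbox a b"
  shows "conv f \<psi> x = integral (cbox a b) (\<lambda>y. f y * \<psi> (x - y))"
proof -
  have "conv f \<psi> x = (LINT y:cbox a b|lborel. f y * \<psi> (x - y))"
    unfolding conv_def set_lebesgue_integral_def
  proof (intro Bochner_Integration.integral_cong refl)
    fix y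
    show "f y * \<psi> (x - y) = indicator (cbox a b) y *\<^sub>R (f y * \<psi> (x - y))"
    proof (cases "y \<in> cbox a b")
      case False
      then have "norm y > norm x + r" using R by (meson mem_cball_0 not_le subsetD)
      then have "norm (x - y) > r" using norm_triangle_ineq4[of x "x - y"] by (smt (verit) add_diff_cancel_left' diff_diff_eq2 norm_minus_commute norm_triangle_sub)
      then show ?thesis using \<psi>(2) by simp
    qed simp
  qed
  also have "\<dots> = integral (cbox a b) (\<lambda>y. f y * \<psi> (x - y))"
  proof (rule set_borel_integral_eq_integral)
    show "set_integrable lborel (cbox a b) (\<lambda>y. f y * \<psi> (x - y))"
      unfolding set_integrable_def
      by (rule integrable_on_compact_indicator)
         (auto intro!: continuous_intros continuous_on_compose2[OF f] continuous_on_compose2[OF smooth_continuous[OF \<psi>(1), of UNIV]])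
  qed
  finally show ?thesis .
qed

text \<open>For \<open>y\<close> in the unit ball around \<open>x\<close> the integrand is supported
  in one fixed box, so the Leibniz rule on this box applies. \<open>F\<close> packages the
  derivative as a bounded linear map, the form in which that rule wants it.\<close>

lemma conv_has_derivative:
  assumes f: "continuous_on UNIV f" and \<psi>: "smooth \<psi>" "\<And>x. norm x > r \<Longrightarrow> \<psi> x = 0"
  shows "(conv f \<psi> has_derivative (\<lambda>h. \<Sum>i\<in>UNIV. (h $ i) *\<^sub>R conv f (pd i \<psi>) x)) (at x)"
proof -
  obtain c :: "real ^ 'a" where "cball 0 (norm x + 1 + r) \<subseteq> cbox (-c) c"
    using bounded_subset_cbox_symmetric[OF bounded_cball] by blast
  then obtain a b :: "real ^ 'a" where ab: "cball 0 (norm x + 1 + r) \<subseteq> cbox a b" by blast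
  have sub: "cball 0 (norm y + r) \<subseteq> cbox a b" if "y \<in> ball x 1" for y
  proof -
    have "norm y \<le> norm x + 1" using that norm_triangle_sub[of y x] by (simp add: dist_norm norm_minus_commute)
    then have "cball 0 (norm y + r) \<subseteq> cball (0 :: real ^ 'a) (norm x + 1 + r)" by (intro subset_cball) simp
    then show ?thesis using ab by blast
  qed
  have bl: "bounded_linear (\<lambda>h. \<Sum>i\<in>UNIV. (h $ i) *\<^sub>R (f t * pd i \<psi> (y - t)))" for y t
    by (intro bounded_linear_sum bounded_linear_scaleR_const bounded_linear_vec_nth)
  define F where "F y t = Blinfun (\<lambda>h. \<Sum>i\<in>UNIV. (h $ i) *\<^sub>R (f t * pd i \<psi> (y - t)))" for y t
  have F: "blinfun_apply (F y t) h = (\<Sum>i\<in>UNIV. (h $ i) *\<^sub>R (f t * pd i \<psi> (y - t)))" for y t h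
    unfolding F_def by (simp add: bounded_linear_Blinfun_apply[OF bl])
  have cp: "continuous_on S (\<lambda>p. f (snd p) * pd i \<psi> (fst p - snd p))" for S :: "((real ^ 'a) \<times> (real ^ 'a)) set" and i
    by (intro continuous_on_mult continuous_on_compose2[OF f] continuous_on_compose2[OF smooth_continuous[OF smooth_pd[OF \<psi>(1)], of UNIV]] continuous_intros) auto
  have cF: "continuous_on S (\<lambda>p. F (fst p) (snd p))" for S :: "((real ^ 'a) \<times> (real ^ 'a)) set"
    by (intro continuous_on_blinfun_componentwise) (auto simp: F intro!: continuous_on_sum continuous_on_scaleR cp continuous_intros)
  have "((\<lambda>y. integral (cbox a b) (\<lambda>t. f t * \<psi> (y - t))) has_derivative blinfun_apply (integral (cbox a b) (F x))) (at x within ball x 1)"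
  proof (rule leibniz_rule)
    show "((\<lambda>y. f t * \<psi> (y - t)) has_derivative blinfun_apply (F y t)) (at y within ball x 1)" for y t
    proof -
      have "((\<lambda>y. \<psi> (y - t)) has_derivative (\<lambda>h. \<Sum>i\<in>UNIV. (h $ i) *\<^sub>R pd i \<psi> (y - t))) (at y within ball x 1)"
        by (rule has_derivative_compose[OF _ smooth_has_pd[OF \<psi>(1)]]) (auto intro!: derivative_eq_intros)
      from has_derivative_mult_right[OF this, of "f t"] show ?thesis
        unfolding F by (simp add: sum_distrib_left mult_scaleR_right)
    qed
    show "(\<lambda>t. f t * \<psi> (y - t)) integrable_on cbox a b" for y
      by (rule integrable_continuous)
         (auto intro!: continuous_intros continuous_on_compose2[OF f] continuous_on_compose2[OF smooth_continuous[OF \<psi>(1), of UNIV]])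
    show "continuous_on (ball x 1 \<times> cbox a b) (\<lambda>(y, t). F y t)"
      unfolding case_prod_beta by (rule cF)
    show "x \<in> ball x 1" "convex (ball x 1)" by simp_all
  qed
  then have "((\<lambda>y. integral (cbox a b) (\<lambda>t. f t * \<psi> (y - t))) has_derivative blinfun_apply (integral (cbox a b) (F x))) (at x)"
    by (simp only: at_within_open[OF centre_in_ball[THEN iffD2, OF zero_less_one] open_ball])
  then have "(conv f \<psi> has_derivative blinfun_apply (integral (cbox a b) (F x))) (at x)"
  proof (rule has_derivative_transform_within_open[where s="ball x 1"])
    show "integral (cbox a b) (\<lambda>t. f t * \<psi> (y - t)) = conv f \<psi> y" if "y \<in> ball x 1" for y
      by (rule conv_eq_integral[OF f \<psi> sub[OF that], symmetric])
  qed simp_all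
  moreover have "blinfun_apply (integral (cbox a b) (F x)) h = (\<Sum>i\<in>UNIV. (h $ i) *\<^sub>R conv f (pd i \<psi>) x)" for h
  proof -
    have cx: "continuous_on (cbox a b) (F x)"
      by (rule continuous_on_uncurry_compose[where g=F and a="\<lambda>_. x" and b="\<lambda>t. t"])
         (simp_all only: case_prod_unfold cF continuous_on_const continuous_on_id)
    have ci: "continuous_on (cbox a b) (\<lambda>t. f t * pd i \<psi> (x - t))" for i
      by (rule continuous_on_uncurry_compose[where g="\<lambda>y t. f t * pd i \<psi> (y - t)" and a="\<lambda>_. x" and b="\<lambda>t. t"])
         (simp_all only: case_prod_unfold cp continuous_on_const continuous_on_id)
    have "blinfun_apply (integral (cbox a b) (F x)) h = integral (cbox a b) (\<lambda>t. \<Sum>i\<in>UNIV. (h $ i) *\<^sub>R (f t * pd i \<psi> (x - t)))"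
      by (subst blinfun_apply_integral[OF integrable_continuous[OF cx]]) (simp add: F)
    also have "\<dots> = (\<Sum>i\<in>UNIV. (h $ i) *\<^sub>R integral (cbox a b) (\<lambda>t. f t * pd i \<psi> (x - t)))"
      by (subst integral_sum) (simp_all only: integrable_cmul[OF integrable_continuous[OF ci]] integral_cmul finite)
    also have "\<dots> = (\<Sum>i\<in>UNIV. (h $ i) *\<^sub>R conv f (pd i \<psi>) x)"
    proof (intro sum.cong refl)
      fix i
      have "conv f (pd i \<psi>) x = integral (cbox a b) (\<lambda>t. f t * pd i \<psi> (x - t))"
        by (rule conv_eq_integral[OF f smooth_pd[OF \<psi>(1)], where r=r]) (use pd_zero_outside \<psi>(2) sub in auto)
      then show "(h $ i) *\<^sub>R integral (cbox a b) (\<lambda>t. f t * pd i \<psi> (x - t)) = (h $ i) *\<^sub>R conv f (pd i \<psi>) x" by simp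
    qed
    finally show ?thesis .
  qed
  then have "blinfun_apply (integral (cbox a b) (F x)) = (\<lambda>h. \<Sum>i\<in>UNIV. (h $ i) *\<^sub>R conv f (pd i \<psi>) x)" by (rule ext)
  ultimately show ?thesis by simp
qed

text \<open>Convolutions with kernels supported in the ball of radius \<open>r\<close> are closed
  under \<open>pd\<close>, since the derivative falls on the kernel.\<close>

lemma smooth_conv:
  assumes f: "continuous_on UNIV f" and "smooth \<psi>" "\<And>x. norm x > r \<Longrightarrow> \<psi> x = 0"
  shows "smooth (conv f \<psi>)"
proof -
  define B where "B = {conv f \<psi> |\<psi>. smooth \<psi> \<and> (\<forall>x. norm x > r \<longrightarrow> \<psi> x = 0)}"
  show ?thesis
  proof (rule smooth_upto[where B=B])
    fix h x assume "h \<in> B"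
    then show "h differentiable (at x)" unfolding B_def using conv_has_derivative[OF f] differentiable_def by blast
  next
    fix h i assume "h \<in> B"
    then obtain \<psi> where \<psi>: "smooth \<psi>" "\<And>x. norm x > r \<Longrightarrow> \<psi> x = 0" "h = conv f \<psi>" by (auto simp: B_def)
    have "pd i h x = conv f (pd i \<psi>) x" for x
      unfolding \<psi>(3) by (subst pd_eqI[OF conv_has_derivative[OF f \<psi>(1,2)]])
        (auto simp: axis_def if_distrib if_distribR cong: if_cong)
    then have "pd i h = conv f (pd i \<psi>)" by (rule ext)
    then show "pd i h \<in> smooth_span B"
      using \<psi> by (auto simp: B_def intro!: smooth_span.base exI[of _ "pd i \<psi>"] smooth_pd pd_zero_outside[where r=r])
  next
    show "conv f \<psi> \<in> smooth_span B" using assms by (auto simp: B_def intro!: smooth_span.base)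
  qed
qed

lemma conv_flip:
  fixes f \<psi> :: "real ^ 'n \<Rightarrow> complex"
  assumes "continuous_on UNIV f" "continuous_on UNIV \<psi>"
  shows "conv f \<psi> x = (LINT w|lborel. f (x - w) * \<psi> w)"
proof -
  have [measurable]: "f \<in> borel_measurable borel" "\<psi> \<in> borel_measurable borel"
    using assms by (auto intro: borel_measurable_continuous_onI)
  have "(LINT w|lborel. f (x - w) * \<psi> w) = (LINT w|lborel. f (x + w) * \<psi> (- w))"
    using integral_orthogonal_image[of uminus "\<lambda>w. f (x + w) * \<psi> (- w)"]
    by (simp add: orthogonal_transformation_neg orthogonal_transformation_id[unfolded id_def])
  also have "\<dots> = (LINT w|lborel. f w * \<psi> (x - w))"
    using lborel_integral_translate[of "\<lambda>w. f w * \<psi> (x - w)" x] by simp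
  finally show ?thesis by (simp add: conv_def)
qed

text \<open>A convolution is a weighted superposition of translates of \<open>f\<close>, whose
  integrals over copies all vanish; Fubini exchanges the two integrations.\<close>

lemma copy_integral_zero_conv:
  assumes P: "compact P" and f: "continuous_on UNIV f" "copy_integral_zero P f"
    and \<psi>: "smooth \<psi>" "\<And>x. norm x > r \<Longrightarrow> \<psi> x = 0"
  shows "copy_integral_zero P (conv f \<psi>)"
  unfolding copy_integral_zero_def
proof (intro allI impI)
  fix a :: "real ^ 'a" and g :: "real ^ 'a \<Rightarrow> real ^ 'a" assume g: "orthogonal_transformation g"
  \<comment> \<open>Restricting \<open>w\<close> to the ball leaves the values unchanged, as
    \<open>\<psi>\<close> vanishes outside, and makes the integrand compactly supported on the
    product.\<close>
  define H where "H z w = indicator (P \<times> cball 0 r) (z, w) *\<^sub>R (f (a + g z - w) * \<psi> w)" for z w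
  have H: "H z w = indicator P z *\<^sub>R (f (a + g z - w) * \<psi> w)" for z w
    using \<psi>(2)[of w] by (cases "norm w > r") (auto simp: H_def indicator_def)
  have c: "continuous_on UNIV (\<lambda>p. f (a + g (fst p) - snd p) * \<psi> (snd p))"
    by (intro continuous_on_mult continuous_on_compose2[OF f(1)] continuous_on_compose2[OF smooth_continuous[OF \<psi>(1), of UNIV]]
        continuous_intros continuous_on_compose2[OF orthogonal_continuous_on[OF g, of UNIV]]) auto
  have "integrable (lborel \<Otimes>\<^sub>M lborel) (case_prod H)"
    unfolding lborel_prod H_def case_prod_beta
    using integrable_on_compact_indicator[OF compact_Times[OF P compact_cball] c, of 0 r] by simp
  then have "(LINT w|lborel. LINT z|lborel. H z w) = (LINT z|lborel. LINT w|lborel. H z w)"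
    by (rule lborel_pair.Fubini_integral)
  moreover have "(LINT z|lborel. H z w) = 0" for w
  proof -
    have "(LINT z|lborel. H z w) = (LINT z|lborel. (indicator P z *\<^sub>R f ((a - w) + g z)) * \<psi> w)"
      unfolding H by (simp add: algebra_simps)
    also have "\<dots> = 0" using copy_integral_zeroD[OF f(2) g, of "a - w"] by (simp only: integral_mult_left_zero mult_zero_left)
    finally show ?thesis .
  qed
  moreover have "(LINT w|lborel. H z w) = indicator P z *\<^sub>R conv f \<psi> (a + g z)" for z
    unfolding H conv_flip[OF f(1) smooth_continuous[OF \<psi>(1)]] by simp
  ultimately show "(LINT y|lborel. indicator P y *\<^sub>R conv f \<psi> (a + g y)) = 0" by simp
qed

lemma ex_smooth_copy_integral_zero:
  fixes f :: "real ^ 'n \<Rightarrow> complex"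
  assumes P: "compact P" and f: "continuous_on UNIV f" "copy_integral_zero P f" "f x \<noteq> 0"
  shows "\<exists>h. smooth h \<and> copy_integral_zero P h \<and> h \<noteq> (\<lambda>_. 0)"
proof -
  have "isCont f x" using f(1) by (simp add: continuous_on_eq_continuous_at)
  then obtain d where d: "d > 0" "\<And>y. dist y x < d \<Longrightarrow> dist (f y) (f x) < norm (f x) / 2"
    using f(3) unfolding continuous_at_eps_delta by (metis half_gt_zero zero_less_norm_iff)
  \<comment> \<open>Shrinks the unit ball carrying \<open>bump 0\<close> to radius
    \<open>d / 2\<close>, well inside the ball where \<open>f\<close> deviates from
    \<open>f x\<close> by less than half of \<open>norm (f x)\<close>; the weighted average at
    \<open>x\<close> then cannot vanish.\<close>
  define c where "c = 2 / d"
  have c: "c > 0" using d by (simp add: c_def)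
  define \<psi> where "\<psi> y = bump 0 (0 + c *\<^sub>R y)" for y :: "real ^ 'n"
  have \<psi>s: "smooth \<psi>" unfolding \<psi>_def[abs_def]
    by (rule smooth_affine_comp(1)) (auto intro: linear_scaleR smooth_bump)
  define \<phi> where "\<phi> y = flat 0 (1 - (c *\<^sub>R y) \<bullet> (c *\<^sub>R y))" for y :: "real ^ 'n"
  have \<psi>\<phi>: "\<psi> y = complex_of_real (\<phi> y)" for y by (simp add: \<psi>_def \<phi>_def bump_def)
  have \<phi>0: "\<phi> y \<ge> 0" for y by (simp add: \<phi>_def flat_def)
  have \<phi>z: "\<phi> y = 0" if "norm y > d / 2" for y
  proof -
    have "norm (c *\<^sub>R y) > 1" using that d by (simp add: c_def field_simps)
    then have "(c *\<^sub>R y) \<bullet> (c *\<^sub>R y) > 1" by (metis dot_square_norm one_less_power pos2)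
    then show ?thesis unfolding \<phi>_def flat_def by simp
  qed
  have z: "\<psi> y = 0" if "norm y > d / 2" for y using \<phi>z[OF that] by (simp add: \<psi>\<phi>)
  have \<psi>c: "continuous_on UNIV \<psi>" by (rule smooth_continuous[OF \<psi>s])
  have \<phi>c: "continuous_on UNIV \<phi>"
  proof -
    have "continuous_on UNIV (\<lambda>y. Re (\<psi> y))" by (intro continuous_intros \<psi>c)
    then show ?thesis by (simp add: \<psi>\<phi>)
  qed
  define K :: "(real ^ 'n) set" where "K = cball 0 (d / 2)"
  have ind: "indicator K y *\<^sub>R \<psi> y = \<psi> y" "indicator K y *\<^sub>R \<phi> y = \<phi> y" for y
    using z[of y] \<phi>z[of y] by (cases "norm y > d / 2"; simp add: K_def indicator_def)+
  have i1: "integrable lborel (\<lambda>y. f (x - y) * \<psi> y)"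
  proof -
    have "integrable lborel (\<lambda>y. indicator K y *\<^sub>R (f (x - y) * \<psi> y))"
      by (rule integrable_on_compact_indicator) (auto simp: K_def intro!: continuous_on_mult \<psi>c continuous_on_compose2[OF f(1)] continuous_intros)
    then show ?thesis by (simp add: ind flip: mult_scaleR_right)
  qed
  have i2: "integrable lborel \<psi>"
    using integrable_on_compact_indicator[of K \<psi>] \<psi>c by (simp add: ind K_def[symmetric]) (simp add: K_def)
  have i3: "integrable lborel \<phi>" using integrable_bounded_linear[OF bounded_linear_Re i2] by (simp add: \<psi>\<phi>)
  have pos: "(LINT y|lborel. \<phi> y) > 0"
  proof -
    have "(LINT y|lborel. \<phi> y) \<noteq> 0"
    proof
      assume "(LINT y|lborel. \<phi> y) = 0"
      then have "AE y in lborel. \<phi> y = 0"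
        using integral_nonneg_eq_0_iff_AE[OF i3] \<phi>0 by simp
      moreover have op: "open {y. \<phi> y \<noteq> 0}" using \<phi>c by (intro open_Collect_neq continuous_on_const)
      moreover have "{y. \<phi> y \<noteq> 0} \<in> sets lborel" using op by simp
      ultimately have "{y. \<phi> y \<noteq> 0} \<in> null_sets lborel"
        using AE_iff_null[of lborel "\<lambda>y. \<phi> y = 0"] by simp
      moreover note op
      ultimately have "{y. \<phi> y \<noteq> 0} = {}" 
        using open_not_negligible by (metis negligible_iff_null_sets null_sets_completionI)
      moreover have "\<phi> 0 \<noteq> 0" by (simp add: \<phi>_def flat_def)
      ultimately show False by blast
    qed
    moreover have "(LINT y|lborel. \<phi> y) \<ge> 0" by (intro integral_nonneg_AE) (simp add: \<phi>0)
    ultimately show ?thesis by simp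
  qed
  have "conv f \<psi> x \<noteq> 0"
  proof
    assume 0: "conv f \<psi> x = 0"
    have "conv f \<psi> x - f x * (LINT y|lborel. \<psi> y) = (LINT y|lborel. (f (x - y) - f x) * \<psi> y)"
      unfolding conv_flip[OF f(1) \<psi>c] using i1 i2 by (simp add: left_diff_distrib)
    then have "norm (f x * (LINT y|lborel. \<psi> y)) = norm (LINT y|lborel. (f (x - y) - f x) * \<psi> y)"
      using 0 by (metis diff_0 norm_minus_cancel)
    also have "\<dots> \<le> (LINT y|lborel. norm (f x) / 2 * \<phi> y)"
    proof (rule order_trans[OF integral_norm_bound], rule integral_mono)
      show "integrable lborel (\<lambda>y. norm ((f (x - y) - f x) * \<psi> y))"
        using i1 i2 by (intro integrable_norm) (simp add: left_diff_distrib)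
      show "integrable lborel (\<lambda>y. norm (f x) / 2 * \<phi> y)" using i3 by simp
      show "norm ((f (x - y) - f x) * \<psi> y) \<le> norm (f x) / 2 * \<phi> y" for y
      proof (cases "norm y > d / 2")
        case False
        then have "dist (x - y) x < d" using d(1) by (simp add: dist_norm)
        then have "norm (f (x - y) - f x) \<le> norm (f x) / 2" using d(2)[of "x - y"] by (simp add: dist_norm)
        from mult_right_mono[OF this \<phi>0[of y]] show ?thesis using \<phi>0[of y] by (simp add: norm_mult \<psi>\<phi>)
      qed (simp add: z \<phi>z)
    qed
    also have "\<dots> = norm (f x) / 2 * (LINT y|lborel. \<phi> y)" by simp
    also have "norm (f x * (LINT y|lborel. \<psi> y)) = norm (f x) * (LINT y|lborel. \<phi> y)"
      using pos by (simp add: \<psi>\<phi>[abs_def] norm_mult)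
    finally show False using pos f(3) by simp
  qed
  then have "conv f \<psi> \<noteq> (\<lambda>_. 0)" by (metis (full_types))
  moreover have "smooth (conv f \<psi>)" by (rule smooth_conv[OF f(1) \<psi>s z])
  moreover have "copy_integral_zero P (conv f \<psi>)" by (rule copy_integral_zero_conv[OF P f(1,2) \<psi>s z])
  ultimately show ?thesis by blast
qed


section \<open>Rotating the vertex relation\<close>

definition complexified :: "(real ^ 'n \<Rightarrow> real ^ 'n) \<Rightarrow> complex ^ 'n \<Rightarrow> complex ^ 'n" where
  "complexified g z = (\<chi> k. \<Sum>i\<in>UNIV. z $ i * complex_of_real (g (axis i 1) $ k))"

lemma complexified_add: "complexified g (z + w) = complexified g z + complexified g w"
  by (simp add: complexified_def vec_eq_iff algebra_simps sum.distrib)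

lemma orthogonal_columns:
  fixes g :: "real ^ 'n \<Rightarrow> real ^ 'n"
  assumes "orthogonal_transformation g"
  shows "(\<Sum>k\<in>UNIV. g (axis i 1) $ k * g (axis j 1) $ k) = (if i = j then 1 else (0::real))"
proof -
  have "g (axis i 1) \<bullet> g (axis j 1) = axis i 1 \<bullet> axis j (1::real)"
    using assms by (simp add: orthogonal_transformation_def)
  moreover have "axis i 1 \<bullet> axis j (1::real) = (if i = j then 1 else 0)" by (simp add: inner_axis_axis)
  ultimately show ?thesis by (simp add: inner_vec_def[of "g _"])
qed

lemma sum_squares_complexified:
  fixes g :: "real ^ 'n \<Rightarrow> real ^ 'n"
  assumes "orthogonal_transformation g"
  shows "(\<Sum>k\<in>UNIV. (complexified g z $ k)\<^sup>2) = (\<Sum>k\<in>UNIV. (z $ k)\<^sup>2)"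
proof -
  have "(\<Sum>k\<in>UNIV. (complexified g z $ k)\<^sup>2)
      = (\<Sum>k\<in>UNIV. \<Sum>i\<in>UNIV. \<Sum>j\<in>UNIV. z $ i * z $ j * complex_of_real (g (axis i 1) $ k * g (axis j 1) $ k))"
    by (simp add: complexified_def power2_eq_square sum_product mult_ac)
  also have "\<dots> = (\<Sum>i\<in>UNIV. \<Sum>k\<in>UNIV. \<Sum>j\<in>UNIV. z $ i * z $ j * complex_of_real (g (axis i 1) $ k * g (axis j 1) $ k))"
    by (rule sum.swap)
  also have "\<dots> = (\<Sum>i\<in>UNIV. \<Sum>j\<in>UNIV. \<Sum>k\<in>UNIV. z $ i * z $ j * complex_of_real (g (axis i 1) $ k * g (axis j 1) $ k))"
    by (intro sum.cong refl sum.swap)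
  also have "\<dots> = (\<Sum>i\<in>UNIV. \<Sum>j\<in>UNIV. z $ i * z $ j * complex_of_real (if i = j then 1 else 0))"
    by (simp only: sum_distrib_left[symmetric] of_real_sum[symmetric] orthogonal_columns[OF assms])
  also have "\<dots> = (\<Sum>k\<in>UNIV. (z $ k)\<^sup>2)"
    by (simp add: power2_eq_square if_distrib cong: if_cong)
  finally show ?thesis .
qed

lemma orthogonal_adjoint_entry:
  fixes g :: "real ^ 'n \<Rightarrow> real ^ 'n"
  assumes g: "orthogonal_transformation g" and h: "\<And>x. g (h x) = x"
  shows "g (axis i 1) $ k = h (axis k 1) $ i"
proof -
  have "g (axis i 1) \<bullet> axis k 1 = g (axis i 1) \<bullet> g (h (axis k 1))" by (simp add: h)
  also have "\<dots> = axis i 1 \<bullet> h (axis k 1)" using g by (simp add: orthogonal_transformation_def)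
  finally show ?thesis by (simp add: inner_axis inner_axis' inner_real_def)
qed

lemma linear_axis_expansion: "linear g \<Longrightarrow> g y = (\<Sum>i\<in>UNIV. (y $ i) *\<^sub>R g (axis i (1::real)))"
  by (subst axis_sum_expansion[symmetric]) (simp only: linear_sum linear_cmul)

text \<open>The transpose of an orthogonal map is its inverse, which is why \<open>h\<close> appears
  on the right.\<close>

lemma cdot_rotate:
  fixes g :: "real ^ 'n \<Rightarrow> real ^ 'n"
  assumes g: "orthogonal_transformation g" and h: "\<And>x. g (h x) = x"
  shows "cdot z (of_real_vec (g y)) = cdot (complexified h z) (of_real_vec y)"
proof -
  have "g y $ k = (\<Sum>i\<in>UNIV. y $ i * h (axis k 1) $ i)" for k
    by (subst linear_axis_expansion[OF orthogonal_transformation_linear[OF g]])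
       (simp add: orthogonal_adjoint_entry[OF assms])
  then have "cdot z (of_real_vec (g y)) = (\<Sum>k\<in>UNIV. \<Sum>i\<in>UNIV. z $ k * complex_of_real (y $ i * h (axis k 1) $ i))"
    by (simp add: cdot_of_real_vec sum_distrib_left)
  also have "\<dots> = (\<Sum>i\<in>UNIV. \<Sum>k\<in>UNIV. z $ k * complex_of_real (y $ i * h (axis k 1) $ i))"
    by (rule sum.swap)
  also have "\<dots> = cdot (complexified h z) (of_real_vec y)"
    by (simp add: cdot_of_real_vec complexified_def sum_distrib_left sum_distrib_right mult_ac)
  finally show ?thesis .
qed

lemma complexified_surj:
  fixes g :: "real ^ 'n \<Rightarrow> real ^ 'n"
  assumes g: "orthogonal_transformation g" and h: "\<And>x. g (h x) = x"
  shows "complexified h (complexified g z) = z"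
proof -
  have "(\<Sum>k\<in>UNIV. complexified g z $ k * complex_of_real (h (axis k 1) $ i)) = z $ i" for i
  proof -
    have "(\<Sum>k\<in>UNIV. complexified g z $ k * complex_of_real (h (axis k 1) $ i))
      = (\<Sum>k\<in>UNIV. \<Sum>j\<in>UNIV. z $ j * complex_of_real (g (axis j 1) $ k * g (axis i 1) $ k))"
      unfolding orthogonal_adjoint_entry[OF assms, of i, symmetric]
      by (simp add: complexified_def sum_distrib_right mult.assoc)
    also have "\<dots> = (\<Sum>j\<in>UNIV. \<Sum>k\<in>UNIV. z $ j * complex_of_real (g (axis j 1) $ k * g (axis i 1) $ k))"
      by (rule sum.swap)
    also have "\<dots> = (\<Sum>j\<in>UNIV. z $ j * complex_of_real (if j = i then 1 else 0))"
      by (simp only: sum_distrib_left[symmetric] of_real_sum[symmetric] orthogonal_columns[OF g])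
    also have "\<dots> = z $ i" by (simp add: if_distrib cong: if_cong)
    finally show ?thesis .
  qed
  then show ?thesis by (subst (1) complexified_def) (simp add: vec_eq_iff)
qed

lemma ex_rotated_op:
  fixes g :: "real ^ 'n \<Rightarrow> real ^ 'n"
  assumes g: "linear g"
  shows "\<exists>B. \<forall>f. smooth f \<longrightarrow> (\<forall>a x. app A (\<lambda>y. f (a + g y)) x = app B f (a + g x))"
proof (induction A rule: diffop_induct)
  case (cst c)
  show ?case by (intro exI[of _ "cst c"]) (auto simp: app_cst smooth_affine_comp(1)[OF g])
next
  case (X i)
  show ?case
    by (intro exI[of _ "\<Sum>k\<in>UNIV. cst (complex_of_real (g (axis i 1) $ k)) * X k"])
       (auto simp: app_X smooth_affine_comp[OF g] app_sum app_mult app_cst smooth_pd)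
next
  case (add A B)
  then obtain A' B' where "\<forall>f. smooth f \<longrightarrow> (\<forall>a x. app A (\<lambda>y. f (a + g y)) x = app A' f (a + g x))"
    "\<forall>f. smooth f \<longrightarrow> (\<forall>a x. app B (\<lambda>y. f (a + g y)) x = app B' f (a + g x))" by blast
  then show ?case by (intro exI[of _ "A' + B'"]) (auto simp: app_add)
next
  case (mult A B)
  then obtain A' B' where A': "\<And>f a x. smooth f \<Longrightarrow> app A (\<lambda>y. f (a + g y)) x = app A' f (a + g x)"
    and B': "\<And>f a x. smooth f \<Longrightarrow> app B (\<lambda>y. f (a + g y)) x = app B' f (a + g x)" by blast
  have "app (A * B) (\<lambda>y. f (a + g y)) x = app (A' * B') f (a + g x)" if f: "smooth f" for f a x
  proof -
    have "app B (\<lambda>y. f (a + g y)) = (\<lambda>y. app B' f (a + g y))" using B'[OF f] by (rule ext)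
    then show ?thesis using A'[OF smooth_app[OF f]] by (simp add: app_mult)
  qed
  then show ?case by blast
qed

text \<open>An exponential composed with \<open>g\<close> is again an exponential, so both symbols
  can be read off from one test function.\<close>

lemma rotated_op_symbol:
  fixes g :: "real ^ 'n \<Rightarrow> real ^ 'n"
  assumes g: "orthogonal_transformation g" and h: "\<And>x. g (h x) = x"
    and B: "\<And>f a x. smooth f \<Longrightarrow> app A (\<lambda>y. f (a + g y)) x = app B f (a + g x)"
  shows "ev B z = ev A (complexified h z)"
proof -
  have g0: "g 0 = 0" using orthogonal_transformation_linear[OF g] by (rule linear_0)
  have "(\<lambda>y. cexp z (0 + g y)) = cexp (complexified h z)"
    by (auto simp: cexp_def cdot_rotate[OF g h])
  then have "app A (cexp (complexified h z)) 0 = app B (cexp z) (0 + g 0)" using B[OF smooth_cexp, of z 0 0] by simp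
  then show ?thesis by (simp add: ev_def g0)
qed

text \<open>\<open>g v $ i\<close> is the inner product of \<open>v\<close> with the unit vector
  \<open>u\<close> that \<open>g\<close> takes to axis \<open>i\<close>. So \<open>u\<close> only
  has to avoid finitely many hyperplanes, which form a null set.\<close>

lemma generic_rotation:
  fixes F :: "(real ^ 'n) set" and i :: 'n
  assumes "finite F" "0 \<notin> F"
  obtains g h :: "real ^ 'n \<Rightarrow> real ^ 'n"
  where "orthogonal_transformation g" "\<And>x. g (h x) = x" "orthogonal_transformation h"
    "\<And>v. v \<in> F \<Longrightarrow> g v $ i \<noteq> 0"
proof -
  \<comment> \<open>Including \<open>axis i 1\<close> forces \<open>a \<noteq> 0\<close> even for
    empty \<open>F\<close>.\<close>
  have "negligible (\<Union>v\<in>insert (axis i 1) F. {x. v \<bullet> x = 0})"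
  proof (rule negligible_Union)
    show "finite ((\<lambda>v. {x. v \<bullet> x = 0}) ` insert (axis i 1) F)" using assms(1) by simp
    fix H assume "H \<in> (\<lambda>v. {x. v \<bullet> x = 0}) ` insert (axis i 1) F"
    then obtain v where v: "v \<in> insert (axis i 1) F" "H = {x. v \<bullet> x = 0}" by blast
    then have "v \<noteq> 0" using assms(2) by (auto simp: axis_eq_0_iff)
    then show "negligible H" unfolding v(2) by (intro negligible_hyperplane) simp
  qed
  then have "(\<Union>v\<in>insert (axis i 1) F. {x. v \<bullet> x = 0}) \<noteq> (UNIV :: (real ^ 'n) set)"
    using non_negligible_UNIV by metis
  then obtain a where a: "\<And>v. v \<in> insert (axis i 1) F \<Longrightarrow> v \<bullet> a \<noteq> 0" by blast
  have a0: "a \<noteq> 0" using a[of "axis i 1"] by auto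
  define u where "u = a /\<^sub>R norm a"
  have u: "norm u = 1" using a0 by (simp add: u_def)
  have un: "v \<bullet> u \<noteq> 0" if "v \<in> F" for v using a[of v] that a0 by (simp add: u_def)
  have n1: "norm (axis i (1::real)) = 1" by (simp add: norm_eq_sqrt_inner inner_axis_axis)
  have "\<exists>g :: real ^ 'n \<Rightarrow> real ^ 'n. orthogonal_transformation g \<and> g u = axis i 1"
    by (rule orthogonal_transformation_exists_1[OF u n1]) blast
  then obtain g :: "real ^ 'n \<Rightarrow> real ^ 'n" where g: "orthogonal_transformation g" "g u = axis i 1" by blast
  have surj: "surj g" using g(1) by (rule orthogonal_transformation_surj)
  have h: "orthogonal_transformation (inv g)" using g(1) by (rule orthogonal_transformation_inv)
  have inv: "g (inv g x) = x" for x by (rule surj_f_inv_f[OF surj])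
  have "g v $ i \<noteq> 0" if "v \<in> F" for v
  proof -
    have "g v $ i = g v \<bullet> g u" by (simp add: g(2) inner_axis)
    also have "\<dots> = v \<bullet> u" using g(1) by (simp add: orthogonal_transformation_def)
    finally show ?thesis using un[OF that] by simp
  qed
  then show ?thesis by (rule that[OF g(1) inv h])
qed

section \<open>The vertex formula and its rotated form\<close>

definition vertex_formula ::
  "(real ^ 'n) set \<Rightarrow> (real ^ 'n) list \<Rightarrow> (real ^ 'n) set \<Rightarrow> (real ^ 'n \<Rightarrow> 'n::finite diffop) \<Rightarrow> bool" where
  "vertex_formula P ds V p \<longleftrightarrow> 0 \<notin> set ds \<and> finite V \<and>
     (\<forall>f. smooth f \<longrightarrow> (LINT y|lborel. indicator P y *\<^sub>R app (prod_list (map dirop ds)) f y) = (\<Sum>v\<in>V. app (p v) f v)) \<and>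
     (\<forall>z. ev (prod_list (map dirop ds)) z \<noteq> 0 \<longrightarrow> (\<exists>v\<in>V. ev (p v) z \<noteq> 0))"

lemma ev_dirops: "ev (prod_list (map dirop ds)) z = (\<Prod>d\<leftarrow>ds. cdot z (of_real_vec d))"
  by (induction ds) (simp_all add: ev_dirop)

lemma ex_vertex_formula:
  fixes P :: "(real ^ 'n) set"
  assumes P: "vertex_set_integral P" "compact P" "measure lborel P > 0"
  shows "\<exists>ds V p. vertex_formula P ds V p"
proof -
  obtain ds k where ds: "0 \<notin> set ds"
    "point_sum k (\<lambda>f. LINT y|lborel. indicator P y *\<^sub>R app (prod_list (map dirop ds)) f y)"
    using P(1) by (auto simp: vertex_set_integral_def)
  then obtain V p where V: "finite V" "\<And>v. homogeneous k (p v)"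
    "\<And>f. smooth f \<Longrightarrow> (LINT y|lborel. indicator P y *\<^sub>R app (prod_list (map dirop ds)) f y) = (\<Sum>v\<in>V. app (p v) f v)"
    by (auto simp: point_sum_def)
  have nv: "\<exists>v\<in>V. ev (p v) z \<noteq> 0" if z: "ev (prod_list (map dirop ds)) z \<noteq> 0" for z
  proof (rule ccontr)
    assume "\<not> ?thesis"
    then have p0: "ev (p v) z = 0" if "v \<in> V" for v using that by blast
    let ?Q = "prod_list (map dirop ds)"
    \<comment> \<open>Homogeneity carries the zeros of all \<open>p v\<close>, and the non-vanishing
      of \<open>?Q\<close>, from \<open>z\<close> to every multiple \<open>c *s z\<close> with
      \<open>c \<noteq> 0\<close>.\<close>
    have I0: "(LINT y|lborel. indicator P y *\<^sub>R cexp (c *s z) y) = 0" if c: "c \<noteq> 0" for c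
    proof -
      have "ev ?Q (c *s z) * (LINT y|lborel. indicator P y *\<^sub>R cexp (c *s z) y)
          = (LINT y|lborel. indicator P y *\<^sub>R app ?Q (cexp (c *s z)) y)"
        unfolding app_cexp by (simp add: mult_scaleR_right[symmetric] del: mult_scaleR_right)
      also have "\<dots> = (\<Sum>v\<in>V. app (p v) (cexp (c *s z)) v)" by (rule V(3)[OF smooth_cexp])
      also have "\<dots> = 0" using V(2) p0 by (simp add: app_cexp homogeneous_def)
      finally have "ev ?Q (c *s z) * (LINT y|lborel. indicator P y *\<^sub>R cexp (c *s z) y) = 0" .
      moreover have "ev ?Q (c *s z) \<noteq> 0"
        using homogeneous_dirops[of ds] c z by (simp add: homogeneous_def)
      ultimately show ?thesis by simp
    qed
    define F where "F s y = cexp (complex_of_real s *s z) y" for s y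
    have Fc: "continuous_on UNIV (\<lambda>(s, y). F s y)"
      unfolding F_def cexp_def cdot_of_real_vec case_prod_beta by (auto intro!: continuous_intros)
    obtain B where B: "\<And>s y. s \<in> {0..1} \<Longrightarrow> y \<in> P \<Longrightarrow> norm (F s y) \<le> B"
    proof -
      have "compact ((\<lambda>(s, y). F s y) ` ({0..1} \<times> P))"
        by (intro compact_continuous_image continuous_on_subset[OF Fc] compact_Times P) auto
      then show ?thesis using that compact_imp_bounded bounded_iff
        by (metis (mono_tags, lifting) SigmaI case_prod_conv image_eqI)
    qed
    define s where "s n = 1 / real (Suc n)" for n
    have s: "0 < s n" "s n \<le> 1" for n by (auto simp: s_def)
    have "s \<longlonglongrightarrow> 0" unfolding s_def by (rule LIMSEQ_Suc[OF lim_1_over_n])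
    have Pm [measurable]: "P \<in> sets borel" using P(2) by (rule borel_compact)
    have Fs: "continuous_on UNIV (F s)" for s
      by (rule continuous_on_uncurry_compose[OF Fc, where a="\<lambda>_. s" and b="\<lambda>y. y"]) (intro continuous_intros)+
    have "(\<lambda>n. LINT y|lborel. indicator P y *\<^sub>R F (s n) y) \<longlonglongrightarrow> (LINT y|lborel. indicator P y *\<^sub>R F 0 y)"
    proof (rule integral_dominated_convergence[where w="\<lambda>y. indicator P y *\<^sub>R B"])
      show "(\<lambda>y. indicator P y *\<^sub>R F t y) \<in> borel_measurable lborel" for t
        using borel_measurable_continuous_onI[OF Fs[of t]] by simp
      then show "(\<lambda>y. indicator P y *\<^sub>R F (s n) y) \<in> borel_measurable lborel" for n .
      show "integrable lborel (\<lambda>y. indicator P y *\<^sub>R B)"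
        using P(2) by (intro integrable_scaleR_left integrable_real_indicator)
          (use emeasure_compact_finite[OF P(2)] in \<open>auto simp: less_top\<close>)
      show "AE y in lborel. (\<lambda>n. indicator P y *\<^sub>R F (s n) y) \<longlonglongrightarrow> indicator P y *\<^sub>R F 0 y"
      proof (intro AE_I2 tendsto_scaleR tendsto_const)
        fix y
        have "continuous_on UNIV (\<lambda>s. F s y)"
          by (rule continuous_on_uncurry_compose[OF Fc, where a="\<lambda>s. s" and b="\<lambda>_. y"]) (intro continuous_intros)+
        then have "isCont (\<lambda>s. F s y) 0" by (simp add: continuous_on_eq_continuous_at)
        then show "(\<lambda>n. F (s n) y) \<longlonglongrightarrow> F 0 y" using \<open>s \<longlonglongrightarrow> 0\<close> by (rule isCont_tendsto_compose)
      qed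
      show "AE y in lborel. norm (indicator P y *\<^sub>R F (s n) y) \<le> indicator P y *\<^sub>R B" for n
        using B[of "s n"] s[of n] by (intro AE_I2) (auto simp: indicator_def)
    qed
    moreover have "(LINT y|lborel. indicator P y *\<^sub>R F (s n) y) = 0" for n
      unfolding F_def using I0[of "complex_of_real (s n)"] s(1)[of n] by simp
    ultimately have "(LINT y|lborel. indicator P y *\<^sub>R F 0 y) = 0" by (simp add: LIMSEQ_const_iff)
    moreover have "F 0 y = 1" for y by (simp add: F_def cexp_def cdot_of_real_vec)
    moreover have "(LINT y|lborel. indicator P y *\<^sub>R (1::complex)) = of_real (measure lborel P)"
      using has_bochner_integral_integral_eq[OF has_bochner_integral_indicator[of P lborel "1::complex"]]
        emeasure_compact_finite[OF P(2)] Pm by (simp add: scaleR_conv_of_real)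
    ultimately show False using P(3) by simp
  qed
  show ?thesis unfolding vertex_formula_def using ds V nv by blast
qed


context plane
begin

text \<open>Along an orbit the form is a Laurent polynomial whose coefficient at \<open>t\<close> is
  a nonzero multiple of \<open>u $ i - \<i> * u $ j\<close>; the shift \<open>a\<close> only affects
  the constant term.\<close>

lemma linear_form_orb:
  assumes w: "ev \<zeta> z \<noteq> 0" and u: "u $ i \<noteq> 0"
  shows "\<exists>q. q \<noteq> 0 \<and> (\<forall>t. t \<noteq> 0 \<longrightarrow> cdot (a + orb z t) (of_real_vec u) = poly q t / t)"
proof -
  define C where "C = (\<Sum>m\<in>UNIV. a $ m * complex_of_real (u $ m)) + (\<Sum>m\<in>rest. z $ m * complex_of_real (u $ m))"
  define \<alpha> where "\<alpha> = ev \<zeta> z * (u $ i - \<i> * u $ j) / 2"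
  define \<beta> where "\<beta> = (z $ i - \<i> * z $ j) * (u $ i + \<i> * u $ j) / 2"
  have "complex_of_real (u $ i) - \<i> * u $ j \<noteq> 0" using u by (simp add: complex_eq_iff)
  then have "\<alpha> \<noteq> 0" using w by (simp add: \<alpha>_def)
  moreover have "cdot (a + orb z t) (of_real_vec u) = poly [:\<beta>, C, \<alpha>:] t / t" if t: "t \<noteq> 0" for t
  proof -
    have "cdot (a + orb z t) (of_real_vec u) = (\<Sum>m\<in>UNIV. a $ m * complex_of_real (u $ m)) + (\<Sum>m\<in>UNIV. orb z t $ m * complex_of_real (u $ m))"
      by (simp add: cdot_of_real_vec distrib_right sum.distrib)
    also have "(\<Sum>m\<in>UNIV. orb z t $ m * complex_of_real (u $ m))
      = orb z t $ i * complex_of_real (u $ i) + orb z t $ j * complex_of_real (u $ j) + (\<Sum>m\<in>rest. z $ m * complex_of_real (u $ m))"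
      by (simp add: sum_rest orb_coords[OF w t])
    also have "orb z t $ i * complex_of_real (u $ i) + orb z t $ j * complex_of_real (u $ j) = \<alpha> * t + \<beta> / t"
      using t unfolding orb_coords[OF w t] \<alpha>_def \<beta>_def by (simp add: field_simps)
    finally show ?thesis using t by (simp add: C_def field_simps)
  qed
  ultimately show ?thesis by (intro exI[of _ "[:\<beta>, C, \<alpha>:]"]) auto
qed

text \<open>Ensures that \<open>Q\<close> is not identically zero on a shifted sphere: along the
  orbit of the point with \<open>\<zeta> = 1\<close>, \<open>sq = l\<close> and zero
  \<open>rest\<close> coordinates, every factor is a nonzero Laurent polynomial.\<close>

lemma linear_forms_not_vanish:
  assumes "\<And>d. d \<in> set ds \<Longrightarrow> d $ i \<noteq> 0"
  shows "\<exists>z\<in>U {l}. (\<Prod>d\<leftarrow>ds. cdot (a + z) (of_real_vec d)) \<noteq> 0"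
proof -
  define z where "z = pt 1 l 0"
  have z: "z \<in> U {l}" and w: "ev \<zeta> z \<noteq> 0" by (simp_all add: z_def U_def ev_\<zeta>_pt ev_sq_pt)
  have "\<exists>q N. q \<noteq> 0 \<and> (\<forall>t. t \<noteq> 0 \<longrightarrow> (\<Prod>d\<leftarrow>ds. cdot (a + orb z t) (of_real_vec d)) = poly q t / t ^ N)"
    using assms
  proof (induction ds)
    case Nil
    show ?case by (intro exI[of _ 1] exI[of _ 0]) auto
  next
    case (Cons d ds)
    then obtain q N where q: "q \<noteq> 0" "\<And>t. t \<noteq> 0 \<Longrightarrow> (\<Prod>d\<leftarrow>ds. cdot (a + orb z t) (of_real_vec d)) = poly q t / t ^ N"
      by auto
    obtain r where r: "r \<noteq> 0" "\<And>t. t \<noteq> 0 \<Longrightarrow> cdot (a + orb z t) (of_real_vec d) = poly r t / t"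
      using linear_form_orb[OF w, of d a] Cons.prems by auto
    show ?case
      by (rule exI[of _ "r * q"], rule exI[of _ "Suc N"]) (use q r in auto)
  qed
  then obtain q N where q: "q \<noteq> 0" "\<And>t. t \<noteq> 0 \<Longrightarrow> (\<Prod>d\<leftarrow>ds. cdot (a + orb z t) (of_real_vec d)) = poly q t / t ^ N"
    by blast
  have "q * [:0, 1:] \<noteq> 0" using q(1) by simp
  then obtain t where "poly (q * [:0, 1:]) t \<noteq> 0" using poly_all_0_iff_0 by metis
  then have t: "poly q t \<noteq> 0" "t \<noteq> 0" by auto
  show ?thesis
    by (rule bexI[OF _ orb_U[OF z t(2)]]) (simp add: q(2)[OF t(2)] t)
qed

end

text \<open>The rotation is generic for the directions \<open>ds\<close>, which keeps
  \<open>Q\<close> from vanishing on spheres, and for all differences of vertices, which separates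
  the rates.\<close>

lemma rotated_vertex_formula:
  fixes P :: "(real ^ 'n) set" and i :: 'n
  assumes vf: "vertex_formula P ds V p"
  obtains g h Q W q where "orthogonal_transformation g" "orthogonal_transformation h" "\<And>x. g (h x) = x"
    "finite W" "\<And>v w. v \<in> W \<Longrightarrow> w \<in> W \<Longrightarrow> v \<noteq> w \<Longrightarrow> v $ i \<noteq> w $ i"
    "\<And>d. d \<in> set ds \<Longrightarrow> g d $ i \<noteq> 0"
    "\<And>z. ev Q z = (\<Prod>d\<leftarrow>map g ds. cdot z (of_real_vec d))"
    "\<And>f x. smooth f \<Longrightarrow> (LINT y|lborel. indicator P y *\<^sub>R app Q f (x + g y)) = (\<Sum>u\<in>W. app (q u) f (x + u))"
    "\<And>z. ev Q z \<noteq> 0 \<Longrightarrow> \<exists>u\<in>W. ev (q u) z \<noteq> 0"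
proof -
  note vf' = vf[unfolded vertex_formula_def]
  have V: "finite V" using vf' by blast
  define F where "F = set ds \<union> (\<lambda>(v, w). v - w) ` {(v, w) \<in> V \<times> V. v \<noteq> w}"
  have "finite {(v, w) \<in> V \<times> V. v \<noteq> w}" by (rule finite_subset[OF _ finite_cartesian_product[OF V V]]) blast
  then have finF: "finite F" unfolding F_def by (intro finite_UnI finite_imageI finite_set)
  have F0: "0 \<notin> F" using conjunct1[OF vf'] by (auto simp: F_def)
  obtain g h :: "real ^ 'n \<Rightarrow> real ^ 'n"
    where g: "orthogonal_transformation g" and h: "\<And>x. g (h x) = x" "orthogonal_transformation h"
    and gen: "\<And>v. v \<in> F \<Longrightarrow> g v $ i \<noteq> 0"
    by (rule generic_rotation[OF finF F0, of i]) (rule that)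
  have lin: "linear g" by (rule orthogonal_transformation_linear[OF g])
  have inj: "inj g" by (rule orthogonal_transformation_inj[OF g])
  have hg: "h (g v) = v" for v using inj h(1)[of "g v"] by (auto simp: inj_def)
  have "\<forall>A. \<exists>B. \<forall>f. smooth f \<longrightarrow> (\<forall>a x. app A (\<lambda>y. f (a + g y)) x = app B f (a + g x))"
    using ex_rotated_op[OF lin] by blast
  then obtain r where r: "\<And>A f a x. smooth f \<Longrightarrow> app A (\<lambda>y. f (a + g y)) x = app (r A) f (a + g x)" by metis
  have er: "ev (r A) z = ev A (complexified h z)" for A z
    by (rule rotated_op_symbol[OF g h(1) r])
  define Q where "Q = r (prod_list (map dirop ds))"
  define q where "q u = r (p (h u))" for u
  show ?thesis
  proof (rule that[of g h "g ` V" Q q])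
    show "orthogonal_transformation g" "orthogonal_transformation h" "\<And>x. g (h x) = x" by (fact g h)+
    show "finite (g ` V)" using V by simp
    show "v $ i \<noteq> w $ i" if vw: "v \<in> g ` V" "w \<in> g ` V" "v \<noteq> w" for v w
    proof -
      obtain v' w' where v': "v' \<in> V" "v = g v'" "w' \<in> V" "w = g w'" using vw by blast
      with vw(3) have "v' \<noteq> w'" by blast
      then have "v' - w' \<in> F" using v' by (auto simp: F_def)
      from gen[OF this] show ?thesis using v' by (simp add: linear_diff[OF lin])
    qed
    show "g d $ i \<noteq> 0" if "d \<in> set ds" for d using gen[of d] that by (simp add: F_def)
    show "ev Q z = (\<Prod>d\<leftarrow>map g ds. cdot z (of_real_vec d))" for z
      by (simp add: Q_def er ev_dirops cdot_rotate[OF g h(1)] o_def)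
    show "(LINT y|lborel. indicator P y *\<^sub>R app Q f (x + g y)) = (\<Sum>u\<in>g ` V. app (q u) f (x + u))" if f: "smooth f" for f x
    proof -
      have "(LINT y|lborel. indicator P y *\<^sub>R app Q f (x + g y))
          = (LINT y|lborel. indicator P y *\<^sub>R app (prod_list (map dirop ds)) (\<lambda>y. f (x + g y)) y)"
        unfolding Q_def r[OF f] ..
      also have "\<dots> = (\<Sum>v\<in>V. app (p v) (\<lambda>y. f (x + g y)) v)"
        using vf' smooth_affine_comp(1)[OF lin f] by blast
      also have "\<dots> = (\<Sum>v\<in>V. app (q (g v)) f (x + g v))" unfolding r[OF f] q_def hg ..
      also have "\<dots> = (\<Sum>u\<in>g ` V. app (q u) f (x + u))"
        using inj by (subst sum.reindex) (auto simp: inj_on_def inj_def)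
      finally show ?thesis .
    qed
    show "\<exists>u\<in>g ` V. ev (q u) z \<noteq> 0" if "ev Q z \<noteq> 0" for z
      using vf' that by (auto simp: Q_def q_def er hg)
  qed
qed

section \<open>Proof of the two conclusions\<close>

definition exponential_integral :: "(real ^ 'n) set \<Rightarrow> complex ^ 'n \<Rightarrow> complex" where
  "exponential_integral P z = (LINT y|lborel. indicator P y *\<^sub>R cexp z y)"

text \<open>Complexified rotations preserve the sum of squares, so the question can be moved to the
  frame in which the vertices are in general position; there the centre becomes
  \<open>complexified g a\<close>.\<close>

lemma exponential_integral_sphere:
  fixes P :: "(real ^ 'n) set"
  assumes card: "CARD('n) \<ge> 2" and vf: "vertex_formula P ds V p"
  shows "\<exists>z. (\<Sum>m\<in>UNIV. (z $ m)\<^sup>2) = l \<and> exponential_integral P (a + z) \<noteq> 0"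
proof -
  obtain i j :: 'n where ij: "i \<noteq> j"
    using card card_2_iff' by (metis (full_types) UNIV_I card_le_Suc0_iff_eq finite not_less_eq_eq numeral_2_eq_2)
  interpret plane i j by unfold_locales (rule ij)
  obtain g h Q W q where g: "orthogonal_transformation g" and h: "orthogonal_transformation h" "\<And>x. g (h x) = x"
    and W: "finite W" "\<And>v w. v \<in> W \<Longrightarrow> w \<in> W \<Longrightarrow> v \<noteq> w \<Longrightarrow> v $ i \<noteq> w $ i"
    and ds: "\<And>d. d \<in> set ds \<Longrightarrow> g d $ i \<noteq> 0"
    and Q: "\<And>z. ev Q z = (\<Prod>d\<leftarrow>map g ds. cdot z (of_real_vec d))"
    and int: "\<And>f x. smooth f \<Longrightarrow> (LINT y|lborel. indicator P y *\<^sub>R app Q f (x + g y)) = (\<Sum>u\<in>W. app (q u) f (x + u))"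
    and nv: "\<And>z. ev Q z \<noteq> 0 \<Longrightarrow> \<exists>u\<in>W. ev (q u) z \<noteq> 0"
    by (rule rotated_vertex_formula[OF vf, of i]) blast
  define I where "I z = exponential_integral P (complexified h z)" for z
  have I: "ev Q z * I z = (\<Sum>v\<in>W. ev (q v) z * cexp z v)" for z
  proof -
    have "cexp z (g y) = cexp (complexified h z) y" for y by (simp add: cexp_def cdot_rotate[OF g h(2)])
    then have "(LINT y|lborel. indicator P y *\<^sub>R app Q (cexp z) (0 + g y)) = ev Q z * I z"
      unfolding I_def exponential_integral_def app_cexp
      by (simp add: mult_scaleR_right[symmetric] del: mult_scaleR_right)
    then show ?thesis using int[OF smooth_cexp, of z 0] by (simp add: app_cexp)
  qed
  obtain z0 where z0: "z0 \<in> U {l}" "(\<Prod>d\<leftarrow>map g ds. cdot (complexified g a + z0) (of_real_vec d)) \<noteq> 0"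
    using linear_forms_not_vanish[of "map g ds" l "complexified g a"] ds by auto
  obtain z where z: "z \<in> U {l}" "I (complexified g a + z) \<noteq> 0"
    using exponential_sum_not_vanishes[OF W I nv z0(1), of "complexified g a"] z0(2) by (auto simp: Q)
  have "I (complexified g a + z) = exponential_integral P (a + complexified h z)"
    by (simp add: I_def complexified_add complexified_surj[OF g h(2)])
  moreover have "(\<Sum>m\<in>UNIV. (complexified h z $ m)\<^sup>2) = l"
    using z(1) by (simp add: sum_squares_complexified[OF h(1)] U_def ev_sq)
  ultimately show ?thesis using z(2) by auto
qed

lemma copy_integral_zero_vertex_relation:
  fixes P :: "(real ^ 'n) set"
  assumes ij: "i \<noteq> j" and vf: "vertex_formula P ds V p" and P: "compact P"
  shows "plane.vertex_relation i j {f. smooth f \<and> copy_integral_zero P f}"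
proof -
  interpret plane i j by unfold_locales (rule ij)
  obtain g h Q W q where g: "orthogonal_transformation g" and h: "orthogonal_transformation h" "\<And>x. g (h x) = x"
    and W: "finite W" "\<And>v w. v \<in> W \<Longrightarrow> w \<in> W \<Longrightarrow> v \<noteq> w \<Longrightarrow> v $ i \<noteq> w $ i"
    and ds: "\<And>d. d \<in> set ds \<Longrightarrow> g d $ i \<noteq> 0"
    and Q: "\<And>z. ev Q z = (\<Prod>d\<leftarrow>map g ds. cdot z (of_real_vec d))"
    and int: "\<And>f x. smooth f \<Longrightarrow> (LINT y|lborel. indicator P y *\<^sub>R app Q f (x + g y)) = (\<Sum>u\<in>W. app (q u) f (x + u))"
    and nv: "\<And>z. ev Q z \<noteq> 0 \<Longrightarrow> \<exists>u\<in>W. ev (q u) z \<noteq> 0"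
    by (rule rotated_vertex_formula[OF vf, of i]) blast
  have "(\<Sum>u\<in>W. app (q u) f (x + u)) = 0" if "smooth f" "copy_integral_zero P f" for f x
  proof -
    have "copy_integral_zero P (app Q f)"
      using copy_integral_zero_invariant_space[OF P] that by (auto simp: invariant_space_def)
    from copy_integral_zeroD[OF this g, of x] show ?thesis using int[OF that(1)] by simp
  qed
  moreover have "\<exists>u\<in>W. \<not> vanishes {l} (q u)" for l
  proof -
    obtain z0 where z0: "z0 \<in> U {l}" "(\<Prod>d\<leftarrow>map g ds. cdot (0 + z0) (of_real_vec d)) \<noteq> 0"
      using linear_forms_not_vanish[of "map g ds" l 0] ds by auto
    then obtain u where "u \<in> W" "ev (q u) z0 \<noteq> 0" using nv[of z0] by (auto simp: Q)
    then show ?thesis using z0(1) by (auto simp: vanishes_def)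
  qed
  ultimately show ?thesis
    unfolding vertex_relation_def using W by (intro exI[of _ W] exI[of _ q]) blast
qed

lemma lebesgue_integral_isometric_copy:
  fixes P :: "(real ^ 'n) set" and f :: "real ^ 'n \<Rightarrow> complex"
  assumes P: "compact P" and f: "continuous_on UNIV f" and g: "orthogonal_transformation g"
  shows "(LINT x:(\<lambda>y. a + g y) ` P|lebesgue. f x) = (LINT y|lborel. indicator P y *\<^sub>R f (a + g y))"
proof -
  let ?T = "\<lambda>y. a + g y"
  have inj: "inj ?T" using orthogonal_transformation_inj[OF g] by (simp add: inj_def)
  have "compact (?T ` P)"
    by (intro compact_continuous_image P continuous_intros orthogonal_continuous_on g)
  then have [measurable]: "?T ` P \<in> sets borel" by (rule borel_compact)
  have [measurable]: "f \<in> borel_measurable borel" using f by (rule borel_measurable_continuous_onI)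
  have "(LINT x:?T ` P|lebesgue. f x) = (LINT x|lborel. indicator (?T ` P) x *\<^sub>R f x)"
    unfolding set_lebesgue_integral_def by (rule integral_completion) measurable
  also have "\<dots> = (LINT x|lborel. indicator (?T ` P) (a + x) *\<^sub>R f (a + x))"
    by (rule lborel_integral_translate[symmetric]) measurable
  also have "\<dots> = (LINT x|lborel. indicator (?T ` P) (a + g x) *\<^sub>R f (a + g x))"
    by (rule integral_orthogonal_image[OF g, symmetric]) measurable
  also have "\<dots> = (LINT y|lborel. indicator P y *\<^sub>R f (a + g y))"
    using inj_image_mem_iff[OF inj] by (intro Bochner_Integration.integral_cong refl) (simp add: indicator_def)
  finally show ?thesis .
qed

lemma pompeiu_property_vertex_formula:
  fixes P :: "(real ^ 'n) set"
  assumes card: "CARD('n) \<ge> 2" and vf: "vertex_formula P ds V p" and P: "compact P" "measure lborel P > 0"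
  shows "pompeiu_property P"
  unfolding pompeiu_property_def
proof (intro conjI allI impI)
  show "bounded P" using P(1) by (rule compact_imp_bounded)
  show "P \<in> sets lebesgue" using borel_compact[OF P(1)] by simp
  fix f :: "real ^ 'n \<Rightarrow> complex" and x
  assume f: "continuous_on UNIV f" and T: "\<forall>T. euclidean_isometry T \<longrightarrow> (LINT x:T ` P|lebesgue. f x) = 0"
  have cz: "copy_integral_zero P f"
    unfolding copy_integral_zero_def
  proof (intro allI impI)
    fix a :: "real ^ 'n" and g :: "real ^ 'n \<Rightarrow> real ^ 'n" assume g: "orthogonal_transformation g"
    have "euclidean_isometry (\<lambda>y. a + g y)"
      using g by (auto simp: euclidean_isometry_def dist_norm orthogonal_transformation
          linear_diff[OF orthogonal_transformation_linear[OF g], symmetric])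
    then show "(LINT y|lborel. indicator P y *\<^sub>R f (a + g y)) = 0"
      using T lebesgue_integral_isometric_copy[OF P(1) f g, of a] by simp
  qed
  show "f x = 0"
  proof (rule ccontr)
    assume "f x \<noteq> 0"
    let ?W = "{f. smooth f \<and> copy_integral_zero P f}"
    obtain h where h: "h \<in> ?W" "h \<noteq> (\<lambda>_. 0)"
      using ex_smooth_copy_integral_zero[OF P(1) f cz \<open>f x \<noteq> 0\<close>] by blast
    obtain c where c: "c \<noteq> 0" "(\<lambda>_. c) \<in> ?W"
      using invariant_space_contains_constant[OF card copy_integral_zero_invariant_space[OF P(1)]
        copy_integral_zero_vertex_relation[OF _ vf P(1)] h] by blast
    have "(LINT y|lborel. indicator P y *\<^sub>R c) = 0"
      using c(2) copy_integral_zeroD[of P "\<lambda>_. c" "\<lambda>x. x" 0]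
      by (simp add: orthogonal_transformation_def linear_id[unfolded id_def])
    moreover have "(LINT y|lborel. indicator P y *\<^sub>R c) = measure lborel P *\<^sub>R c"
      using has_bochner_integral_integral_eq[OF has_bochner_integral_indicator[of P lborel c]]
        emeasure_compact_finite[OF P(1)] borel_compact[OF P(1)] by simp
    ultimately show False using c(1) P(2) by simp
  qed
qed

theorem theorem1p1:
  fixes P :: "nat \<Rightarrow> (real ^ 'n) set" and J :: nat
  assumes "CARD('n) \<ge> 2"
    and "J \<ge> 1"
    and "\<And>j. j \<in> {1..J} \<Longrightarrow> polytope (P j)"
    and "\<And>j. j \<in> {1..J} \<Longrightarrow> aff_dim (P j) = int CARD('n)"
    and "disjoint_family_on (\<lambda>j. interior (P j)) {1..J}"
  shows "(\<forall>(a :: complex ^ 'n) R :: complex. R \<noteq> 0 \<longrightarrow>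
            \<not> (\<forall>z \<in> complex_sphere a R. fourier_laplace_indicator (\<Union>j\<in>{1..J}. P j) z = 0))
         \<and> pompeiu_property (\<Union>j\<in>{1..J}. P j)"
proof -
  define E where "E = (\<Union>j\<in>{1..J}. P j)"
  have cE: "compact E" unfolding E_def by (intro compact_UN polytope_imp_compact assms(3)) auto
  have mE: "measure lborel E > 0"
  proof -
    have 1: "1 \<in> {1..J}" using assms(2) by simp
    have "interior (P 1) \<noteq> {}"
    proof
      assume e: "interior (P 1) = {}"
      have "aff_dim (P 1) = int DIM(real ^ 'n)" using assms(4)[OF 1] by simp
      then have "affine hull (P 1) = UNIV" using aff_dim_eq_full[of "P 1"] by simp
      then have "rel_interior (P 1) = {}" using e rel_interior_interior by blast
      then have "P 1 = {}" using rel_interior_eq_empty[OF polytope_imp_convex[OF assms(3)[OF 1]]] by simp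
      then show False using assms(4)[OF 1] by simp
    qed
    then have "\<not> negligible (interior (P 1))" by (intro open_not_negligible) auto
    moreover have "interior (P 1) \<subseteq> E" unfolding E_def by (rule order_trans[OF interior_subset UN_upper[OF 1]])
    ultimately have nn: "\<not> negligible E" using negligible_subset by blast
    have "measure lborel E \<noteq> 0"
    proof
      assume "measure lborel E = 0"
      then have "emeasure lborel E = 0"
        using emeasure_compact_finite[OF cE] by (auto simp: measure_def enn2real_eq_0_iff)
      then have "E \<in> null_sets lborel" using borel_compact[OF cE] by (simp add: null_sets_def)
      then show False using nn by (simp add: negligible_iff_null_sets null_sets_completionI)
    qed
    then show ?thesis using measure_nonneg[of lborel E] by linarith
  qed
  have "vertex_set_integral E"
    unfolding E_def using assms by (intro vertex_set_integral_polytopes) auto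
  then obtain ds V p where vf: "vertex_formula E ds V p" using ex_vertex_formula[OF _ cE mE] by blast
  have FL: "fourier_laplace_indicator E z = exponential_integral E ((- 2 * complex_of_real pi * \<i>) *s z)" for z
  proof -
    let ?c = "- 2 * complex_of_real pi * \<i>"
    have ce: "exp (?c * cdot z (of_real_vec x)) = cexp (?c *s z) x" for x
      by (simp add: cexp_def cdot_of_real_vec sum_distrib_left mult.assoc)
    have [measurable]: "E \<in> sets borel" "cexp (?c *s z) \<in> borel_measurable borel"
      by (intro borel_compact cE borel_measurable_continuous_onI smooth_continuous smooth_cexp)+
    show ?thesis
      unfolding fourier_laplace_indicator_def exponential_integral_def ce set_lebesgue_integral_def
      by (rule integral_completion) measurable
  qed
  have "\<exists>z\<in>complex_sphere a R. fourier_laplace_indicator E z \<noteq> 0" for a R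
  proof -
    define c where "c = - 2 * complex_of_real pi * \<i>"
    have c: "c \<noteq> 0" by (simp add: c_def)
    \<comment> \<open>The transform at \<open>w\<close> is the exponential integral at
      \<open>c *s w\<close>, and multiplication by \<open>c\<close> takes
      \<open>complex_sphere a R\<close> to the sphere with centre \<open>c *s a\<close> and squared
      radius \<open>c\<^sup>2 * R\<^sup>2\<close>.\<close>
    obtain z where z: "(\<Sum>m\<in>UNIV. (z $ m)\<^sup>2) = c\<^sup>2 * R\<^sup>2" "exponential_integral E (c *s a + z) \<noteq> 0"
      using exponential_integral_sphere[OF assms(1) vf, of "c\<^sup>2 * R\<^sup>2" "c *s a"] by blast
    define w where "w = a + (1 / c) *s z"
    have "(\<Sum>m\<in>UNIV. (w $ m - a $ m)\<^sup>2) = (1 / c)\<^sup>2 * (\<Sum>m\<in>UNIV. (z $ m)\<^sup>2)"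
      by (simp add: w_def power_mult_distrib sum_distrib_left power_divide)
    also have "\<dots> = R\<^sup>2" using c by (simp add: z(1) power_divide)
    finally have "w \<in> complex_sphere a R" by (simp add: complex_sphere_def)
    moreover have "c *s w = c *s a + z" using c by (simp add: w_def vec_eq_iff algebra_simps)
    moreover have "fourier_laplace_indicator E w = exponential_integral E (c *s w)"
      unfolding FL c_def ..
    ultimately show ?thesis using z(2) by (intro bexI[of _ w]) simp_all
  qed
  moreover have "pompeiu_property E" by (rule pompeiu_property_vertex_formula[OF assms(1) vf cE mE])
  ultimately show ?thesis unfolding E_def[symmetric] by blast
qed

end
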